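(* Let $r\ge2$, $n$ divisible by $r$, and $S_1,\dots,S_r$ a partition of $[n]$ with $|S_\ell|=n/r$. Let $\mathbf{B}_0(r)\in\mathbb{R}^{n\times n}$ have entries $B_0(r)_{ij}=(r-1)/n$ if $\{i,j\}\subseteq S_\ell$ for some $\ell\in[r]$, and $-1/n$ otherwise, and let $\mathbf{B}(\lambda,r)=\lambda\mathbf{B}_0(r)+\mathbf{W}$ with $\mathbf{W}\sim\mathrm{GOE}(n)$. If $\lambda>1$, then there exists $\Delta(\lambda,r)>0$ such that $\mathrm{SDP}(\mathbf{B}(\lambda,r))/n\ge2+\Delta(\lambda,r)$ with probability converging to one as $n\to\infty$.
   Context: $\mathbf{W}\sim\mathrm{GOE}(n)$: symmetric, $\{W_{ij}\}_{i\le j}$ independent, $W_{ii}\sim\mathsf{N}(0,2/n)$, $W_{ij}\sim\mathsf{N}(0,1/n)$ ($i<j$). $\mathrm{SDP}(\mathbf{M})=\max\{\mathrm{Tr}(\mathbf{M}\mathbf{X}):\ \mathbf{X}\succeq0,\ X_{ii}=1\ \forall i\}$. *)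

theory Defs
  imports "HOL-Probability.Probability" "Jordan_Normal_Form.Matrix"
begin

hide_const (open) Finite_Cartesian_Product.vec Finite_Cartesian_Product.row
  Finite_Cartesian_Product.mat
hide_type (open) Finite_Cartesian_Product.vec
unbundle no vec_syntax and no inner_syntax

text \<open>The dimension \<^term>\<open>n\<close> tends to infinity, so matrices are carrier-based; the index set
  $[n]$ becomes \<^term>\<open>{..<n}\<close> and $[r]$ becomes \<^term>\<open>{..<r}\<close>.\<close>

definition mat_trace :: "real mat \<Rightarrow> real" where
  "mat_trace A = (\<Sum>i<dim_row A. A $$ (i, i))"

definition positive_semidefinite :: "real mat \<Rightarrow> bool" where
  "positive_semidefinite A \<longleftrightarrow>
     transpose_mat A = A \<and> (\<forall>v\<in>carrier_vec (dim_row A). 0 \<le> v \<bullet> (A *\<^sub>v v))"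

definition elliptope :: "nat \<Rightarrow> real mat set" where
  "elliptope n = {X \<in> carrier_mat n n. positive_semidefinite X \<and> (\<forall>i<n. X $$ (i, i) = 1)}"

text \<open>The supremum is a maximum, see \<open>SDP_attained\<close> below.\<close>

definition SDP :: "real mat \<Rightarrow> real" where
  "SDP M = (SUP X\<in>elliptope (dim_row M). mat_trace (M * X))"

text \<open>The Borel sets of $\mathbb{R}^{n \times n}$: the least sigma-algebra making all entries
  measurable.\<close>

definition mat_borel :: "nat \<Rightarrow> real mat measure" where
  "mat_borel n = vimage_algebra (carrier_mat n n)
     (\<lambda>A. \<lambda>ij\<in>{..<n} \<times> {..<n}. A $$ ij) (Pi\<^sub>M ({..<n} \<times> {..<n}) (\<lambda>_. borel))"

definition upper_indices :: "nat \<Rightarrow> (nat \<times> nat) set" where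
  "upper_indices n = {(i, j). i \<le> j \<and> j < n}"

definition symmetric_mat_of :: "nat \<Rightarrow> (nat \<times> nat \<Rightarrow> real) \<Rightarrow> real mat" where
  "symmetric_mat_of n w = mat n n (\<lambda>(i, j). w (min i j, max i j))"

text \<open>Note that \<^const>\<open>normal_density\<close> takes the standard deviation, not the variance.\<close>

definition GOE_density :: "nat \<Rightarrow> nat \<times> nat \<Rightarrow> real \<Rightarrow> real" where
  "GOE_density n = (\<lambda>(i, j). normal_density 0 (sqrt (if i = j then 2 / real n else 1 / real n)))"

text \<open>$\mathrm{GOE}(n)$ as a probability law on matrices: the entries on and above the diagonal are
  independent, and the others are determined by symmetry. See \<open>distr_eq_GOE\<close> below for the
  description by random variables.\<close>

definition GOE :: "nat \<Rightarrow> real mat measure" where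
  "GOE n = distr (Pi\<^sub>M (upper_indices n) (\<lambda>ij. density lborel (GOE_density n ij)))
     (mat_borel n) (symmetric_mat_of n)"

definition equipartition :: "nat \<Rightarrow> nat \<Rightarrow> (nat \<Rightarrow> nat set) \<Rightarrow> bool" where
  "equipartition r n S \<longleftrightarrow> (\<Union>l<r. S l) = {..<n} \<and> disjoint_family_on S {..<r} \<and>
     (\<forall>l<r. card (S l) = n div r)"

definition B0_mat :: "nat \<Rightarrow> nat \<Rightarrow> (nat \<Rightarrow> nat set) \<Rightarrow> real mat" where
  "B0_mat r n S = mat n n (\<lambda>(i, j). if \<exists>l<r. {i, j} \<subseteq> S l then (real r - 1) / real n else - 1 / real n)"

definition B_mat :: "real \<Rightarrow> nat \<Rightarrow> nat \<Rightarrow> (nat \<Rightarrow> nat set) \<Rightarrow> real mat \<Rightarrow> real mat" where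
  "B_mat lam r n S W = lam \<cdot>\<^sub>m B0_mat r n S + W"


lemma mat_trace_mult:
  assumes "M \<in> carrier_mat n n" "X \<in> carrier_mat n n"
  shows "mat_trace (M * X) = (\<Sum>i<n. \<Sum>j<n. M $$ (i, j) * X $$ (j, i))"
  using assms by (auto simp: mat_trace_def scalar_prod_def atLeast0LessThan intro!: sum.cong)

lemma quadratic_form_eq:
  assumes "X \<in> carrier_mat n n" "v \<in> carrier_vec n"
  shows "v \<bullet> (X *\<^sub>v v) = (\<Sum>i<n. \<Sum>j<n. v $ i * X $$ (i, j) * v $ j)"
  using assms
  by (auto simp: scalar_prod_def atLeast0LessThan sum_distrib_left mult.assoc intro!: sum.cong)

lemma elliptope_entry_bound:
  assumes X: "X \<in> elliptope n" and ij: "i < n" "j < n"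
  shows "\<bar>X $$ (i, j)\<bar> \<le> 1"
proof (cases "i = j")
  case True
  then show ?thesis using assms by (auto simp: elliptope_def)
next
  case False
  have Xc: "X \<in> carrier_mat n n" and diag: "X $$ (i, i) = 1" "X $$ (j, j) = 1"
    and psd: "positive_semidefinite X"
    using X ij by (auto simp: elliptope_def)
  have sym: "X $$ (j, i) = X $$ (i, j)"
    using psd Xc ij unfolding positive_semidefinite_def
    by (metis carrier_matD index_transpose_mat(1))
  have "0 \<le> 2 + 2 * s * X $$ (i, j)" if s: "s * s = 1" for s :: real
  proof -
    define v where "v = Matrix.vec n (\<lambda>k. if k = i then 1 else if k = j then s else 0)"
    have v: "v \<in> carrier_vec n" by (simp add: v_def)
    have "0 \<le> v \<bullet> (X *\<^sub>v v)"
      using psd v Xc unfolding positive_semidefinite_def by auto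
    also have "\<dots> = (\<Sum>k\<in>{i, j}. \<Sum>l<n. v $ k * X $$ (k, l) * v $ l)"
      unfolding quadratic_form_eq[OF Xc v] using ij
      by (intro sum.mono_neutral_right) (auto simp: v_def)
    also have "\<dots> = (\<Sum>k\<in>{i, j}. \<Sum>l\<in>{i, j}. v $ k * X $$ (k, l) * v $ l)"
      using ij by (intro sum.cong sum.mono_neutral_right) (auto simp: v_def)
    also have "\<dots> = 1 + s * s + 2 * s * X $$ (i, j)"
      using False ij diag sym by (simp add: v_def algebra_simps)
    finally show ?thesis using s by simp
  qed
  from this[of 1] this[of "-1"] show ?thesis by simp
qed

lemma SDP_attained:
  assumes M: "M \<in> carrier_mat n n"
  shows "\<exists>X\<in>elliptope n. mat_trace (M * X) = SDP M \<and> (\<forall>Y\<in>elliptope n. mat_trace (M * Y) \<le> SDP M)"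
proof -
  define T where "T = (\<lambda>ij :: nat \<times> nat. if ij \<in> {..<n} \<times> {..<n} then {-1..1 :: real} else {0})"
  define C where "C = {f :: nat \<times> nat \<Rightarrow> real. (\<forall>i<n. f (i, i) = 1) \<and>
    (\<forall>i<n. \<forall>j<n. f (i, j) = f (j, i)) \<and>
    (\<forall>v. 0 \<le> (\<Sum>i<n. \<Sum>j<n. v i * f (i, j) * v j))}"
  define K where "K = Pi\<^sub>E UNIV T \<inter> C"
  have C_eq: "C = (\<Inter>i\<in>{..<n}. {f. f (i, i) = 1}) \<inter>
     (\<Inter>i\<in>{..<n}. \<Inter>j\<in>{..<n}. {f. f (i, j) = f (j, i)}) \<inter>
     (\<Inter>v. {f. 0 \<le> (\<Sum>i<n. \<Sum>j<n. v i * f (i, j) * v j)})"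
    by (auto simp: C_def)
  have cont: "continuous_on A (\<lambda>f :: nat \<times> nat \<Rightarrow> real. f ij)" for A ij
    by (rule continuous_on_subset[OF continuous_on_product_coordinates]) simp
  have "closed C"
    unfolding C_eq
    by (intro closed_Int closed_INT ballI closed_Collect_eq closed_Collect_le
        continuous_intros cont)
  moreover have "compact (Pi\<^sub>E UNIV T)"
    unfolding compactin_euclidean_iff[symmetric] euclidean_product_topology[symmetric] compactin_PiE
    by (auto simp: T_def)
  ultimately have "compact K"
    unfolding K_def by (rule compact_Int_closed[rotated])
  define F where "F = (\<lambda>f :: nat \<times> nat \<Rightarrow> real. \<Sum>i<n. \<Sum>j<n. M $$ (i, j) * f (j, i))"
  have ell: "Matrix.mat n n f \<in> elliptope n \<and> mat_trace (M * Matrix.mat n n f) = F f" if "f \<in> K" for f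
    using that M
    by (auto simp: K_def C_def elliptope_def positive_semidefinite_def quadratic_form_eq[of _ n]
        mat_trace_mult[OF M] F_def intro!: eq_matI)
  have inK: "\<exists>f\<in>K. F f = mat_trace (M * X)" if X: "X \<in> elliptope n" for X
  proof
    define f where "f = (\<lambda>ij. if ij \<in> {..<n} \<times> {..<n} then X $$ ij else 0)"
    have Xc: "X \<in> carrier_mat n n" and psd: "positive_semidefinite X"
      using X by (auto simp: elliptope_def)
    show "F f = mat_trace (M * X)"
      using Xc by (simp add: F_def mat_trace_mult[OF M] f_def)
    have "f \<in> Pi\<^sub>E UNIV T"
      using elliptope_entry_bound[OF X] by (auto simp: f_def T_def abs_le_iff minus_le_iff)
    moreover have "f \<in> C"
    proof -
      have "X $$ (j, i) = X $$ (i, j)" if "i < n" "j < n" for i j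
        using psd Xc that unfolding positive_semidefinite_def
        by (metis carrier_matD index_transpose_mat(1))
      moreover have "0 \<le> (\<Sum>i<n. \<Sum>j<n. v i * f (i, j) * v j)" for v
      proof -
        have "0 \<le> scalar_prod (Matrix.vec n v) (X *\<^sub>v Matrix.vec n v)"
          using psd Xc unfolding positive_semidefinite_def by auto
        then show ?thesis
          by (subst (asm) quadratic_form_eq[OF Xc]) (auto simp: f_def)
      qed
      ultimately show ?thesis
        using X by (auto simp: C_def f_def elliptope_def)
    qed
    ultimately show "f \<in> K" by (simp add: K_def)
  qed
  have "0 \<le> v \<bullet> v" for v :: "real Matrix.vec"
    by (simp add: scalar_prod_def sum_nonneg)
  then have "1\<^sub>m n \<in> elliptope n"
    by (auto simp: elliptope_def positive_semidefinite_def)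
  with inK have "K \<noteq> {}" by blast
  moreover have "continuous_on K F"
    unfolding F_def by (intro continuous_intros cont)
  ultimately obtain f where f: "f \<in> K" "\<And>g. g \<in> K \<Longrightarrow> F g \<le> F f"
    using continuous_attains_sup[OF \<open>compact K\<close>] by blast
  have le: "mat_trace (M * Y) \<le> F f" if "Y \<in> elliptope n" for Y
    using inK[OF that] f(2) by metis
  have "SDP M = F f"
    unfolding SDP_def using M ell[OF f(1)] le
    by (intro cSup_eq_maximum) (auto intro!: image_eqI)
  then show ?thesis using ell[OF f(1)] le by auto
qed

lemma space_mat_borel [simp]: "space (mat_borel n) = carrier_mat n n"
  by (simp add: mat_borel_def)

lemma measurable_mat_borel:
  assumes "\<And>x. x \<in> space N \<Longrightarrow> X x \<in> carrier_mat n n"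
    and "\<And>i j. i < n \<Longrightarrow> j < n \<Longrightarrow> (\<lambda>x. X x $$ (i, j)) \<in> borel_measurable N"
  shows "X \<in> measurable N (mat_borel n)"
  unfolding mat_borel_def
  using assms by (intro measurable_vimage_algebra2 measurable_restrict) auto

lemma entry_measurable:
  assumes "i < n" "j < n"
  shows "(\<lambda>A. A $$ (i, j)) \<in> borel_measurable (mat_borel n)"
proof -
  have "(\<lambda>A. \<lambda>ij\<in>{..<n} \<times> {..<n}. A $$ ij) \<in>
      measurable (mat_borel n) (Pi\<^sub>M ({..<n} \<times> {..<n}) (\<lambda>_. borel :: real measure))"
    unfolding mat_borel_def by (intro measurable_vimage_algebra1) (auto simp: space_PiM)
  from measurable_component_singleton[THEN measurable_compose[OF this], of "(i, j)"]
  show ?thesis using assms by simp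
qed

lemma symmetric_mat_of_measurable:
  "symmetric_mat_of n \<in> measurable (Pi\<^sub>M (upper_indices n) (\<lambda>_. borel)) (mat_borel n)"
  by (intro measurable_mat_borel)
    (auto simp: symmetric_mat_of_def upper_indices_def min_def max_def
      intro!: measurable_component_singleton)

lemma distr_eq_GOE:
  assumes "prob_space M" "0 < n"
    and X: "\<And>x. x \<in> space M \<Longrightarrow> X x \<in> carrier_mat n n \<and> transpose_mat (X x) = X x"
    and indep: "prob_space.indep_vars M (\<lambda>_. borel) (\<lambda>ij x. X x $$ ij) {(i, j). i \<le> j \<and> j < n}"
    and diag: "\<And>i. i < n \<Longrightarrow>
      distributed M lborel (\<lambda>x. X x $$ (i, i)) (normal_density 0 (sqrt (2 / real n)))"
    and off: "\<And>i j. i < j \<Longrightarrow> j < n \<Longrightarrow>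
      distributed M lborel (\<lambda>x. X x $$ (i, j)) (normal_density 0 (sqrt (1 / real n)))"
  shows "distr M (mat_borel n) X = GOE n"
proof -
  interpret prob_space M by fact
  let ?U = "upper_indices n"
  let ?Y = "\<lambda>x. \<lambda>ij\<in>?U. X x $$ ij"
  have law: "distributed M lborel (\<lambda>x. X x $$ ij) (GOE_density n ij)" if "ij \<in> ?U" for ij
    using that diag[of "fst ij"] off[of "fst ij" "snd ij"]
    by (cases ij) (auto simp: upper_indices_def GOE_density_def le_less)
  have rv: "(\<lambda>x. X x $$ ij) \<in> borel_measurable M" if "ij \<in> ?U" for ij
    using distributed_measurable[OF law[OF that]] by simp
  have Y: "?Y \<in> measurable M (Pi\<^sub>M ?U (\<lambda>_. borel))"
    using rv by (intro measurable_restrict) auto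
  have "(0, 0) \<in> ?U" using \<open>0 < n\<close> by (simp add: upper_indices_def)
  then have "distr M (Pi\<^sub>M ?U (\<lambda>_. borel)) ?Y = Pi\<^sub>M ?U (\<lambda>ij. distr M borel (\<lambda>x. X x $$ ij))"
    using indep[folded upper_indices_def]
      indep_vars_iff_distr_eq_PiM'[of ?U "\<lambda>ij x. X x $$ ij" "\<lambda>_. borel"] rv by auto
  also have "\<dots> = Pi\<^sub>M ?U (\<lambda>ij. density lborel (GOE_density n ij))"
    using distributed_distr_eq_density[OF law]
    by (intro PiM_cong refl) (metis distr_cong sets_lborel)
  finally have eq: "Pi\<^sub>M ?U (\<lambda>ij. density lborel (GOE_density n ij)) = distr M (Pi\<^sub>M ?U (\<lambda>_. borel)) ?Y" ..
  have "symmetric_mat_of n (?Y x) = X x" if "x \<in> space M" for x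
  proof (intro eq_matI)
    fix i j assume "i < dim_row (X x)" "j < dim_col (X x)"
    then have "i < n" "j < n" using X[OF that] by auto
    moreover from this have "X x $$ (j, i) = X x $$ (i, j)"
      using X[OF that] by (metis carrier_matD index_transpose_mat(1))
    ultimately show "symmetric_mat_of n (?Y x) $$ (i, j) = X x $$ (i, j)"
      by (auto simp: symmetric_mat_of_def upper_indices_def min_def max_def)
  qed (use X[OF that] in \<open>auto simp: symmetric_mat_of_def\<close>)
  then have "distr M (mat_borel n) X = distr M (mat_borel n) (symmetric_mat_of n \<circ> ?Y)"
    by (intro distr_cong) auto
  then show ?thesis
    unfolding GOE_def eq by (simp add: distr_distr[OF symmetric_mat_of_measurable Y])
qed

lemma GOE_random_matrix:
  assumes n: "0 < n"
  shows prob_space_GOE: "prob_space (GOE n)"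
    and GOE_symmetric: "\<P>(A in GOE n. transpose_mat A = A) = 1"
    and GOE_indep: "prob_space.indep_vars (GOE n) (\<lambda>_. borel) (\<lambda>ij A. A $$ ij) {(i, j). i \<le> j \<and> j < n}"
    and GOE_diag: "\<And>i. i < n \<Longrightarrow>
      distributed (GOE n) lborel (\<lambda>A. A $$ (i, i)) (normal_density 0 (sqrt (2 / real n)))"
    and GOE_off_diag: "\<And>i j. i < j \<Longrightarrow> j < n \<Longrightarrow>
      distributed (GOE n) lborel (\<lambda>A. A $$ (i, j)) (normal_density 0 (sqrt (1 / real n)))"
proof -
  let ?U = "upper_indices n"
  let ?D = "\<lambda>ij. density lborel (GOE_density n ij)"
  let ?P = "Pi\<^sub>M ?U ?D"
  let ?s = "symmetric_mat_of n"
  have prob_D: "prob_space (?D ij)" for ij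
    using n by (cases ij) (auto simp: GOE_density_def intro!: prob_space_normal_density)
  interpret P: product_prob_space ?D ?U
    by (intro product_prob_spaceI prob_D)
  have sets_P [measurable_cong]: "sets ?P = sets (Pi\<^sub>M ?U (\<lambda>_. borel))"
    by (intro sets_PiM_cong) auto
  have s: "?s \<in> measurable ?P (mat_borel n)"
    using symmetric_mat_of_measurable measurable_cong_sets[OF sets_P refl] by blast
  have P_prob: "prob_space ?P"
    by (rule prob_space_PiM) (rule prob_D)
  show prob: "prob_space (GOE n)"
    unfolding GOE_def using P_prob s by (rule prob_space.prob_space_distr)
  interpret prob_space "GOE n" by (rule prob)
  have sets_GOE: "sets (GOE n) = sets (mat_borel n)" by (simp add: GOE_def)
  have space_GOE: "space (GOE n) = carrier_mat n n" by (simp add: GOE_def)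
  have entry0: "(\<lambda>A. A $$ ij) \<in> borel_measurable (mat_borel n)" if "ij \<in> ?U" for ij
    using that by (cases ij) (simp add: upper_indices_def entry_measurable)
  have entry: "(\<lambda>A. A $$ ij) \<in> borel_measurable (GOE n)" if "ij \<in> ?U" for ij
    unfolding measurable_cong_sets[OF sets_GOE refl] by (rule entry0[OF that])
  have entry_s: "?s w $$ ij = w ij" if "ij \<in> ?U" for w ij
    using that by (auto simp: symmetric_mat_of_def upper_indices_def)
  have marginal: "distr (GOE n) borel (\<lambda>A. A $$ ij) = ?D ij" if "ij \<in> ?U" for ij
  proof -
    have "distr (GOE n) borel (\<lambda>A. A $$ ij) = distr ?P borel (\<lambda>w. w ij)"
      unfolding GOE_def distr_distr[OF entry0[OF that] s] comp_def entry_s[OF that] ..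
    also have "\<dots> = distr ?P (?D ij) (\<lambda>w. w ij)"
      by (intro distr_cong) auto
    also have "\<dots> = ?D ij" by (rule P.PiM_component[OF that])
    finally show ?thesis .
  qed
  have restr: "(\<lambda>A. \<lambda>ij\<in>?U. A $$ ij) \<in> measurable (mat_borel n) (Pi\<^sub>M ?U (\<lambda>_. borel))"
    by (rule measurable_restrict) (rule entry0)
  have "distr (GOE n) (Pi\<^sub>M ?U (\<lambda>_. borel)) (\<lambda>A. \<lambda>ij\<in>?U. A $$ ij) =
      distr ?P (Pi\<^sub>M ?U (\<lambda>_. borel)) ((\<lambda>A. \<lambda>ij\<in>?U. A $$ ij) \<circ> ?s)"
    unfolding GOE_def by (rule distr_distr[OF restr s])
  also have "\<dots> = distr ?P ?P (\<lambda>w. w)"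
  proof (rule distr_cong)
    fix w assume "w \<in> space ?P"
    then have w: "w \<in> extensional ?U" by (simp add: space_PiM PiE_def)
    show "((\<lambda>A. \<lambda>ij\<in>?U. A $$ ij) \<circ> ?s) w = w"
      using entry_s extensional_arb[OF w] by (auto simp: restrict_def fun_eq_iff)
  qed (simp_all add: sets_P)
  also have "\<dots> = ?P" by simp
  also have "\<dots> = Pi\<^sub>M ?U (\<lambda>ij. distr (GOE n) borel (\<lambda>A. A $$ ij))"
    by (rule PiM_cong) (simp_all add: marginal)
  finally have joint: "distr (GOE n) (Pi\<^sub>M ?U (\<lambda>_. borel)) (\<lambda>A. \<lambda>ij\<in>?U. A $$ ij) =
    Pi\<^sub>M ?U (\<lambda>ij. distr (GOE n) borel (\<lambda>A. A $$ ij))" .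
  have "(0, 0) \<in> ?U" using n by (simp add: upper_indices_def)
  then have "indep_vars (\<lambda>_. borel) (\<lambda>ij A. A $$ ij) ?U"
    using indep_vars_iff_distr_eq_PiM'[of ?U "\<lambda>ij A. A $$ ij" "\<lambda>_. borel"] joint entry by auto
  then show "indep_vars (\<lambda>_. borel) (\<lambda>ij A. A $$ ij) {(i, j). i \<le> j \<and> j < n}"
    by (simp add: upper_indices_def)
  have dist: "distributed (GOE n) lborel (\<lambda>A. A $$ ij) (GOE_density n ij)" if "ij \<in> ?U" for ij
    unfolding distributed_def
  proof (intro conjI)
    show "distr (GOE n) lborel (\<lambda>A. A $$ ij) = ?D ij"
      using marginal[OF that] by (metis distr_cong sets_lborel)
    show "(\<lambda>A. A $$ ij) \<in> measurable (GOE n) lborel" using entry[OF that] by simp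
    show "(\<lambda>x. ennreal (GOE_density n ij x)) \<in> borel_measurable lborel"
      by (cases ij) (auto simp: GOE_density_def)
  qed
  show "distributed (GOE n) lborel (\<lambda>A. A $$ (i, i)) (normal_density 0 (sqrt (2 / real n)))"
    if "i < n" for i
    using dist[of "(i, i)"] that by (simp add: upper_indices_def GOE_density_def)
  show "distributed (GOE n) lborel (\<lambda>A. A $$ (i, j)) (normal_density 0 (sqrt (1 / real n)))"
    if "i < j" "j < n" for i j
    using dist[of "(i, j)"] that by (simp add: upper_indices_def GOE_density_def)
  have "{A \<in> space (GOE n). transpose_mat A = A} =
      {A \<in> space (mat_borel n). \<forall>i\<in>{..<n}. \<forall>j\<in>{..<n}. A $$ (j, i) = A $$ (i, j)}"
    unfolding space_GOE space_mat_borel by (auto simp: mat_eq_iff)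
  also have "\<dots> \<in> sets (mat_borel n)"
    by (intro sets.sets_Collect_finite_All finite_lessThan borel_measurable_eq entry_measurable) auto
  finally have meas: "{A \<in> space (GOE n). transpose_mat A = A} \<in> sets (mat_borel n)" .
  have "?s -` {A \<in> space (GOE n). transpose_mat A = A} \<inter> space ?P = space ?P"
    by (auto simp: space_GOE symmetric_mat_of_def mat_eq_iff min.commute max.commute)
  then show "\<P>(A in GOE n. transpose_mat A = A) = 1"
    using measure_distr[OF s meas] prob_space.prob_space[OF P_prob] by (simp add: GOE_def)
qed

end

theory Submission
  imports Defs "HOL-Computational_Algebra.Polynomial"
begin

text \<open>Since \<open>B\<^sub>0\<close> dominates \<open>v v\<^sup>T\<close> for the normalized difference \<open>v\<close> of the indicators
  of two blocks, a delocalized unit vector, it suffices to bound the program of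
  \<open>\<lambda> v v\<^sup>T + W\<close> from below. As test matrix take the Gram matrix of the columns \<open>p(W) e\<^sub>a\<close> together
  with \<open>\<surd>\<epsilon> \<phi>\<close>, where \<open>\<phi> = \<surd>n q(W) v\<close>; rows longer than \<open>1\<close> are normalized, and the diagonal is
  then filled up to \<open>1\<close>. For a polynomial \<open>p\<close> with \<open>\<integral> p\<^sup>2 = 1\<close> under the semicircle law and mass
  concentrated near the edge, the first columns contribute about \<open>2 n\<close>. With the spike column the
  squared row norms become \<open>1 + \<epsilon> \<phi>\<^sub>i\<^sup>2\<close> up to \<open>o(1)\<close>, and normalizing them costs \<open>2 \<epsilon> \<phi>\<^sub>i\<^sup>2\<close>
  of energy to first order. So the gain is \<open>\<epsilon> n (\<lambda> (\<integral> q)\<^sup>2 + \<integral> x q\<^sup>2 - 2 \<integral> q\<^sup>2)\<close> up to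
  \<open>O(\<epsilon>\<^sup>2 n)\<close>, and the bracket can be made positive precisely for \<open>\<lambda> > 1\<close>.

  All averages are expectations of products of quadratic forms \<open>x\<^sup>T W\<^sup>k y\<close>, which Gaussian
  integration by parts evaluates by induction on the degree. They only give the lower bound with
  probability \<open>1/2\<close>, and this is enough: the value of the program is Lipschitz in the Gaussian entries,
  so its variance is of order \<open>n\<close>.\<close>

section \<open>Gaussian integration by parts\<close>

text \<open>The threshold comes from minimizing \<integral> (2 - x) q^2 under \<integral> q = 1. By
  Cauchy-Schwarz the infimum is the reciprocal of \<integral> 1 / (2 - x), which is 1 for the
  semicircle law; near-optimal q are truncations of 1 / (2 - x). The order of the choices matters: q
  depends on \<lambda> only, the weight \<epsilon> is then made small against the quartic terms,
  next p is taken so close to the edge that 2 - \<integral> x p^2 is a fraction of the gain, and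
  only then does n grow. Working with polynomials of W in place of eigenvectors, the argument uses
  nothing about individual eigenvalues or the top of the spectrum; only a crude lower bound on W
  enters, and it multiplies terms of second order. As the partition is arbitrary for every n, all
  constants have to be uniform over unit vectors v with entries of size at most c / sqrt n.\<close>

lemma normal_moment_integrable:
  assumes "0 < (s::real)"
  shows "integrable (density lborel (normal_density 0 s)) (\<lambda>x. x ^ k)"
  using integrable_normal_moment[OF assms, of 0 k]
  by (subst integrable_density) auto

text \<open>Stein's identity for a monomial, read off from the closed formulas for even and odd
  moments. For k = 0 the truncated \<open>k - 1\<close> is multiplied by 0.\<close>

lemma normal_moment_rec:
  assumes s: "0 < (s::real)"
  shows "(\<integral>x. x * x ^ k \<partial>density lborel (normal_density 0 s)) =
    s\<^sup>2 * (real k * (\<integral>x. x ^ (k - 1) \<partial>density lborel (normal_density 0 s)))"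
proof -
  have eq: "(\<integral>x. x ^ j \<partial>density lborel (normal_density 0 s)) =
      (\<integral>x. normal_density 0 s x * (x - 0) ^ j \<partial>lborel)" for j
    by (subst integral_density) auto
  show ?thesis
  proof (cases "even k")
    case True
    then obtain j where j: "k = 2 * j" by (elim evenE)
    have "(\<integral>x. x * x ^ k \<partial>density lborel (normal_density 0 s)) = 0"
      using eq[of "Suc k"] integral_normal_moment_odd[OF s, of 0 j] j by simp
    moreover have "real k * (\<integral>x. x ^ (k - 1) \<partial>density lborel (normal_density 0 s)) = 0"
    proof (cases j)
      case (Suc i)
      then show ?thesis
        using eq[of "k - 1"] integral_normal_moment_odd[OF s, of 0 i] j by simp
    qed (simp add: j)
    ultimately show ?thesis by simp
  next
    case False
    then obtain j where j: "k = 2 * j + 1" by (elim oddE)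
    have "(\<integral>x. x * x ^ k \<partial>density lborel (normal_density 0 s)) =
        fact (2 * (j + 1)) / ((2 / s\<^sup>2) ^ (j + 1) * fact (j + 1))"
      using eq[of "Suc k"] integral_normal_moment_even[OF s, of 0 "j + 1"] j by simp
    moreover have "(\<integral>x. x ^ (k - 1) \<partial>density lborel (normal_density 0 s)) =
        fact (2 * j) / ((2 / s\<^sup>2) ^ j * fact j)"
      using eq[of "k - 1"] integral_normal_moment_even[OF s, of 0 j] j by simp
    moreover have "fact (2 * (j + 1)) / ((2 / s\<^sup>2) ^ (j + 1) * fact (j + 1)) =
        s\<^sup>2 * (real k * (fact (2 * j) / ((2 / s\<^sup>2) ^ j * fact j)))"
    proof -
      have "fact (2 * (j + 1)) = 2 * real (j + 1) * real k * fact (2 * j)"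
        by (simp add: j algebra_simps)
      moreover have "(2 / s\<^sup>2) ^ (j + 1) * fact (j + 1) =
          2 * real (j + 1) / s\<^sup>2 * ((2 / s\<^sup>2) ^ j * fact j)"
        by (simp add: algebra_simps)
      moreover have "2 * real (j + 1) * real k * a / (2 * real (j + 1) / s\<^sup>2 * b) = s\<^sup>2 * (real k * (a / b))"
        for a b :: real
        using s by simp
      ultimately show ?thesis by (simp only:)
    qed
    ultimately show ?thesis by simp
  qed
qed

section \<open>Polynomial functions of independent Gaussian coordinates\<close>

definition gauss_prod :: "'i set \<Rightarrow> ('i \<Rightarrow> real) \<Rightarrow> ('i \<Rightarrow> real) measure" where
  "gauss_prod I s = Pi\<^sub>M I (\<lambda>i. density lborel (normal_density 0 (s i)))"

text \<open>Generated by monomials in product form because their expectations factor over the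
  coordinates; all further facts extend by linearity.\<close>

inductive gauss_poly :: "'i set \<Rightarrow> (('i \<Rightarrow> real) \<Rightarrow> real) \<Rightarrow> bool" for I where
  monom: "gauss_poly I (\<lambda>w. c * (\<Prod>i\<in>I. w i ^ m i))"
| add: "gauss_poly I F \<Longrightarrow> gauss_poly I G \<Longrightarrow> gauss_poly I (\<lambda>w. F w + G w)"

lemma gauss_poly_const: "gauss_poly I (\<lambda>w. c)"
  using gauss_poly.monom[of I c "\<lambda>_. 0"] by simp

lemma gauss_poly_var:
  assumes "finite I" "i \<in> I"
  shows "gauss_poly I (\<lambda>w. w i)"
proof -
  have "(\<Prod>j\<in>I. w j ^ (if j = i then 1 else 0)) = (w i :: real)" for w
    using assms by (simp add: if_distrib[of "\<lambda>k. _ ^ k"] prod.delta cong: if_cong)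
  then show ?thesis
    using gauss_poly.monom[of I 1 "\<lambda>j. if j = i then 1 else 0"] by simp
qed

lemma gauss_poly_mult:
  assumes "gauss_poly I F" "gauss_poly I G"
  shows "gauss_poly I (\<lambda>w. F w * G w)"
  using assms(1)
proof induction
  case (monom c m)
  show ?case
    using assms(2)
  proof induction
    case (monom c' m')
    have eq: "(\<lambda>w. c * (\<Prod>i\<in>I. w i ^ m i) * (c' * (\<Prod>i\<in>I. w i ^ m' i))) =
        (\<lambda>w. (c * c') * (\<Prod>i\<in>I. w i ^ (m i + m' i)))"
      by (simp add: power_add prod.distrib mult_ac)
    show ?case unfolding eq by (rule gauss_poly.monom)
  next
    case (add F G)
    then show ?case by (auto simp: distrib_left intro: gauss_poly.add)
  qed
next
  case (add F G)
  then show ?case by (auto simp: distrib_right intro: gauss_poly.add)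
qed

lemma gauss_poly_sum:
  assumes "\<And>a. a \<in> A \<Longrightarrow> gauss_poly I (F a)"
  shows "gauss_poly I (\<lambda>w. \<Sum>a\<in>A. F a w)"
  using assms
  by (induction A rule: infinite_finite_induct) (auto intro: gauss_poly_const gauss_poly.add)

lemma gauss_poly_power:
  "gauss_poly I F \<Longrightarrow> gauss_poly I (\<lambda>w. F w ^ k)"
  by (induction k) (auto intro: gauss_poly_const gauss_poly_mult)

lemma gauss_poly_diff:
  assumes "gauss_poly I F" "gauss_poly I G"
  shows "gauss_poly I (\<lambda>w. F w - G w)"
proof -
  have "gauss_poly I (\<lambda>w. F w + (- 1) * G w)"
    by (intro gauss_poly.add gauss_poly_mult gauss_poly_const assms)
  then show ?thesis by simp
qed

lemmas gauss_poly_intros = gauss_poly_const gauss_poly.add gauss_poly_mult gauss_poly_sum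
  gauss_poly_power gauss_poly_diff

text \<open>Positivity is demanded at every index, also outside \<open>I\<close>, since
  \<open>product_prob_space\<close> asks every factor of the family to be a probability
  measure.\<close>

locale gaussian_product =
  fixes I :: "'i set" and s :: "'i \<Rightarrow> real"
  assumes finite_I: "finite I" and s_pos: "\<And>i. 0 < s i"
begin

sublocale P: product_prob_space "\<lambda>i. density lborel (normal_density 0 (s i))" I
  by (intro product_prob_spaceI prob_space_normal_density s_pos)

sublocale prob_space "gauss_prod I s"
  unfolding gauss_prod_def by (intro prob_space_PiM prob_space_normal_density s_pos)

abbreviation moment :: "'i \<Rightarrow> nat \<Rightarrow> real" where
  "moment i k \<equiv> (\<integral>x. x ^ k \<partial>density lborel (normal_density 0 (s i)))"

lemma monom_integrable: "integrable (gauss_prod I s) (\<lambda>w. \<Prod>i\<in>I. w i ^ m i)"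
  unfolding gauss_prod_def
  by (rule P.product_integrable_prod[OF finite_I]) (rule normal_moment_integrable[OF s_pos])

lemma monom_integral: "(\<integral>w. (\<Prod>i\<in>I. w i ^ m i) \<partial>gauss_prod I s) = (\<Prod>i\<in>I. moment i (m i))"
  unfolding gauss_prod_def
  by (rule P.product_integral_prod[OF finite_I]) (rule normal_moment_integrable[OF s_pos])

lemma gauss_poly_integrable: "gauss_poly I F \<Longrightarrow> integrable (gauss_prod I s) F"
  by (induction rule: gauss_poly.induct) (auto intro: monom_integrable)

lemma monom_ibp:
  assumes u: "u \<in> I"
  shows "(\<integral>w. w u * (\<Prod>i\<in>I. w i ^ m i) \<partial>gauss_prod I s) =
    (s u)\<^sup>2 * (real (m u) * (\<integral>w. (\<Prod>i\<in>I. w i ^ (m(u := m u - 1)) i) \<partial>gauss_prod I s))"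
proof -
  have "w u * (\<Prod>i\<in>I. w i ^ m i) = (\<Prod>i\<in>I. w i ^ (m(u := Suc (m u))) i)" for w :: "'i \<Rightarrow> real"
    using u finite_I by (simp add: prod.remove[of _ u])
  then have "(\<integral>w. w u * (\<Prod>i\<in>I. w i ^ m i) \<partial>gauss_prod I s) =
      (\<Prod>i\<in>I. moment i ((m(u := Suc (m u))) i))"
    by (simp add: monom_integral del: fun_upd_apply)
  also have "\<dots> = moment u (Suc (m u)) * (\<Prod>i\<in>I - {u}. moment i (m i))"
    using u finite_I by (simp add: prod.remove[of _ u])
  also have "moment u (Suc (m u)) = (s u)\<^sup>2 * (real (m u) * moment u (m u - 1))"
    using normal_moment_rec[OF s_pos] by simp
  also have "\<dots> * (\<Prod>i\<in>I - {u}. moment i (m i)) =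
      (s u)\<^sup>2 * (real (m u) * (\<Prod>i\<in>I. moment i ((m(u := m u - 1)) i)))"
    using u finite_I by (simp add: prod.remove[of _ u])
  finally show ?thesis by (simp add: monom_integral del: fun_upd_apply)
qed

text \<open>The derivative is produced together with the identity, because adding two identities
  requires it to be a \<open>gauss_poly\<close> and hence integrable. Uniqueness of derivatives
  later exchanges it for any derivative computed by other means.\<close>

lemma gauss_poly_ibp_ex:
  assumes u: "u \<in> I" and "gauss_poly I F"
  shows "\<exists>F'. gauss_poly I F' \<and>
    (\<forall>w. ((\<lambda>t. F (w(u := t))) has_real_derivative F' w) (at (w u))) \<and>
    (\<integral>w. w u * F w \<partial>gauss_prod I s) = (s u)\<^sup>2 * (\<integral>w. F' w \<partial>gauss_prod I s)"
  using assms(2)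
proof induction
  case (monom c m)
  let ?F' = "\<lambda>w. c * real (m u) * (\<Prod>i\<in>I. w i ^ (m(u := m u - 1)) i)"
  have "((\<lambda>t. c * (\<Prod>i\<in>I. (w(u := t)) i ^ m i)) has_real_derivative ?F' w) (at (w u))"
    for w :: "'i \<Rightarrow> real"
  proof -
    have "(\<Prod>i\<in>I. (w(u := t)) i ^ m i) = t ^ m u * (\<Prod>i\<in>I - {u}. w i ^ m i)" for t
      using u finite_I by (simp add: prod.remove[of _ u])
    moreover have "(\<Prod>i\<in>I. w i ^ (m(u := m u - 1)) i) =
        w u ^ (m u - 1) * (\<Prod>i\<in>I - {u}. w i ^ m i)"
      using u finite_I by (simp add: prod.remove[of _ u])
    ultimately show ?thesis
      by (auto intro!: derivative_eq_intros)
  qed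
  moreover have "(\<integral>w. w u * (c * (\<Prod>i\<in>I. w i ^ m i)) \<partial>gauss_prod I s) =
      (s u)\<^sup>2 * (\<integral>w. ?F' w \<partial>gauss_prod I s)"
  proof -
    have "(\<integral>w. w u * (c * (\<Prod>i\<in>I. w i ^ m i)) \<partial>gauss_prod I s) =
        c * (\<integral>w. w u * (\<Prod>i\<in>I. w i ^ m i) \<partial>gauss_prod I s)"
      by (subst integral_mult_right_zero[symmetric]) (simp add: mult_ac)
    then show ?thesis by (simp add: monom_ibp[OF u] mult_ac del: fun_upd_apply)
  qed
  moreover have "gauss_poly I ?F'" by (rule gauss_poly.monom)
  ultimately show ?case by (intro exI[of _ ?F']) blast
next
  case (add F G)
  then obtain F' G' where
    *: "gauss_poly I F'" "\<And>w. ((\<lambda>t. F (w(u := t))) has_real_derivative F' w) (at (w u))"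
      "(\<integral>w. w u * F w \<partial>gauss_prod I s) = (s u)\<^sup>2 * (\<integral>w. F' w \<partial>gauss_prod I s)"
      "gauss_poly I G'" "\<And>w. ((\<lambda>t. G (w(u := t))) has_real_derivative G' w) (at (w u))"
      "(\<integral>w. w u * G w \<partial>gauss_prod I s) = (s u)\<^sup>2 * (\<integral>w. G' w \<partial>gauss_prod I s)"
    by blast
  have "integrable (gauss_prod I s) (\<lambda>w. w u * F w)" "integrable (gauss_prod I s) (\<lambda>w. w u * G w)"
    using add by (auto intro!: gauss_poly_integrable gauss_poly_mult gauss_poly_var u finite_I)
  then have "(\<integral>w. w u * (F w + G w) \<partial>gauss_prod I s) =
      (s u)\<^sup>2 * (\<integral>w. F' w + G' w \<partial>gauss_prod I s)"
    using * by (simp add: distrib_left gauss_poly_integrable)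
  moreover have "gauss_poly I (\<lambda>w. F' w + G' w)" using * by (intro gauss_poly.add)
  moreover have "((\<lambda>t. F (w(u := t)) + G (w(u := t))) has_real_derivative F' w + G' w) (at (w u))" for w
    using * by (intro DERIV_add)
  ultimately show ?case by blast
qed

lemma gauss_poly_ibp:
  assumes "u \<in> I" "gauss_poly I F"
    and F': "\<And>w. ((\<lambda>t. F (w(u := t))) has_real_derivative F' w) (at (w u))"
  shows "(\<integral>w. w u * F w \<partial>gauss_prod I s) = (s u)\<^sup>2 * (\<integral>w. F' w \<partial>gauss_prod I s)"
proof -
  obtain F'' where F'': "\<And>w. ((\<lambda>t. F (w(u := t))) has_real_derivative F'' w) (at (w u))"
    "(\<integral>w. w u * F w \<partial>gauss_prod I s) = (s u)\<^sup>2 * (\<integral>w. F'' w \<partial>gauss_prod I s)"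
    using gauss_poly_ibp_ex[OF assms(1,2)] by blast
  have "F'' = F'" using F' F''(1) by (auto intro: DERIV_unique)
  with F''(2) show ?thesis by simp
qed

end

section \<open>Loop equations for Gaussian symmetric matrices\<close>

text \<open>Vectors and matrices are functions on all of \<open>nat\<close> from here on, and
  \<open>n\<close> only bounds the sums, so that no carrier conditions have to be carried
  along.\<close>

definition inner_n :: "nat \<Rightarrow> (nat \<Rightarrow> real) \<Rightarrow> (nat \<Rightarrow> real) \<Rightarrow> real" where
  "inner_n n x y = (\<Sum>i<n. x i * y i)"

primrec pow_app :: "nat \<Rightarrow> (nat \<Rightarrow> nat \<Rightarrow> real) \<Rightarrow> nat \<Rightarrow> (nat \<Rightarrow> real) \<Rightarrow> nat \<Rightarrow> real" where
  "pow_app n W 0 y = y"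
| "pow_app n W (Suc k) y = (\<lambda>i. \<Sum>j<n. W i j * pow_app n W k y j)"

definition pow_form :: "nat \<Rightarrow> (nat \<Rightarrow> nat \<Rightarrow> real) \<Rightarrow> (nat \<Rightarrow> real) \<Rightarrow> nat \<Rightarrow> (nat \<Rightarrow> real) \<Rightarrow> real" where
  "pow_form n W x k y = inner_n n x (pow_app n W k y)"

definition unit_fun :: "nat \<Rightarrow> nat \<Rightarrow> real" where
  "unit_fun i = (\<lambda>j. if j = i then 1 else 0)"

lemma inner_n_commute: "inner_n n x y = inner_n n y x"
  by (simp add: inner_n_def mult.commute)

lemma inner_n_unit [simp]: "i < n \<Longrightarrow> inner_n n (unit_fun i) x = x i"
  "i < n \<Longrightarrow> inner_n n x (unit_fun i) = x i"
  by (simp_all add: inner_n_def unit_fun_def if_distrib[of "\<lambda>x. _ * x"] if_distrib[of "\<lambda>x. x * _"]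
    cong: if_cong)

lemma pow_app_add: "pow_app n W (k + l) y = pow_app n W k (pow_app n W l y)"
  by (induction k) auto

lemma pow_app_Suc_right:
  "pow_app n W (Suc k) y = pow_app n W k (\<lambda>i. \<Sum>j<n. W i j * y j)"
  using pow_app_add[of n W k 1 y] by simp

lemma inner_pow_app:
  assumes sym: "\<And>i j. W i j = W j i"
  shows "inner_n n x (pow_app n W k y) = inner_n n (pow_app n W k x) y"
proof (induction k arbitrary: x)
  case (Suc k)
  have "inner_n n x (pow_app n W (Suc k) y) =
      (\<Sum>j<n. \<Sum>i<n. x i * (W i j * pow_app n W k y j))"
    unfolding inner_n_def by (simp add: sum_distrib_left) (rule sum.swap)
  also have "\<dots> = inner_n n (\<lambda>j. \<Sum>i<n. W j i * x i) (pow_app n W k y)"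
    unfolding inner_n_def sum_distrib_right
    by (intro sum.cong refl) (simp add: sym mult_ac)
  also have "\<dots> = inner_n n (pow_app n W (Suc k) x) y"
    by (simp only: Suc.IH pow_app_Suc_right)
  finally show ?case .
qed simp

lemma pow_form_unit: "i < n \<Longrightarrow> pow_form n W (unit_fun i) k y = pow_app n W k y i"
  by (simp add: pow_form_def)

lemma inner_pow_app_pow_app:
  assumes "\<And>i j. W i j = W j i"
  shows "inner_n n (pow_app n W a x) (pow_app n W b y) = pow_form n W x (a + b) y"
  unfolding pow_form_def pow_app_add inner_pow_app[where W = W and n = n and x = x, OF assms] ..

lemma pow_form_commute:
  assumes "\<And>i j. W i j = W j i"
  shows "pow_form n W x k y = pow_form n W y k x"
  unfolding pow_form_def inner_pow_app[where W = W and n = n and x = x, OF assms] by (rule inner_n_commute)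

section \<open>The random matrix as a function of its independent entries, and its partial
  derivatives\<close>

definition sym_ext :: "(nat \<times> nat \<Rightarrow> real) \<Rightarrow> nat \<Rightarrow> nat \<Rightarrow> real" where
  "sym_ext w i j = w (min i j, max i j)"

lemma sym_ext_sym: "sym_ext w i j = sym_ext w j i"
  by (simp add: sym_ext_def min.commute max.commute)

definition goe_sd :: "nat \<Rightarrow> nat \<times> nat \<Rightarrow> real" where
  "goe_sd n = (\<lambda>(i, j). sqrt (if i = j then 2 / real n else 1 / real n))"

abbreviation goe_vars :: "nat \<Rightarrow> (nat \<times> nat \<Rightarrow> real) measure" where
  "goe_vars n \<equiv> gauss_prod (upper_indices n) (goe_sd n)"

lemma finite_upper_indices [simp]: "finite (upper_indices n)"
  by (rule finite_subset[of _ "{..<n} \<times> {..<n}"]) (auto simp: upper_indices_def)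

lemma gaussian_product_goe: "0 < n \<Longrightarrow> gaussian_product (upper_indices n) (goe_sd n)"
  by unfold_locales (auto simp: goe_sd_def split: prod.splits simp del: finite_upper_indices intro: finite_upper_indices)

abbreviation goe_poly :: "nat \<Rightarrow> ((nat \<times> nat \<Rightarrow> real) \<Rightarrow> real) \<Rightarrow> bool" where
  "goe_poly n \<equiv> gauss_poly (upper_indices n)"

lemma goe_poly_entry: "i < n \<Longrightarrow> j < n \<Longrightarrow> goe_poly n (\<lambda>w. sym_ext w i j)"
  unfolding sym_ext_def
  by (rule gauss_poly_var[OF finite_upper_indices]) (auto simp: upper_indices_def)

lemma goe_poly_pow_app: "i < n \<Longrightarrow> goe_poly n (\<lambda>w. pow_app n (sym_ext w) k y i)"
  by (induction k arbitrary: i) (auto intro!: gauss_poly_intros goe_poly_entry)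

lemma goe_poly_pow_form: "goe_poly n (\<lambda>w. pow_form n (sym_ext w) x k y)"
  unfolding pow_form_def inner_n_def by (auto intro!: gauss_poly_intros goe_poly_pow_app)

text \<open>The factor \<open>1/2\<close> on the diagonal turns the partial derivative in the coordinate \<open>(i, j)\<close> into
  a multiple of the derivative in the direction $E_{ij} + E_{ji}$; it cancels against the doubled
  variance, so that the identity has the same form for all entries.\<close>

definition diag_factor :: "nat \<Rightarrow> nat \<Rightarrow> real" where
  "diag_factor i j = (if i = j then 1 / 2 else 1)"

lemma goe_ibp:
  assumes n: "0 < n" and ij: "i < n" "j < n" and F: "goe_poly n F"
    and F': "\<And>w. ((\<lambda>t. F (w((min i j, max i j) := t))) has_real_derivative
      diag_factor i j * F' w) (at (w (min i j, max i j)))"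
  shows "(\<integral>w. sym_ext w i j * F w \<partial>goe_vars n) = (\<integral>w. F' w \<partial>goe_vars n) / real n"
proof -
  interpret gaussian_product "upper_indices n" "goe_sd n" by (rule gaussian_product_goe[OF n])
  have "(min i j, max i j) \<in> upper_indices n" using ij by (auto simp: upper_indices_def)
  from gauss_poly_ibp[OF this F F'] n show ?thesis
    by (cases "i = j") (auto simp: sym_ext_def diag_factor_def goe_sd_def min_def max_def)
qed

definition entry_deriv :: "nat \<times> nat \<Rightarrow> nat \<Rightarrow> nat \<Rightarrow> real" where
  "entry_deriv u p q = (if (min p q, max p q) = u then 1 else 0)"

lemma sym_ext_deriv:
  "((\<lambda>t. sym_ext (w(u := t)) p q) has_real_derivative entry_deriv u p q) (at (w u))"
  by (cases "(min p q, max p q) = u") (auto simp: sym_ext_def entry_deriv_def)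

text \<open>The noncommutative product rule: the derivative of W^k is the sum of W^a W' W^(k-1-a),
  where W' is \<open>entry_deriv u\<close>.\<close>

lemma pow_app_deriv:
  "((\<lambda>t. pow_app n (sym_ext (w(u := t))) k y p) has_real_derivative
    (\<Sum>a<k. pow_app n (sym_ext w) a (\<lambda>i. \<Sum>j<n. entry_deriv u i j * pow_app n (sym_ext w) (k - 1 - a) y j) p))
    (at (w u))"
proof (induction k arbitrary: p)
  case (Suc k)
  let ?W = "sym_ext w"
  let ?h = "\<lambda>k i. \<Sum>j<n. entry_deriv u i j * pow_app n ?W k y j"
  have "((\<lambda>t. pow_app n (sym_ext (w(u := t))) (Suc k) y p) has_real_derivative
     (\<Sum>q<n. entry_deriv u p q * pow_app n ?W k y q +
        ?W p q * (\<Sum>a<k. pow_app n ?W a (?h (k - 1 - a)) q))) (at (w u))"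
    unfolding pow_app.simps
    by (rule DERIV_sum, rule DERIV_cong, rule DERIV_mult, rule sym_ext_deriv, rule Suc) simp
  also have "(\<Sum>q<n. entry_deriv u p q * pow_app n ?W k y q +
        ?W p q * (\<Sum>a<k. pow_app n ?W a (?h (k - 1 - a)) q)) =
      (\<Sum>a<Suc k. pow_app n ?W a (?h (Suc k - 1 - a)) p)"
    unfolding sum.lessThan_Suc_shift
    by (simp add: sum.distrib sum_distrib_left) (rule sum.swap)
  finally show ?case .
qed simp

lemma sum_entry_deriv:
  assumes "i < n" "j < n"
  shows "(\<Sum>p<n. \<Sum>q<n. x p * (entry_deriv (min i j, max i j) p q * z q)) =
    diag_factor i j * (x i * z j + x j * z i)"
proof -
  have *: "entry_deriv (min i j, max i j) p q =
      (if p = i then if q = j then diag_factor i j else 0 else 0) +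
      (if p = j then if q = i then diag_factor i j else 0 else 0)" for p q
    by (auto simp: entry_deriv_def diag_factor_def min_def max_def)
  have **: "(\<Sum>p<n. \<Sum>q<n. x p * ((if p = a then if q = b then c else 0 else 0) * z q)) = c * (x a * z b)"
    if "a < n" "b < n" for a b and c :: real
  proof -
    have "(\<Sum>q<n. x a * ((if q = b then c else 0) * z q)) = (\<Sum>q<n. if q = b then c * (x a * z b) else 0)"
      by (intro sum.cong) auto
    then have inner: "(\<Sum>q<n. x a * ((if q = b then c else 0) * z q)) = c * (x a * z b)"
      using that by simp
    have "(\<Sum>p<n. \<Sum>q<n. x p * ((if p = a then if q = b then c else 0 else 0) * z q)) =
        (\<Sum>p<n. if p = a then c * (x a * z b) else 0)"
      by (intro sum.cong refl) (auto simp: inner)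
    then show ?thesis using that by simp
  qed
  show ?thesis
    unfolding * distrib_left distrib_right sum.distrib using assms by (simp add: ** distrib_left)
qed

text \<open>The derivative of x^T W^k y in the direction E_ij + E_ji.\<close>

definition pow_form_diff :: "nat \<Rightarrow> (nat \<Rightarrow> nat \<Rightarrow> real) \<Rightarrow> nat \<Rightarrow> nat \<Rightarrow> (nat \<Rightarrow> real) \<Rightarrow> nat \<Rightarrow> (nat \<Rightarrow> real) \<Rightarrow> real" where
  "pow_form_diff n W i j x k y =
    (\<Sum>a<k. pow_app n W a x i * pow_app n W (k - 1 - a) y j + pow_app n W a x j * pow_app n W (k - 1 - a) y i)"

lemma pow_form_deriv:
  assumes ij: "i < n" "j < n"
  shows "((\<lambda>t. pow_form n (sym_ext (w((min i j, max i j) := t))) x k y) has_real_derivative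
    diag_factor i j * pow_form_diff n (sym_ext w) i j x k y) (at (w (min i j, max i j)))"
proof -
  let ?u = "(min i j, max i j)" and ?W = "sym_ext w"
  let ?h = "\<lambda>a i. \<Sum>j<n. entry_deriv ?u i j * pow_app n ?W (k - 1 - a) y j"
  have "((\<lambda>t. pow_form n (sym_ext (w(?u := t))) x k y) has_real_derivative
     (\<Sum>p<n. x p * (\<Sum>a<k. pow_app n ?W a (?h a) p))) (at (w ?u))"
    unfolding pow_form_def inner_n_def
    by (intro DERIV_sum DERIV_cmult pow_app_deriv)
  moreover have "(\<Sum>p<n. x p * (\<Sum>a<k. pow_app n ?W a (?h a) p)) =
      (\<Sum>a<k. inner_n n x (pow_app n ?W a (?h a)))"
    unfolding inner_n_def sum_distrib_left by (rule sum.swap)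
  moreover have "inner_n n x (pow_app n ?W a (?h a)) =
      (\<Sum>p<n. \<Sum>q<n. pow_app n ?W a x p * (entry_deriv ?u p q * pow_app n ?W (k - 1 - a) y q))" for a
    unfolding inner_pow_app[where n = n and x = x, OF sym_ext_sym]
    by (simp add: inner_n_def sum_distrib_left)
  ultimately show ?thesis
    unfolding sum_entry_deriv[OF ij] by (simp add: pow_form_diff_def sum_distrib_left)
qed

section \<open>Products of quadratic forms and their Schwinger-Dyson equation\<close>

type_synonym form = "(nat \<Rightarrow> real) \<times> nat \<times> (nat \<Rightarrow> real)"

primrec form_prod :: "nat \<Rightarrow> (nat \<Rightarrow> nat \<Rightarrow> real) \<Rightarrow> form list \<Rightarrow> real" where
  "form_prod n W [] = 1"
| "form_prod n W (f # L) = (case f of (x, k, y) \<Rightarrow> pow_form n W x k y) * form_prod n W L"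

primrec form_prod_diff :: "nat \<Rightarrow> (nat \<Rightarrow> nat \<Rightarrow> real) \<Rightarrow> nat \<Rightarrow> nat \<Rightarrow> form list \<Rightarrow> real" where
  "form_prod_diff n W i j [] = 0"
| "form_prod_diff n W i j (f # L) = (case f of (x, k, y) \<Rightarrow>
     pow_form_diff n W i j x k y * form_prod n W L + pow_form n W x k y * form_prod_diff n W i j L)"

text \<open>The outcome of integration by parts when the entry split off from p^T W^(k+1) q
  differentiates another factor: x^T W^l y is cut at each of its l places, and the two pieces are
  joined to p and to W^k q in both possible ways.\<close>

primrec form_cross :: "nat \<Rightarrow> (nat \<Rightarrow> nat \<Rightarrow> real) \<Rightarrow> (nat \<Rightarrow> real) \<Rightarrow> nat \<Rightarrow> (nat \<Rightarrow> real) \<Rightarrow> form list \<Rightarrow> real" where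
  "form_cross n W p k q [] = 0"
| "form_cross n W p k q (f # L) = (case f of (x, l, y) \<Rightarrow>
     (\<Sum>a<l. form_prod n W ((p, a, x) # (q, k + (l - 1 - a), y) # L) +
            form_prod n W ((q, k + a, x) # (p, l - 1 - a, y) # L))
     + pow_form n W x l y * form_cross n W p k q L)"

lemma form_prod_append: "form_prod n W (L @ L') = form_prod n W L * form_prod n W L'"
  by (induction L) (auto simp: mult_ac)

lemma goe_poly_form_prod: "goe_poly n (\<lambda>w. form_prod n (sym_ext w) L)"
  by (induction L) (auto intro!: gauss_poly_intros goe_poly_pow_form simp: split_beta)

lemma goe_poly_form_cross: "goe_poly n (\<lambda>w. form_cross n (sym_ext w) p k q L)"
  by (induction L)
    (auto intro!: gauss_poly_intros goe_poly_pow_form goe_poly_form_prod simp: split_beta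
      simp del: form_prod.simps)

lemma form_prod_deriv:
  assumes ij: "i < n" "j < n"
  shows "((\<lambda>t. form_prod n (sym_ext (w((min i j, max i j) := t))) L) has_real_derivative
    diag_factor i j * form_prod_diff n (sym_ext w) i j L) (at (w (min i j, max i j)))"
proof (induction L)
  case (Cons f L)
  obtain x k y where f: "f = (x, k, y)" by (cases f)
  show ?case
    unfolding f form_prod.simps form_prod_diff.simps prod.case
    by (rule DERIV_cong, rule DERIV_mult, rule pow_form_deriv[OF ij], rule Cons) (simp add: algebra_simps)
qed simp

text \<open>Every term of the derivative is a function of i times a function of j, so the double sum
  against p_i (W^k q)_j splits into two inner products; symmetry of W moves the powers
  together.\<close>

lemma form_prod_diff_sum:
  assumes sym: "\<And>i j. W i j = W j i"
  shows "(\<Sum>i<n. \<Sum>j<n. p i * pow_app n W k q j * form_prod_diff n W i j L) = form_cross n W p k q L"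
proof (induction L)
  case (Cons f L)
  obtain x l y where f: "f = (x, l, y)" by (cases f)
  have sep: "(\<Sum>i<n. \<Sum>j<n. (p i * g i) * (pow_app n W k q j * h j)) =
      inner_n n p g * inner_n n (pow_app n W k q) h" for g h
    unfolding inner_n_def by (simp add: sum_product)
  have term1: "(\<Sum>i<n. \<Sum>j<n. p i * pow_app n W k q j * pow_form_diff n W i j x l y) =
      (\<Sum>a<l. pow_form n W p a x * pow_form n W q (k + (l - 1 - a)) y +
            pow_form n W q (k + a) x * pow_form n W p (l - 1 - a) y)"
  proof -
    have "(\<Sum>i<n. \<Sum>j<n. p i * pow_app n W k q j * pow_form_diff n W i j x l y) =
       (\<Sum>i<n. \<Sum>j<n. \<Sum>a<l.
         ((p i * pow_app n W a x i) * (pow_app n W k q j * pow_app n W (l - 1 - a) y j) +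
          (p i * pow_app n W (l - 1 - a) y i) * (pow_app n W k q j * pow_app n W a x j)))"
      unfolding pow_form_diff_def sum_distrib_left
      by (intro sum.cong refl) (simp add: algebra_simps)
    also have "\<dots> = (\<Sum>a<l. \<Sum>i<n. \<Sum>j<n.
         ((p i * pow_app n W a x i) * (pow_app n W k q j * pow_app n W (l - 1 - a) y j) +
          (p i * pow_app n W (l - 1 - a) y i) * (pow_app n W k q j * pow_app n W a x j)))"
      by (simp only: sum.swap[of _ "{..<l}"])
    also have "\<dots> = (\<Sum>a<l. inner_n n p (pow_app n W a x) * inner_n n (pow_app n W k q) (pow_app n W (l - 1 - a) y)
        + inner_n n p (pow_app n W (l - 1 - a) y) * inner_n n (pow_app n W k q) (pow_app n W a x))"
      by (simp only: sum.distrib sep)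
    also have "\<dots> = (\<Sum>a<l. pow_form n W p a x * pow_form n W q (k + (l - 1 - a)) y +
            pow_form n W q (k + a) x * pow_form n W p (l - 1 - a) y)"
      unfolding inner_pow_app_pow_app[OF sym] by (simp add: pow_form_def mult_ac)
    finally show ?thesis .
  qed
  have "(\<Sum>i<n. \<Sum>j<n. p i * pow_app n W k q j * form_prod_diff n W i j (f # L)) =
      (\<Sum>i<n. \<Sum>j<n. p i * pow_app n W k q j * pow_form_diff n W i j x l y) * form_prod n W L +
      pow_form n W x l y * (\<Sum>i<n. \<Sum>j<n. p i * pow_app n W k q j * form_prod_diff n W i j L)"
    unfolding sum_distrib_right sum_distrib_left sum.distrib[symmetric]
    by (intro sum.cong refl) (simp add: f algebra_simps)
  also have "\<dots> = form_cross n W p k q (f # L)"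
    unfolding Cons term1 by (simp add: f sum_distrib_right distrib_right mult.assoc)
  finally show ?case .
qed simp

text \<open>Here the derivative also hits W^k q itself. Of the two terms of a cut, one sums over j
  to p^T W^(k-1) q and the other produces the trace of W^a. The trace is kept as a sum of forms in
  unit vectors, so that the result consists of products of forms again.\<close>

lemma form_prod_diff_unit_sum:
  assumes sym: "\<And>i j. W i j = W j i"
  shows "(\<Sum>i<n. \<Sum>j<n. p i * form_prod_diff n W i j ((unit_fun j, k, q) # L)) =
    (\<Sum>a<k. form_prod n W ((p, k - 1, q) # L) +
      (\<Sum>j<n. form_prod n W ((unit_fun j, a, unit_fun j) # (p, k - 1 - a, q) # L))) +
    form_cross n W p k q L"
proof -
  have "(\<Sum>i<n. \<Sum>j<n. p i * pow_form_diff n W i j (unit_fun j) k q) =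
     (\<Sum>j<n. \<Sum>i<n. \<Sum>a<k.
         (p i * pow_app n W a (unit_fun j) i) * pow_app n W (k - 1 - a) q j +
         (p i * pow_app n W (k - 1 - a) q i) * pow_app n W a (unit_fun j) j)"
    unfolding pow_form_diff_def sum_distrib_left
    by (subst sum.swap) (intro sum.cong refl, simp add: algebra_simps)
  also have "\<dots> = (\<Sum>a<k. \<Sum>j<n. \<Sum>i<n.
         (p i * pow_app n W a (unit_fun j) i) * pow_app n W (k - 1 - a) q j +
         (p i * pow_app n W (k - 1 - a) q i) * pow_app n W a (unit_fun j) j)"
    by (simp only: sum.swap[of _ "{..<k}"])
  also have "\<dots> = (\<Sum>a<k. \<Sum>j<n.
         inner_n n p (pow_app n W a (unit_fun j)) * pow_app n W (k - 1 - a) q j +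
         pow_form n W p (k - 1 - a) q * pow_form n W (unit_fun j) a (unit_fun j))"
    by (intro sum.cong refl) (simp add: sum.distrib inner_n_def sum_distrib_right pow_form_def[of n W p] pow_form_unit)
  also have "\<dots> = (\<Sum>a<k. \<Sum>j<n.
         pow_app n W a p j * pow_app n W (k - 1 - a) q j +
         pow_form n W p (k - 1 - a) q * pow_form n W (unit_fun j) a (unit_fun j))"
    by (simp add: inner_pow_app[OF sym])
  also have "\<dots> = (\<Sum>a<k. inner_n n (pow_app n W a p) (pow_app n W (k - 1 - a) q) +
      (\<Sum>j<n. pow_form n W p (k - 1 - a) q * pow_form n W (unit_fun j) a (unit_fun j)))"
    by (simp add: sum.distrib inner_n_def)
  also have "\<dots> = (\<Sum>a<k. pow_form n W p (k - 1) q +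
      (\<Sum>j<n. pow_form n W p (k - 1 - a) q * pow_form n W (unit_fun j) a (unit_fun j)))"
    unfolding inner_pow_app_pow_app[OF sym] by (intro sum.cong refl) simp
  finally have 1: "(\<Sum>i<n. \<Sum>j<n. p i * pow_form_diff n W i j (unit_fun j) k q) = \<dots>" .
  have "(\<Sum>i<n. \<Sum>j<n. p i * form_prod_diff n W i j ((unit_fun j, k, q) # L)) =
     (\<Sum>i<n. \<Sum>j<n. p i * pow_form_diff n W i j (unit_fun j) k q) * form_prod n W L +
     (\<Sum>i<n. \<Sum>j<n. p i * pow_app n W k q j * form_prod_diff n W i j L)"
    unfolding sum_distrib_right sum.distrib[symmetric]
    by (intro sum.cong refl) (simp add: pow_form_unit algebra_simps)
  also have "\<dots> = (\<Sum>a<k. form_prod n W ((p, k - 1, q) # L) +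
      (\<Sum>j<n. form_prod n W ((unit_fun j, a, unit_fun j) # (p, k - 1 - a, q) # L))) +
    form_cross n W p k q L"
    unfolding form_prod_diff_sum[OF sym] 1 sum_distrib_right distrib_right
    by (simp add: sum_distrib_right mult_ac)
  finally show ?thesis .
qed

abbreviation form_mean :: "nat \<Rightarrow> form list \<Rightarrow> real" where
  "form_mean n L \<equiv> (\<integral>w. form_prod n (sym_ext w) L \<partial>goe_vars n)"

lemma integral_double_sum:
  fixes f :: "nat \<Rightarrow> nat \<Rightarrow> 'a \<Rightarrow> real"
  assumes "\<And>i j. i < n \<Longrightarrow> j < n \<Longrightarrow> integrable M (f i j)"
  shows "(\<integral>w. (\<Sum>i<n. \<Sum>j<n. f i j w) \<partial>M) = (\<Sum>i<n. \<Sum>j<n. \<integral>w. f i j w \<partial>M)"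
proof -
  have "(\<integral>w. (\<Sum>i<n. \<Sum>j<n. f i j w) \<partial>M) = (\<Sum>i<n. \<integral>w. (\<Sum>j<n. f i j w) \<partial>M)"
    by (intro Bochner_Integration.integral_sum Bochner_Integration.integrable_sum assms) auto
  also have "\<dots> = (\<Sum>i<n. \<Sum>j<n. \<integral>w. f i j w \<partial>M)"
    by (intro sum.cong refl Bochner_Integration.integral_sum assms) auto
  finally show ?thesis .
qed

text \<open>Write p^T W^(k+1) q as the sum of p_i W_ij (W^k q)_j and integrate by parts in W_ij.
  Only the trace term has n summands to make up for the division by n. For k = 0 the sum over a is
  empty, so \<open>k - 1\<close> is harmless.\<close>

lemma loop_equation:
  assumes n: "0 < n"
  shows "form_mean n ((p, Suc k, q) # L) =
    ((\<Sum>a<k. form_mean n ((p, k - 1, q) # L) +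
       (\<Sum>j<n. form_mean n ((unit_fun j, a, unit_fun j) # (p, k - 1 - a, q) # L))) +
     (\<integral>w. form_cross n (sym_ext w) p k q L \<partial>goe_vars n)) / real n"
proof -
  interpret gaussian_product "upper_indices n" "goe_sd n" by (rule gaussian_product_goe[OF n])
  note [simp] = gauss_poly_integrable[OF goe_poly_form_prod] gauss_poly_integrable[OF goe_poly_form_cross]
  let ?F = "\<lambda>j w. form_prod n (sym_ext w) ((unit_fun j, k, q) # L)"
  have dint: "integrable (goe_vars n) (\<lambda>w. form_prod_diff n (sym_ext w) i j L')" if "i < n" "j < n" for i j L'
    using that
    by (intro gauss_poly_integrable, induction L')
      (auto intro!: gauss_poly_intros goe_poly_pow_form goe_poly_pow_app goe_poly_form_prod simp: split_beta pow_form_diff_def)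
  have "form_prod n (sym_ext w) ((p, Suc k, q) # L) =
      (\<Sum>i<n. \<Sum>j<n. p i * (sym_ext w i j * ?F j w))" for w
    by (simp add: pow_form_def[of n _ p] inner_n_def sum_distrib_left sum_distrib_right pow_form_unit mult_ac)
  then have "form_mean n ((p, Suc k, q) # L) =
      (\<integral>w. (\<Sum>i<n. \<Sum>j<n. p i * (sym_ext w i j * ?F j w)) \<partial>goe_vars n)"
    by simp
  also have "\<dots> = (\<Sum>i<n. \<Sum>j<n. p i * (\<integral>w. sym_ext w i j * ?F j w \<partial>goe_vars n))"
  proof -
    have *: "integrable (goe_vars n) (\<lambda>w. p i * (sym_ext w i j * ?F j w))" if "i < n" "j < n" for i j
      using that by (intro gauss_poly_integrable gauss_poly_intros goe_poly_entry goe_poly_form_prod)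
    show ?thesis by (subst integral_double_sum[OF *]) simp_all
  qed
  also have "\<dots> = (\<Sum>i<n. \<Sum>j<n. p i * ((\<integral>w. form_prod_diff n (sym_ext w) i j ((unit_fun j, k, q) # L) \<partial>goe_vars n) / real n))"
    by (intro sum.cong refl arg_cong2[where f = "(*)"] goe_ibp n goe_poly_form_prod form_prod_deriv) auto
  also have "\<dots> = (\<integral>w. (\<Sum>i<n. \<Sum>j<n. p i * form_prod_diff n (sym_ext w) i j ((unit_fun j, k, q) # L)) \<partial>goe_vars n) / real n"
    by (subst integral_double_sum) (simp_all add: dint sum_divide_distrib del: form_prod_diff.simps)
  also have "\<dots> = (\<integral>w. (\<Sum>a<k. form_prod n (sym_ext w) ((p, k - 1, q) # L) +
      (\<Sum>j<n. form_prod n (sym_ext w) ((unit_fun j, a, unit_fun j) # (p, k - 1 - a, q) # L))) +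
    form_cross n (sym_ext w) p k q L \<partial>goe_vars n) / real n"
    by (simp only: form_prod_diff_unit_sum[OF sym_ext_sym])
  also have "\<dots> = ((\<Sum>a<k. form_mean n ((p, k - 1, q) # L) +
       (\<Sum>j<n. form_mean n ((unit_fun j, a, unit_fun j) # (p, k - 1 - a, q) # L))) +
     (\<integral>w. form_cross n (sym_ext w) p k q L \<partial>goe_vars n)) / real n"
    by (simp add: Bochner_Integration.integral_sum del: form_prod.simps)
  finally show ?thesis .
qed

section \<open>Moments of products of quadratic forms\<close>

lemma unit_fun_apply: "unit_fun i j = (if j = i then 1 else 0)"
  by (simp add: unit_fun_def)

text \<open>In a labelled form, \<open>None\<close> stands for the spike vector \<open>v\<close> and \<open>Some i\<close> for the \<open>i\<close>-th unit
  vector. Mixed forms, with one label of each kind, are of order \<open>n powr (-1/2)\<close> for a flat \<open>v\<close>.\<close>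

type_synonym lform = "nat option \<times> nat \<times> nat option"

primrec lab_vec :: "(nat \<Rightarrow> real) \<Rightarrow> nat option \<Rightarrow> nat \<Rightarrow> real" where
  "lab_vec v None = v"
| "lab_vec v (Some i) = unit_fun i"

definition lab_form :: "(nat \<Rightarrow> real) \<Rightarrow> lform \<Rightarrow> form" where
  "lab_form v = (\<lambda>(x, k, y). (lab_vec v x, k, lab_vec v y))"

definition lab_ok :: "nat \<Rightarrow> nat option \<Rightarrow> bool" where
  "lab_ok n x \<longleftrightarrow> (\<forall>i. x = Some i \<longrightarrow> i < n)"

definition forms_ok :: "nat \<Rightarrow> lform list \<Rightarrow> bool" where
  "forms_ok n L \<longleftrightarrow> (\<forall>(x, k, y)\<in>set L. lab_ok n x \<and> lab_ok n y)"

definition forms_deg :: "lform list \<Rightarrow> nat" where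
  "forms_deg L = sum_list (map (\<lambda>(x, k, y). k) L)"

definition mixed :: "nat option \<Rightarrow> nat option \<Rightarrow> nat" where
  "mixed x y = (if (x = None) = (y = None) then 0 else 1)"

definition forms_mixed :: "lform list \<Rightarrow> nat" where
  "forms_mixed L = sum_list (map (\<lambda>(x, k, y). mixed x y) L)"

text \<open>The constant \<open>c\<close> is a parameter separate from \<open>n\<close>, since the
  later bounds have to hold uniformly over all spike vectors that the partitions can
  produce.\<close>

definition flat_unit :: "nat \<Rightarrow> real \<Rightarrow> (nat \<Rightarrow> real) \<Rightarrow> bool" where
  "flat_unit n c v \<longleftrightarrow> inner_n n v v = 1 \<and> (\<forall>i<n. \<bar>v i\<bar> \<le> c / sqrt (real n))"

abbreviation lmean :: "nat \<Rightarrow> (nat \<Rightarrow> real) \<Rightarrow> lform list \<Rightarrow> real" where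
  "lmean n v L \<equiv> form_mean n (map (lab_form v) L)"

lemma lab_form_simps [simp]: "lab_form v (x, k, y) = (lab_vec v x, k, lab_vec v y)"
  by (simp add: lab_form_def)

lemma forms_simps [simp]:
  "forms_ok n []" "forms_ok n ((x, k, y) # L) \<longleftrightarrow> lab_ok n x \<and> lab_ok n y \<and> forms_ok n L"
  "forms_ok n (L @ L') \<longleftrightarrow> forms_ok n L \<and> forms_ok n L'"
  "forms_deg [] = 0" "forms_deg ((x, k, y) # L) = k + forms_deg L"
  "forms_deg (L @ L') = forms_deg L + forms_deg L'"
  "forms_mixed [] = 0" "forms_mixed ((x, k, y) # L) = mixed x y + forms_mixed L"
  "forms_mixed (L @ L') = forms_mixed L + forms_mixed L'"
  by (auto simp: forms_ok_def forms_deg_def forms_mixed_def ball_Un)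

lemma lab_ok_simps [simp]: "lab_ok n None" "lab_ok n (Some i) \<longleftrightarrow> i < n"
  by (auto simp: lab_ok_def)

lemma form_prod_mset:
  "form_prod n W L = prod_mset (image_mset (\<lambda>(x, k, y). pow_form n W x k y) (mset L))"
  by (induction L) (auto simp: split_beta)

text \<open>A product of forms depends on the multiset of its factors only, so a factor of positive
  degree can be moved to the head, where \<open>loop_equation\<close> applies.\<close>

lemma forms_reorder:
  assumes "(x, k, y) \<in> set L"
  shows "form_prod n W (map (lab_form v) L) = form_prod n W (map (lab_form v) ((x, k, y) # remove1 (x, k, y) L))"
    "forms_ok n L \<longleftrightarrow> forms_ok n ((x, k, y) # remove1 (x, k, y) L)"
    "forms_deg L = forms_deg ((x, k, y) # remove1 (x, k, y) L)"
    "forms_mixed L = forms_mixed ((x, k, y) # remove1 (x, k, y) L)"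
    "length L = Suc (length (remove1 (x, k, y) L))"
proof -
  have m: "mset L = mset ((x, k, y) # remove1 (x, k, y) L)"
    using assms by simp
  show "form_prod n W (map (lab_form v) L) = form_prod n W (map (lab_form v) ((x, k, y) # remove1 (x, k, y) L))"
    unfolding form_prod_mset mset_map m ..
  show "forms_ok n L \<longleftrightarrow> forms_ok n ((x, k, y) # remove1 (x, k, y) L)"
    unfolding forms_ok_def using m by (metis set_mset_mset)
  have "sum_mset (image_mset g (mset L)) = sum_mset (image_mset g (mset ((x, k, y) # remove1 (x, k, y) L)))"
    for g :: "lform \<Rightarrow> nat"
    unfolding m ..
  then show "forms_deg L = forms_deg ((x, k, y) # remove1 (x, k, y) L)"
    "forms_mixed L = forms_mixed ((x, k, y) # remove1 (x, k, y) L)"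
    unfolding forms_deg_def forms_mixed_def sum_mset_sum_list[symmetric] mset_map by blast+
  show "length L = Suc (length (remove1 (x, k, y) L))"
    using m by (metis length_Cons size_mset)
qed

lemma abs_sum_le_card:
  fixes f :: "'a \<Rightarrow> real"
  assumes "\<And>a. a \<in> A \<Longrightarrow> \<bar>f a\<bar> \<le> B"
  shows "\<bar>\<Sum>a\<in>A. f a\<bar> \<le> real (card A) * B"
  using sum_norm_bound[of A f B] assms by simp

text \<open>\<open>pre\<close> accumulates the factors that the recursion of
  \<open>form_cross\<close> has passed and left outside. Rejoining p, q with x, y removes two forms
  and creates two, so at most two mixed forms are lost; this is the \<open>+ 2\<close> in the
  hypothesis. Each cut contributes two terms, whence the factor 2 in the bound.\<close>

lemma cross_bound:
  assumes n: "0 < n" and B: "\<And>L. forms_ok n L \<Longrightarrow> length L \<le> M \<Longrightarrow> forms_deg L \<le> N \<Longrightarrow>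
      \<mu> \<le> forms_mixed L + 2 \<Longrightarrow> \<bar>lmean n v L\<bar> \<le> B"
    and ok: "lab_ok n p" "lab_ok n q" "forms_ok n pre" "forms_ok n L"
    and len: "length pre + length L < M" and deg: "forms_deg pre + k + forms_deg L \<le> N"
    and mix: "\<mu> \<le> forms_mixed pre + mixed p q + forms_mixed L"
  shows "\<bar>\<integral>w. form_prod n (sym_ext w) (map (lab_form v) pre) *
      form_cross n (sym_ext w) (lab_vec v p) k (lab_vec v q) (map (lab_form v) L) \<partial>goe_vars n\<bar>
    \<le> 2 * real (forms_deg L) * B"
  using ok len deg mix
proof (induction L arbitrary: pre)
  case (Cons f L)
  interpret gaussian_product "upper_indices n" "goe_sd n" by (rule gaussian_product_goe[OF n])
  obtain x l y where f: "f = (x, l, y)" by (cases f)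
  let ?m = "map (lab_form v)"
  let ?A = "\<lambda>a. pre @ (p, a, x) # (q, k + (l - 1 - a), y) # L"
  let ?A' = "\<lambda>a. pre @ (q, k + a, x) # (p, l - 1 - a, y) # L"
  let ?C = "\<lambda>w. form_cross n (sym_ext w) (lab_vec v p) k (lab_vec v q) (?m L)"
  have bA: "\<bar>lmean n v (?A a)\<bar> \<le> B" "\<bar>lmean n v (?A' a)\<bar> \<le> B" if "a < l" for a
    by (rule B; use Cons.prems that in \<open>auto simp: f mixed_def split: if_splits\<close>)+
  have IH: "\<bar>\<integral>w. form_prod n (sym_ext w) (?m (pre @ [f])) * ?C w \<partial>goe_vars n\<bar>
      \<le> 2 * real (forms_deg L) * B"
    using Cons.prems by (intro Cons.IH) (auto simp: f)
  have int: "integrable (goe_vars n) (\<lambda>w. form_prod n (sym_ext w) L')" for L'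
    by (intro gauss_poly_integrable goe_poly_form_prod)
  have intC: "integrable (goe_vars n) (\<lambda>w. form_prod n (sym_ext w) L' * ?C w)" for L'
    by (intro gauss_poly_integrable gauss_poly_mult goe_poly_form_prod goe_poly_form_cross)
  have split: "form_prod n (sym_ext w) (?m pre) *
      form_cross n (sym_ext w) (lab_vec v p) k (lab_vec v q) (?m (f # L)) =
     (\<Sum>a<l. form_prod n (sym_ext w) (?m (?A a)) + form_prod n (sym_ext w) (?m (?A' a))) +
     form_prod n (sym_ext w) (?m (pre @ [f])) * ?C w" for w
    by (simp add: f form_prod_append distrib_left sum_distrib_left mult_ac sum.distrib)
  have int_split: "(\<integral>w. form_prod n (sym_ext w) (?m pre) *
      form_cross n (sym_ext w) (lab_vec v p) k (lab_vec v q) (?m (f # L)) \<partial>goe_vars n) =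
     (\<Sum>a<l. lmean n v (?A a) + lmean n v (?A' a)) +
     (\<integral>w. form_prod n (sym_ext w) (?m (pre @ [f])) * ?C w \<partial>goe_vars n)"
  proof -
    have "(\<integral>w. (\<Sum>a<l. form_prod n (sym_ext w) (?m (?A a)) + form_prod n (sym_ext w) (?m (?A' a))) \<partial>goe_vars n)
        = (\<Sum>a<l. \<integral>w. form_prod n (sym_ext w) (?m (?A a)) + form_prod n (sym_ext w) (?m (?A' a)) \<partial>goe_vars n)"
      by (intro Bochner_Integration.integral_sum Bochner_Integration.integrable_add int)
    also have "\<dots> = (\<Sum>a<l. lmean n v (?A a) + lmean n v (?A' a))"
      by (intro sum.cong refl Bochner_Integration.integral_add int)
    finally have eq: "(\<integral>w. (\<Sum>a<l. form_prod n (sym_ext w) (?m (?A a)) + form_prod n (sym_ext w) (?m (?A' a))) \<partial>goe_vars n)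
        = \<dots>" .
    show ?thesis
      by (rule trans[OF Bochner_Integration.integral_cong[OF refl split]],
        rule trans[OF Bochner_Integration.integral_add], rule Bochner_Integration.integrable_sum,
        rule Bochner_Integration.integrable_add[OF int int], rule intC, rule arg_cong[OF eq])
  qed
  have "\<bar>lmean n v (?A a) + lmean n v (?A' a)\<bar> \<le> 2 * B" if "a < l" for a
    by (rule order.trans[OF abs_triangle_ineq order.trans[OF add_mono[OF bA[OF that]]]]) simp
  then have bound: "\<bar>\<Sum>a<l. lmean n v (?A a) + lmean n v (?A' a)\<bar> \<le> real (card {..<l}) * (2 * B)"
    by (intro abs_sum_le_card) (simp only: lessThan_iff)
  have "\<bar>\<integral>w. form_prod n (sym_ext w) (?m pre) *
      form_cross n (sym_ext w) (lab_vec v p) k (lab_vec v q) (?m (f # L)) \<partial>goe_vars n\<bar>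
    \<le> real (card {..<l}) * (2 * B) + 2 * real (forms_deg L) * B"
    unfolding int_split by (rule order.trans[OF abs_triangle_ineq add_mono[OF bound IH]])
  also have "\<dots> = 2 * real (forms_deg (f # L)) * B"
    by (simp add: f algebra_simps)
  finally show ?case .
qed simp

lemma lab_vec_inner:
  assumes c: "1 \<le> c" and v: "flat_unit n c v" and ok: "lab_ok n x" "lab_ok n y"
  shows "\<bar>inner_n n (lab_vec v x) (lab_vec v y)\<bar> \<le> c * (1 / sqrt n) ^ mixed x y"
  using assms by (cases x; cases y)
    (auto simp: mixed_def flat_unit_def unit_fun_apply)

lemma moment_bound_const:
  assumes n: "0 < n" and c: "1 \<le> c" and v: "flat_unit n c v"
    and L: "forms_ok n L" "forms_deg L = 0"
  shows "\<bar>form_prod n W (map (lab_form v) L)\<bar> \<le> c ^ length L * (1 / sqrt n) ^ forms_mixed L"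
  using L
proof (induction L)
  case (Cons f L)
  obtain x l y where f: "f = (x, l, y)" by (cases f)
  have "\<bar>inner_n n (lab_vec v x) (lab_vec v y)\<bar> * \<bar>form_prod n W (map (lab_form v) L)\<bar> \<le>
      (c * (1 / sqrt n) ^ mixed x y) * (c ^ length L * (1 / sqrt n) ^ forms_mixed L)"
    using Cons c v by (intro mult_mono lab_vec_inner Cons.IH) (auto simp: f)
  then show ?case using Cons.prems
    by (simp add: f abs_mult pow_form_def power_add mult_ac)
qed simp

lemma (in prob_space) abs_integral_le_bound:
  fixes f :: "'a \<Rightarrow> real"
  assumes "integrable M f" "\<And>x. \<bar>f x\<bar> \<le> B"
  shows "\<bar>\<integral>x. f x \<partial>M\<bar> \<le> B"
proof -
  have "\<bar>\<integral>x. f x \<partial>M\<bar> \<le> (\<integral>x. \<bar>f x\<bar> \<partial>M)" by (rule integral_abs_bound)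
  also have "\<dots> \<le> (\<integral>x. B \<partial>M)" using assms by (intro integral_mono) auto
  finally show ?thesis by (simp add: prob_space)
qed

lemma positive_degree_form:
  assumes "forms_deg L \<noteq> 0"
  obtains x k y where "(x, Suc k, y) \<in> set L"
proof -
  from assms obtain x k y where "(x, k, y) \<in> set L" "k \<noteq> 0"
    by (auto simp: forms_deg_def)
  then show thesis using that[of x "k - 1" y] by simp
qed

text \<open>The loop equation replaces a moment by moments of lower degree. It can lose two mixed factors
  at most, and then it gains a factor $1/n$.\<close>

lemma moment_bound:
  assumes c: "1 \<le> c"
  shows "\<exists>K\<ge>0. \<forall>n>0. \<forall>v. flat_unit n c v \<longrightarrow> (\<forall>L. forms_ok n L \<longrightarrow> length L \<le> m \<longrightarrow> forms_deg L \<le> N \<longrightarrow>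
    \<bar>lmean n v L\<bar> \<le> K * (1 / sqrt n) ^ forms_mixed L)"
proof (induction N arbitrary: m)
  case 0
  show ?case
  proof (intro exI[of _ "c ^ m"] conjI allI impI)
    fix n :: nat and v L
    assume n: "0 < n" and v: "flat_unit n c v" and L: "forms_ok n L" "length L \<le> m" "forms_deg L \<le> 0"
    interpret gaussian_product "upper_indices n" "goe_sd n" by (rule gaussian_product_goe[OF n])
    have "c ^ length L * (1 / sqrt n) ^ forms_mixed L \<le> c ^ m * (1 / sqrt n) ^ forms_mixed L"
      using L c by (intro mult_right_mono power_increasing) auto
    then show "\<bar>lmean n v L\<bar> \<le> c ^ m * (1 / sqrt n) ^ forms_mixed L"
      using L by (intro abs_integral_le_bound gauss_poly_integrable goe_poly_form_prod
        order.trans[OF moment_bound_const[OF n c v]]) auto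
  qed (use c in auto)
next
  case (Suc N)
  \<comment> \<open>The loop equation lowers the degree but may lengthen the list by one form, hence
    \<open>Suc m\<close> and the generalization over \<open>m\<close>.\<close>
  obtain K where K0: "K \<ge> 0" and K: "\<And>n v L. 0 < n \<Longrightarrow> flat_unit n c v \<Longrightarrow> forms_ok n L \<Longrightarrow>
      length L \<le> Suc m \<Longrightarrow> forms_deg L \<le> N \<Longrightarrow> \<bar>lmean n v L\<bar> \<le> K * (1 / sqrt n) ^ forms_mixed L"
    using Suc[of "Suc m"] by blast
  show ?case
  \<comment> \<open>The self terms contribute at most 2 k, as 1 / n + 1 \<le> 2, and the cross terms
    2 \<open>forms_deg L'\<close>. The + 1 keeps the constant above K when the degree is already at
    most N.\<close>
  proof (intro exI[of _ "K * (4 * real N + 1)"] conjI allI impI)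
    fix n :: nat and v L
    assume n: "0 < n" and v: "flat_unit n c v" and L: "forms_ok n L" "length L \<le> m" "forms_deg L \<le> Suc N"
    let ?h = "1 / sqrt (real n)"
    have h: "0 < ?h" "?h \<le> 1" "real n * ?h\<^sup>2 = 1"
      using n by (auto simp: power_divide)
    show "\<bar>lmean n v L\<bar> \<le> K * (4 * real N + 1) * ?h ^ forms_mixed L"
    proof (cases "forms_deg L \<le> N")
      case True
      then have "\<bar>lmean n v L\<bar> \<le> K * ?h ^ forms_mixed L" using K[OF n v L(1)] L by simp
      also have "\<dots> \<le> K * (4 * real N + 1) * ?h ^ forms_mixed L"
        using K0 by (intro mult_right_mono) (auto simp: algebra_simps)
      finally show ?thesis .
    next
      case False
      then have deg: "forms_deg L = Suc N" using L by simp
      then have "forms_deg L \<noteq> 0" by simp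
      then obtain p k q where pq: "(p, Suc k, q) \<in> set L" by (rule positive_degree_form)
      define L' where "L' = remove1 (p, Suc k, q) L"
      note re = forms_reorder[OF pq, folded L'_def]
      define \<mu> where "\<mu> = forms_mixed L"
      have \<mu>: "\<mu> = mixed p q + forms_mixed L'" using re by (simp add: \<mu>_def)
      have ok: "lab_ok n p" "lab_ok n q" "forms_ok n L'" using re L by auto
      have len: "length L' < m" using re L by simp
      have degs: "k + forms_deg L' = N" using re deg by simp
      have B0: "0 \<le> K * ?h ^ \<mu>" using K0 h by simp
      have t1: "\<bar>form_mean n ((lab_vec v p, k - 1, lab_vec v q) # map (lab_form v) L')\<bar> \<le> K * ?h ^ \<mu>"
        using K[OF n v, of "(p, k - 1, q) # L'"] ok len degs \<mu> by simp
      have t2: "\<bar>form_mean n ((unit_fun j, a, unit_fun j) #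
          (lab_vec v p, k - 1 - a, lab_vec v q) # map (lab_form v) L')\<bar> \<le> K * ?h ^ \<mu>"
        if "j < n" "a < k" for a j
        using K[OF n v, of "(Some j, a, Some j) # (p, k - 1 - a, q) # L'"] ok len degs \<mu> that
        by (simp add: mixed_def)
      have t3: "\<bar>\<integral>w. form_cross n (sym_ext w) (lab_vec v p) k (lab_vec v q) (map (lab_form v) L') \<partial>goe_vars n\<bar>
          \<le> 2 * real (forms_deg L') * (real n * (K * ?h ^ \<mu>))"
      proof -
        have "\<bar>\<integral>w. form_prod n (sym_ext w) (map (lab_form v) []) *
            form_cross n (sym_ext w) (lab_vec v p) k (lab_vec v q) (map (lab_form v) L') \<partial>goe_vars n\<bar>
            \<le> 2 * real (forms_deg L') * (real n * (K * ?h ^ \<mu>))"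
        proof (rule cross_bound[OF n])
          fix L'' assume *: "forms_ok n L''" "length L'' \<le> Suc m" "forms_deg L'' \<le> N" "\<mu> \<le> forms_mixed L'' + 2"
          have "real n * ?h ^ (forms_mixed L'' + 2) = real n * ?h\<^sup>2 * ?h ^ forms_mixed L''"
            by (simp only: power_add mult_ac)
          then have "?h ^ forms_mixed L'' = real n * ?h ^ (forms_mixed L'' + 2)"
            by (simp only: h(3) mult_1)
          also have "\<dots> \<le> real n * ?h ^ \<mu>"
            using h * by (intro mult_left_mono power_decreasing) auto
          finally have "K * ?h ^ forms_mixed L'' \<le> K * (real n * ?h ^ \<mu>)" using K0 by (rule mult_left_mono)
          then show "\<bar>lmean n v L''\<bar> \<le> real n * (K * ?h ^ \<mu>)"
            using K[OF n v *(1-3)] by (simp add: mult_ac)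
        qed (use ok len degs \<mu> in auto)
        then show ?thesis by simp
      qed
      have el: "\<bar>form_mean n ((lab_vec v p, k - 1, lab_vec v q) # map (lab_form v) L') +
          (\<Sum>j<n. form_mean n ((unit_fun j, a, unit_fun j) # (lab_vec v p, k - 1 - a, lab_vec v q) # map (lab_form v) L'))\<bar>
          \<le> K * ?h ^ \<mu> + real (card {..<n}) * (K * ?h ^ \<mu>)" if "a < k" for a
        by (rule order.trans[OF abs_triangle_ineq add_mono[OF t1 abs_sum_le_card[OF t2]]])
          (simp_all only: lessThan_iff that)
      have "\<bar>lmean n v L\<bar> = \<bar>form_mean n ((lab_vec v p, Suc k, lab_vec v q) # map (lab_form v) L')\<bar>"
        using re(1)[where v = v and n = n] by (simp del: form_prod.simps)
      also have "\<dots> \<le> (\<bar>\<Sum>a<k. form_mean n ((lab_vec v p, k - 1, lab_vec v q) # map (lab_form v) L') +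
           (\<Sum>j<n. form_mean n ((unit_fun j, a, unit_fun j) # (lab_vec v p, k - 1 - a, lab_vec v q) # map (lab_form v) L'))\<bar>
          + \<bar>\<integral>w. form_cross n (sym_ext w) (lab_vec v p) k (lab_vec v q) (map (lab_form v) L') \<partial>goe_vars n\<bar>) / real n"
        unfolding loop_equation[OF n] abs_divide abs_of_nat
        by (intro divide_right_mono abs_triangle_ineq of_nat_0_le_iff)
      also have "\<dots> \<le> (real (card {..<k}) * (K * ?h ^ \<mu> + real (card {..<n}) * (K * ?h ^ \<mu>)) +
          2 * real (forms_deg L') * (real n * (K * ?h ^ \<mu>))) / real n"
        by (intro divide_right_mono add_mono t3 abs_sum_le_card el of_nat_0_le_iff) (simp only: lessThan_iff)
      also have "\<dots> = (real k * (1 / real n + 1) + 2 * real (forms_deg L')) * (K * ?h ^ \<mu>)"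
        using n by (simp add: field_simps)
      also have "\<dots> \<le> (4 * real N + 1) * (K * ?h ^ \<mu>)"
      proof (intro mult_right_mono B0)
        have "real k * (1 / real n + 1) \<le> real k * 2" using n by (intro mult_left_mono) auto
        then show "real k * (1 / real n + 1) + 2 * real (forms_deg L') \<le> 4 * real N + 1"
          using degs by auto
      qed
      finally show ?thesis by (simp add: \<mu>_def mult_ac)
    qed
  qed (use K0 in auto)
qed

section \<open>Semicircle moments\<close>

text \<open>The Jacobi matrix of the semicircle law, that is, the adjacency operator J of the half
  line. Its spectral measure at e_0 is the semicircle law on [-2, 2], so moments become matrix
  entries of powers of J and no integral has to be set up.\<close>

definition shift_op :: "(nat \<Rightarrow> real) \<Rightarrow> nat \<Rightarrow> real" where
  "shift_op x = (\<lambda>i. (if i = 0 then 0 else x (i - 1)) + x (Suc i))"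

definition semicircle_moment :: "nat \<Rightarrow> real" where
  "semicircle_moment k = (shift_op ^^ k) (unit_fun 0) 0"

definition right_shift :: "(nat \<Rightarrow> real) \<Rightarrow> nat \<Rightarrow> real" where
  "right_shift x = (\<lambda>i. if i = 0 then 0 else x (i - 1))"

lemma shift_op_add: "shift_op (\<lambda>i. x i + y i) = (\<lambda>i. shift_op x i + shift_op y i)"
  by (auto simp: shift_op_def)

lemma shift_op_scale: "shift_op (\<lambda>i. c * x i) = (\<lambda>i. c * shift_op x i)"
  by (auto simp: shift_op_def algebra_simps)

lemma shift_op_zero: "shift_op (\<lambda>i. 0) = (\<lambda>i. 0)"
  by (auto simp: shift_op_def)

lemma shift_op_sum: "shift_op (\<lambda>i. \<Sum>a\<in>A. c a * x a i) = (\<lambda>i. \<Sum>a\<in>A. c a * shift_op (x a) i)"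
  by (induction A rule: infinite_finite_induct) (simp_all add: shift_op_zero shift_op_add shift_op_scale)

lemma shift_op_right_shift:
  "shift_op (right_shift x) = (\<lambda>i. right_shift (shift_op x) i + x 0 * unit_fun 0 i)"
proof
  fix i show "shift_op (right_shift x) i = right_shift (shift_op x) i + x 0 * unit_fun 0 i"
    by (cases i) (auto simp: shift_op_def right_shift_def unit_fun_def)
qed

text \<open>The recursion below is the decomposition of Dyck paths at their first return, read off from
  the commutator of \<^const>\<open>shift_op\<close> and \<^const>\<open>right_shift\<close>.\<close>

lemma shift_op_pow_right_shift:
  "(shift_op ^^ k) (right_shift x) = (\<lambda>i. right_shift ((shift_op ^^ k) x) i +
     (\<Sum>a<k. (shift_op ^^ (k - 1 - a)) x 0 * (shift_op ^^ a) (unit_fun 0) i))"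
proof (induction k)
  case (Suc k)
  have "(shift_op ^^ Suc k) (right_shift x) = (\<lambda>i. shift_op (right_shift ((shift_op ^^ k) x)) i +
     (\<Sum>a<k. (shift_op ^^ (k - 1 - a)) x 0 * shift_op ((shift_op ^^ a) (unit_fun 0)) i))"
    by (simp add: Suc shift_op_add shift_op_sum)
  also have "\<dots> = (\<lambda>i. right_shift ((shift_op ^^ Suc k) x) i +
     (\<Sum>a<Suc k. (shift_op ^^ (Suc k - 1 - a)) x 0 * (shift_op ^^ a) (unit_fun 0) i))"
    unfolding sum.lessThan_Suc_shift by (simp add: shift_op_right_shift add.assoc)
  finally show ?case .
qed simp

lemma semicircle_moment_0 [simp]: "semicircle_moment 0 = 1"
  by (simp add: semicircle_moment_def unit_fun_def)

text \<open>This is the loop equation in the limit: normalized traces are replaced by moments, and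
  all terms without a trace disappear.\<close>

lemma semicircle_moment_Suc:
  "semicircle_moment (Suc k) = (\<Sum>a<k. semicircle_moment a * semicircle_moment (k - 1 - a))"
proof -
  have "shift_op (unit_fun 0) = right_shift (unit_fun 0)"
    by (auto simp: shift_op_def right_shift_def unit_fun_def)
  then have "(shift_op ^^ Suc k) (unit_fun 0) = (shift_op ^^ k) (right_shift (unit_fun 0))"
    by (simp add: funpow_swap1)
  then show ?thesis
    unfolding semicircle_moment_def shift_op_pow_right_shift by (simp add: right_shift_def mult.commute)
qed

section \<open>Limits of products of pure forms\<close>

definition forms_pure :: "lform list \<Rightarrow> bool" where
  "forms_pure L \<longleftrightarrow> (\<forall>(x, k, y)\<in>set L. x = y)"

definition forms_limit :: "lform list \<Rightarrow> real" where
  "forms_limit L = prod_list (map (\<lambda>(x, k, y). semicircle_moment k) L)"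

lemma forms_pure_simps [simp]:
  "forms_pure []" "forms_pure ((x, k, y) # L) \<longleftrightarrow> x = y \<and> forms_pure L"
  "forms_limit [] = 1" "forms_limit ((x, k, y) # L) = semicircle_moment k * forms_limit L"
  by (auto simp: forms_pure_def forms_limit_def)

lemma forms_reorder_pure:
  assumes "(x, k, y) \<in> set L"
  shows "forms_pure L \<longleftrightarrow> forms_pure ((x, k, y) # remove1 (x, k, y) L)"
    "forms_limit L = forms_limit ((x, k, y) # remove1 (x, k, y) L)"
proof -
  have m: "mset L = mset ((x, k, y) # remove1 (x, k, y) L)"
    using assms by simp
  show "forms_pure L \<longleftrightarrow> forms_pure ((x, k, y) # remove1 (x, k, y) L)"
    unfolding forms_pure_def using m by (metis set_mset_mset)
  show "forms_limit L = forms_limit ((x, k, y) # remove1 (x, k, y) L)"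
    unfolding forms_limit_def prod_mset_prod_list[symmetric] mset_map m ..
qed

lemma pure_moment_const:
  assumes v: "inner_n n v v = 1" and L: "forms_ok n L" "forms_deg L = 0" "forms_pure L"
  shows "form_prod n W (map (lab_form v) L) = 1 \<and> forms_limit L = 1"
  using L
proof (induction L)
  case (Cons f L)
  obtain x l y where f: "f = (x, l, y)" by (cases f)
  have "inner_n n (lab_vec v x) (lab_vec v x) = 1"
    using Cons.prems v by (cases x) (auto simp: f unit_fun_apply)
  then show ?case using Cons by (simp add: f pow_form_def)
qed simp

text \<open>Only the trace terms survive the division by n, and they reproduce
  \<open>semicircle_moment_Suc\<close>. The remaining terms may contain forms that are not pure, so
  they are merely bounded, by \<open>moment_bound\<close>. That the limit of a product is the
  product of the limits gives concentration later: two copies of a form yield a variance of order 1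
  / n.\<close>

lemma pure_moment_limit:
  assumes c: "1 \<le> c"
  shows "\<exists>K\<ge>0. \<forall>n>0. \<forall>v. flat_unit n c v \<longrightarrow> (\<forall>L. forms_ok n L \<longrightarrow> forms_pure L \<longrightarrow> length L \<le> m \<longrightarrow>
    forms_deg L \<le> N \<longrightarrow> \<bar>lmean n v L - forms_limit L\<bar> \<le> K / n)"
proof (induction N arbitrary: m)
  case 0
  show ?case
  proof (intro exI[of _ 0] conjI allI impI)
    fix n :: nat and v L
    assume n: "0 < n" and v: "flat_unit n c v" and L: "forms_ok n L" "forms_pure L" "forms_deg L \<le> 0"
    interpret gaussian_product "upper_indices n" "goe_sd n" by (rule gaussian_product_goe[OF n])
    show "\<bar>lmean n v L - forms_limit L\<bar> \<le> 0 / n"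
      using pure_moment_const[of n v L] v L by (simp add: flat_unit_def prob_space)
  qed auto
next
  case (Suc N)
  obtain K0 where K00: "K0 \<ge> 0" and K0: "\<And>n v L. 0 < n \<Longrightarrow> flat_unit n c v \<Longrightarrow> forms_ok n L \<Longrightarrow>
      length L \<le> Suc m \<Longrightarrow> forms_deg L \<le> N \<Longrightarrow> \<bar>lmean n v L\<bar> \<le> K0 * (1 / sqrt n) ^ forms_mixed L"
    using moment_bound[OF c, of "Suc m" N] by blast
  obtain K where K1: "K \<ge> 0" and K: "\<And>n v L. 0 < n \<Longrightarrow> flat_unit n c v \<Longrightarrow> forms_ok n L \<Longrightarrow> forms_pure L \<Longrightarrow>
      length L \<le> Suc m \<Longrightarrow> forms_deg L \<le> N \<Longrightarrow> \<bar>lmean n v L - forms_limit L\<bar> \<le> K / n"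
    using Suc[of "Suc m"] by blast
  have K0': "\<bar>lmean n v L\<bar> \<le> K0" if "0 < n" "flat_unit n c v" "forms_ok n L"
      "length L \<le> Suc m" "forms_deg L \<le> N" for n v L
  proof -
    have "K0 * (1 / sqrt n) ^ forms_mixed L \<le> K0 * 1"
      using K00 that(1) by (intro mult_left_mono power_le_one) auto
    then show ?thesis using K0[OF that] by simp
  qed
  show ?case
  proof (intro exI[of _ "(real N + 1) * (K + 3 * K0)"] conjI allI impI)
    fix n :: nat and v L
    assume n: "0 < n" and v: "flat_unit n c v" and L: "forms_ok n L" "forms_pure L" "length L \<le> m" "forms_deg L \<le> Suc N"
    show "\<bar>lmean n v L - forms_limit L\<bar> \<le> (real N + 1) * (K + 3 * K0) / n"
    proof (cases "forms_deg L \<le> N")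
      case True
      then have "\<bar>lmean n v L - forms_limit L\<bar> \<le> K / n" using K[OF n v L(1,2)] L by simp
      also have "K \<le> (real N + 1) * (K + 3 * K0)"
        using K00 K1 mult_nonneg_nonneg[of "real N" K] mult_nonneg_nonneg[of "real N" K0] by (simp add: algebra_simps)
      then have "K / n \<le> (real N + 1) * (K + 3 * K0) / n"
        using n by (intro divide_right_mono) auto
      finally show ?thesis .
    next
      case False
      then have deg: "forms_deg L = Suc N" using L by simp
      then have "forms_deg L \<noteq> 0" by simp
      then obtain p k q where pq0: "(p, Suc k, q) \<in> set L" by (rule positive_degree_form)
      have "q = p" using pq0 L(2) by (auto simp: forms_pure_def)
      with pq0 have pq: "(p, Suc k, p) \<in> set L" by simp
      define L' where "L' = remove1 (p, Suc k, p) L"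
      note re = forms_reorder[OF pq, folded L'_def] forms_reorder_pure[OF pq, folded L'_def]
      have ok: "lab_ok n p" "forms_ok n L'" "forms_pure L'" using re L by auto
      have len: "length L' < m" using re L by simp
      have degs: "k + forms_deg L' = N" using re deg by simp
      let ?T1 = "form_mean n ((lab_vec v p, k - 1, lab_vec v p) # map (lab_form v) L')"
      let ?T2 = "\<lambda>a j. form_mean n ((unit_fun j, a, unit_fun j) # (lab_vec v p, k - 1 - a, lab_vec v p) # map (lab_form v) L')"
      let ?T3 = "\<integral>w. form_cross n (sym_ext w) (lab_vec v p) k (lab_vec v p) (map (lab_form v) L') \<partial>goe_vars n"
      let ?l = "\<lambda>a. semicircle_moment a * semicircle_moment (k - 1 - a) * forms_limit L'"
      \<comment> \<open>The limit is written as an average of n equal terms, so that it can be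
        subtracted from the trace sum term by term.\<close>
      have collect: "((\<Sum>a<k. t1 + (\<Sum>j<n. t2 a j)) + t3) / n - (\<Sum>a<k. \<Sum>j<n. l a) / n =
          ((\<Sum>a<k. t1 + (\<Sum>j<n. t2 a j - l a)) + t3) / n" for t1 t3 :: real and t2 l
        by (simp add: sum.distrib sum_subtractf diff_divide_distrib add_divide_distrib del: sum_constant)
      have t1: "\<bar>?T1\<bar> \<le> K0"
        using K0'[OF n v, of "(p, k - 1, p) # L'"] ok len degs by simp
      have t2: "\<bar>?T2 a j - ?l a\<bar> \<le> K / n"
        if "j < n" "a < k" for a j
        using K[OF n v, of "(Some j, a, Some j) # (p, k - 1 - a, p) # L'"] ok len degs that
        by (simp add: mixed_def mult_ac)
      have t3: "\<bar>?T3\<bar> \<le> 2 * real (forms_deg L') * K0"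
      proof -
        have "\<bar>\<integral>w. form_prod n (sym_ext w) (map (lab_form v) []) *
            form_cross n (sym_ext w) (lab_vec v p) k (lab_vec v p) (map (lab_form v) L') \<partial>goe_vars n\<bar>
            \<le> 2 * real (forms_deg L') * K0"
          by (rule cross_bound[OF n K0'[OF n v], where \<mu> = 0]) (use ok len degs in auto)
        then show ?thesis by simp
      qed
      have el: "\<bar>?T1 + (\<Sum>j<n. ?T2 a j - ?l a)\<bar> \<le> K0 + real (card {..<n}) * (K / n)" if "a < k" for a
        by (rule order.trans[OF abs_triangle_ineq add_mono[OF t1 abs_sum_le_card[OF t2]]])
          (simp_all only: lessThan_iff that)
      have "lmean n v L = form_mean n ((lab_vec v p, Suc k, lab_vec v p) # map (lab_form v) L')"
        using re(1)[where v = v and n = n] by (simp del: form_prod.simps)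
      also have "\<dots> = ((\<Sum>a<k. ?T1 + (\<Sum>j<n. ?T2 a j)) + ?T3) / n"
        by (rule loop_equation[OF n])
      finally have 1: "lmean n v L = ((\<Sum>a<k. ?T1 + (\<Sum>j<n. ?T2 a j)) + ?T3) / n" .
      have 2: "forms_limit L = ((\<Sum>a<k. \<Sum>j<n. ?l a)) / n"
      proof -
        have "(\<Sum>a<k. \<Sum>j<n. ?l a) / n = (\<Sum>a<k. ?l a)"
          using n by (simp add: sum_divide_distrib)
        moreover have "forms_limit L = (\<Sum>a<k. ?l a)"
          using re(7) by (simp add: semicircle_moment_Suc sum_distrib_right)
        ultimately show ?thesis by (simp only:)
      qed
      have "\<bar>lmean n v L - forms_limit L\<bar> = \<bar>((\<Sum>a<k. ?T1 + (\<Sum>j<n. ?T2 a j - ?l a)) + ?T3) / n\<bar>"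
        unfolding 1 2 by (rule arg_cong[OF collect])
      also have "\<dots> \<le> (\<bar>\<Sum>a<k. ?T1 + (\<Sum>j<n. ?T2 a j - ?l a)\<bar> + \<bar>?T3\<bar>) / n"
        unfolding abs_divide abs_of_nat
        by (intro divide_right_mono abs_triangle_ineq of_nat_0_le_iff)
      also have "\<dots> \<le> (real (card {..<k}) * (K0 + real (card {..<n}) * (K / n)) +
          2 * real (forms_deg L') * K0) / n"
        by (intro divide_right_mono add_mono t3 abs_sum_le_card el of_nat_0_le_iff) (simp only: lessThan_iff)
      also have "\<dots> = (real k * (K0 + K) + 2 * real (forms_deg L') * K0) / n"
        using n by simp
      also have "\<dots> \<le> (real N + 1) * (K + 3 * K0) / n"
      proof (intro divide_right_mono)
        have "real k * (K0 + K) \<le> real N * (K0 + K)" "real (forms_deg L') * K0 \<le> real N * K0"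
          using degs K00 K1 by (auto intro!: mult_right_mono)
        then show "real k * (K0 + K) + 2 * real (forms_deg L') * K0 \<le> (real N + 1) * (K + 3 * K0)"
          using K00 K1 by (simp add: algebra_simps)
      qed auto
      finally show ?thesis .
    qed
  qed (use K00 K1 in auto)
qed

section \<open>Test polynomials\<close>

text \<open>The linear functional on polynomials with x^k \<mapsto> f k. It serves three purposes:
  the semicircle integral, quadratic forms in P(W), and the coordinates of P(J) e_0.\<close>

definition lin_poly :: "(nat \<Rightarrow> real) \<Rightarrow> real poly \<Rightarrow> real" where
  "lin_poly f P = (\<Sum>k\<le>degree P. coeff P k * f k)"

lemma lin_poly_ge_degree:
  assumes "degree P \<le> d"
  shows "lin_poly f P = (\<Sum>k\<le>d. coeff P k * f k)"
  unfolding lin_poly_def using assms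
  by (intro sum.mono_neutral_left) (auto simp: coeff_eq_0)

lemma lin_poly_0 [simp]: "lin_poly f 0 = 0"
  by (simp add: lin_poly_def)

lemma lin_poly_add: "lin_poly f (P + Q) = lin_poly f P + lin_poly f Q"
proof -
  let ?d = "max (degree P) (degree Q)"
  have "lin_poly f (P + Q) = (\<Sum>k\<le>?d. coeff (P + Q) k * f k)"
    by (intro lin_poly_ge_degree degree_add_le_max)
  then show ?thesis
    by (simp add: lin_poly_ge_degree[of P ?d] lin_poly_ge_degree[of Q ?d] sum.distrib distrib_right)
qed

lemma lin_poly_smult: "lin_poly f (Polynomial.smult c P) = c * lin_poly f P"
  using lin_poly_ge_degree[of "Polynomial.smult c P" "degree P" f]
  by (simp add: lin_poly_def[of f P] sum_distrib_left mult_ac)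

lemma lin_poly_diff: "lin_poly f (P - Q) = lin_poly f P - lin_poly f Q"
  using lin_poly_add[of f P "Polynomial.smult (-1) Q"] lin_poly_smult[of f "-1" Q] by simp

lemma lin_poly_sum: "lin_poly f (\<Sum>a\<in>A. P a) = (\<Sum>a\<in>A. lin_poly f (P a))"
  by (induction A rule: infinite_finite_induct) (auto simp: lin_poly_add)

lemma lin_poly_pCons: "lin_poly f (pCons a P) = a * f 0 + lin_poly (\<lambda>k. f (Suc k)) P"
proof -
  have "lin_poly f (pCons a P) = (\<Sum>k\<le>Suc (degree P). coeff (pCons a P) k * f k)"
    by (rule lin_poly_ge_degree) (simp add: degree_pCons_le)
  then show ?thesis by (simp add: lin_poly_def[of _ P] sum.atMost_Suc_shift del: sum.atMost_Suc)
qed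

lemma lin_poly_mult:
  "lin_poly f (P * Q) = (\<Sum>k\<le>degree P. \<Sum>l\<le>degree Q. coeff P k * coeff Q l * f (k + l))"
proof -
  have "lin_poly f (P * Q) = lin_poly (\<lambda>k. lin_poly (\<lambda>l. f (k + l)) Q) P"
    by (induction P arbitrary: f)
      (simp_all add: mult_pCons_left lin_poly_add lin_poly_smult lin_poly_pCons)
  then show ?thesis by (simp add: lin_poly_def sum_distrib_left mult_ac)
qed

lemma lin_poly_linear:
  "lin_poly (\<lambda>k. \<Sum>a\<in>A. c a * f a k) P = (\<Sum>a\<in>A. c a * lin_poly (f a) P)"
  unfolding lin_poly_def sum_distrib_left
  by (subst sum.swap) (simp add: mult_ac)

text \<open>The Chebyshev polynomials U_k(x / 2) of the second kind, which are orthonormal for the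
  semicircle law.\<close>

fun cheb :: "nat \<Rightarrow> real poly" where
  "cheb 0 = 1"
| "cheb (Suc 0) = [:0, 1:]"
| "cheb (Suc (Suc k)) = pCons 0 (cheb (Suc k)) - cheb k"

definition jac_vec :: "real poly \<Rightarrow> nat \<Rightarrow> real" where
  "jac_vec P i = lin_poly (\<lambda>k. (shift_op ^^ k) (unit_fun 0) i) P"

lemma jac_vec_pCons_0: "jac_vec (pCons 0 P) = shift_op (jac_vec P)"
proof -
  have "lin_poly (\<lambda>k. shift_op (F k) i) P = shift_op (\<lambda>i. lin_poly (\<lambda>k. F k i) P) i" for F i
    by (auto simp: shift_op_def lin_poly_def distrib_left sum.distrib)
  then show ?thesis by (auto simp: jac_vec_def[abs_def] lin_poly_pCons)
qed

lemma jac_vec_diff: "jac_vec (P - Q) i = jac_vec P i - jac_vec Q i"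
  by (simp add: jac_vec_def lin_poly_diff)

text \<open>The three-term recursion of \<open>cheb\<close> is that of the basis vectors, J e_(k+1)
  = e_k + e_(k+2). So U_k(J / 2) moves e_0 to e_k.\<close>

lemma jac_vec_cheb: "jac_vec (cheb k) = unit_fun k"
proof (induction k rule: cheb.induct)
  case 1
  show ?case by (auto simp: jac_vec_def lin_poly_def)
next
  case 2
  have "jac_vec [:0, 1:] = shift_op (jac_vec 1)"
    using jac_vec_pCons_0[of 1] by (simp add: one_pCons)
  also have "jac_vec 1 = unit_fun 0" by (auto simp: jac_vec_def lin_poly_def)
  finally show ?case by (auto simp: shift_op_def unit_fun_def)
next
  case (3 k)
  show ?case
  proof
    fix i show "jac_vec (cheb (Suc (Suc k))) i = unit_fun (Suc (Suc k)) i"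
      using 3 by (cases i) (auto simp: jac_vec_diff jac_vec_pCons_0 shift_op_def unit_fun_def)
  qed
qed

abbreviation semicircle :: "real poly \<Rightarrow> real" where
  "semicircle \<equiv> lin_poly semicircle_moment"

lemma semicircle_eq: "semicircle P = jac_vec P 0"
  by (simp add: jac_vec_def lin_poly_def semicircle_moment_def)

text \<open>The coordinates of P(J) e_0 are therefore the coefficients of P in the orthonormal
  system \<open>cheb\<close>, and multiplication by x acts on coefficient sequences as
  \<open>shift_op\<close>. Optimizing over polynomials becomes optimizing over sequences.\<close>

lemma semicircle_mult_cheb: "semicircle (P * cheb k) = jac_vec P k"
proof (induction k arbitrary: P rule: cheb.induct)
  case 1
  then show ?case by (simp add: semicircle_eq)
next
  case 2
  show ?case by (simp add: semicircle_eq jac_vec_pCons_0 shift_op_def)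
next
  case (3 k)
  have "semicircle (P * cheb (Suc (Suc k))) =
      semicircle (pCons 0 P * cheb (Suc k)) - semicircle (P * cheb k)"
    by (simp add: algebra_simps lin_poly_diff)
  then show ?case
    by (simp only: 3) (simp add: jac_vec_pCons_0 shift_op_def)
qed

definition cheb_comb :: "nat \<Rightarrow> (nat \<Rightarrow> real) \<Rightarrow> real poly" where
  "cheb_comb N a = (\<Sum>k<N. Polynomial.smult (a k) (cheb k))"

lemma jac_vec_cheb_comb: "jac_vec (cheb_comb N a) i = (if i < N then a i else 0)"
proof -
  have "jac_vec (cheb_comb N a) i = (\<Sum>k<N. a k * jac_vec (cheb k) i)"
    by (simp add: cheb_comb_def jac_vec_def lin_poly_sum lin_poly_smult)
  also have "\<dots> = (\<Sum>k<N. if k = i then a k else 0)"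
    by (intro sum.cong refl) (auto simp: jac_vec_cheb unit_fun_def)
  finally show ?thesis by simp
qed

lemma semicircle_mult_cheb_comb: "semicircle (P * cheb_comb N a) = (\<Sum>k<N. a k * jac_vec P k)"
  by (simp add: cheb_comb_def sum_distrib_left lin_poly_sum lin_poly_smult semicircle_mult_cheb)

text \<open>With N equal coefficients the energy is that of a constant unit vector on a path with N
  vertices: 2 (N - 1) / N. Only the two missing edges at the ends cost anything.\<close>

lemma edge_poly:
  assumes "0 < \<eta>"
  obtains p \<kappa> where "semicircle (p * p) = 1" "semicircle (pCons 0 (p * p)) = \<kappa>" "2 - \<eta> < \<kappa>" "\<kappa> \<le> 2"
proof -
  obtain N :: nat where N: "2 / \<eta> < real N" using reals_Archimedean2 by blast
  have "0 < 2 / \<eta>" using assms by simp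
  with N have N0: "0 < real N" by linarith
  define a where "a = (\<lambda>k :: nat. 1 / sqrt (real N))"
  let ?p = "cheb_comb N a"
  have 1: "semicircle (?p * ?p) = 1"
    using N0 by (simp add: semicircle_mult_cheb_comb jac_vec_cheb_comb a_def)
  have "semicircle (pCons 0 (?p * ?p)) = semicircle (pCons 0 ?p * ?p)" by simp
  also have "\<dots> = (\<Sum>k<N. a k * shift_op (\<lambda>i. if i < N then a i else 0) k)"
    unfolding semicircle_mult_cheb_comb jac_vec_pCons_0 jac_vec_cheb_comb[abs_def] ..
  \<comment> \<open>The two indicators mark the ends of the path; for N = 1 both fall on the same
    index.\<close>
  also have "\<dots> = (\<Sum>k<N. (2 - (if k = 0 then 1 else 0) - (if k = N - 1 then 1 else 0)) / real N)"
    using N0 by (intro sum.cong refl) (auto simp: shift_op_def a_def field_simps)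
  also have "\<dots> = (2 * real N - 1 - 1) / real N"
    using N0 unfolding sum_divide_distrib[symmetric] by (simp add: sum_subtractf)
  also have "\<dots> = 2 - 2 / real N" using N0 by (simp add: field_simps)
  finally have 2: "semicircle (pCons 0 (?p * ?p)) = 2 - 2 / real N" .
  have "2 / real N < \<eta>" using N N0 assms by (simp add: field_simps)
  then show thesis using that[OF 1 2] N0 by simp
qed

text \<open>The piecewise linear coefficients are harmonic away from \<open>0\<close>, so that the discrete Laplacian
  only contributes at \<open>k = 0\<close>.\<close>

lemma spike_poly:
  assumes "1 < (lam::real)"
  obtains q where "semicircle q = 1"
    "0 < lam + semicircle (pCons 0 (q * q)) - 2 * semicircle (q * q)"
proof -
  obtain N :: nat where N: "1 / (lam - 1) < real N" using reals_Archimedean2 by blast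
  have "0 < 1 / (lam - 1)" using assms by simp
  with N have N0: "0 < real N" by linarith
  \<comment> \<open>A linear taper of the constant sequence 1, which is the formal expansion of 1 /
    (2 - x) in \<open>cheb\<close>: the generating function of U_k(x / 2), taken at argument
    1.\<close>
  define a where "a = (\<lambda>k :: nat. 1 - real k / real N)"
  let ?q = "cheb_comb N a"
  have 1: "semicircle ?q = 1"
    using N0 by (simp add: semicircle_eq jac_vec_cheb_comb a_def)
  have "semicircle (pCons 0 (?q * ?q)) - 2 * semicircle (?q * ?q) =
      semicircle (pCons 0 ?q * ?q) - 2 * semicircle (?q * ?q)" by simp
  also have "\<dots> = (\<Sum>k<N. a k * (shift_op (\<lambda>i. if i < N then a i else 0) k - 2 * a k))"
    unfolding semicircle_mult_cheb_comb jac_vec_pCons_0 jac_vec_cheb_comb[abs_def]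
    by (simp add: sum_distrib_left right_diff_distrib sum_subtractf mult_ac)
  also have "\<dots> = (\<Sum>k<N. if k = 0 then - 1 - 1 / real N else 0)"
  proof (intro sum.cong refl)
    fix k assume k: "k \<in> {..<N}"
    \<comment> \<open>The cut at N is invisible, since the linear function vanishes there.\<close>
    have "Suc k = N" if "\<not> Suc k < N" using k that by simp
    then have "(if Suc k < N then a (Suc k) else 0) = a (Suc k)"
      using N0 by (auto simp: a_def)
    then have sh: "shift_op (\<lambda>i. if i < N then a i else 0) k = (if k = 0 then 0 else a (k - 1)) + a (Suc k)"
      using k by (simp add: shift_op_def)
    show "a k * (shift_op (\<lambda>i. if i < N then a i else 0) k - 2 * a k) =
        (if k = 0 then - 1 - 1 / real N else 0)"
      unfolding sh using N0 by (cases k) (auto simp: a_def field_simps)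
  qed
  also have "\<dots> = - 1 - 1 / real N" using N0 by simp
  finally have 2: "semicircle (pCons 0 (?q * ?q)) - 2 * semicircle (?q * ?q) = - 1 - 1 / real N" .
  have "1 / real N < lam - 1" using N N0 assms by (simp add: field_simps)
  with 2 show thesis using that[OF 1] by simp
qed

section \<open>Polynomials of the random matrix\<close>

definition poly_form :: "nat \<Rightarrow> (nat \<Rightarrow> nat \<Rightarrow> real) \<Rightarrow> (nat \<Rightarrow> real) \<Rightarrow> real poly \<Rightarrow> (nat \<Rightarrow> real) \<Rightarrow> real" where
  "poly_form n W x P y = lin_poly (\<lambda>k. pow_form n W x k y) P"

lemma goe_poly_poly_form: "goe_poly n (\<lambda>w. poly_form n (sym_ext w) x P y)"
  unfolding poly_form_def lin_poly_def by (intro gauss_poly_intros goe_poly_pow_form)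

lemma square_sum_le:
  fixes f :: "nat \<Rightarrow> real"
  shows "(\<Sum>k\<le>d. f k)\<^sup>2 \<le> real (Suc d) * (\<Sum>k\<le>d. (f k)\<^sup>2)"
  using sum_squared_le_sum_of_squares[of f "{..d}"] by (simp add: mult.commute)

lemma fourth_power_sum_le:
  fixes f :: "nat \<Rightarrow> real"
  shows "(\<Sum>k\<le>d. f k) ^ 4 \<le> real (Suc d) ^ 3 * (\<Sum>k\<le>d. f k ^ 4)"
proof -
  have sq: "x ^ 4 = (x\<^sup>2)\<^sup>2" for x :: real by simp
  have "(\<Sum>k\<le>d. f k) ^ 4 \<le> (real (Suc d) * (\<Sum>k\<le>d. (f k)\<^sup>2))\<^sup>2"
    unfolding sq by (intro power_mono square_sum_le) simp
  also have "\<dots> \<le> (real (Suc d))\<^sup>2 * (real (Suc d) * (\<Sum>k\<le>d. ((f k)\<^sup>2)\<^sup>2))"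
    unfolding power_mult_distrib by (intro mult_left_mono square_sum_le) simp
  also have "\<dots> = real (Suc d) ^ 3 * (\<Sum>k\<le>d. f k ^ 4)"
    by (simp only: sq power3_eq_cube power2_eq_square[of "real (Suc d)"] mult.assoc)
  finally show ?thesis .
qed

lemma goe_poly_integrable: "0 < n \<Longrightarrow> goe_poly n F \<Longrightarrow> integrable (goe_vars n) F"
  by (rule gaussian_product.gauss_poly_integrable[OF gaussian_product_goe])

text \<open>An O-notation for expectations with one constant for all n, all flat v and all i. Upper
  bounds suffice, since they end up in Markov's inequality. Integrability is part of the notion so
  that orders can be added.\<close>

definition goe_order :: "real \<Rightarrow> (nat \<Rightarrow> real) \<Rightarrow> (nat \<Rightarrow> (nat \<Rightarrow> real) \<Rightarrow> nat \<Rightarrow> (nat \<times> nat \<Rightarrow> real) \<Rightarrow> real) \<Rightarrow> bool" where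
  "goe_order c h F \<longleftrightarrow> (\<exists>K\<ge>0. \<forall>n>0. \<forall>v. flat_unit n c v \<longrightarrow> (\<forall>i<n.
     integrable (goe_vars n) (F n v i) \<and> (\<integral>w. F n v i w \<partial>goe_vars n) \<le> K * h n))"

lemma goe_orderI:
  assumes "0 \<le> K" and "\<And>n v i. 0 < n \<Longrightarrow> flat_unit n c v \<Longrightarrow> i < n \<Longrightarrow> integrable (goe_vars n) (F n v i)"
    and "\<And>n v i. 0 < n \<Longrightarrow> flat_unit n c v \<Longrightarrow> i < n \<Longrightarrow> (\<integral>w. F n v i w \<partial>goe_vars n) \<le> K * h n"
  shows "goe_order c h F"
  using assms unfolding goe_order_def by blast

lemma goe_orderE:
  assumes "goe_order c h F"
  obtains K where "0 \<le> K" "\<And>n v i. 0 < n \<Longrightarrow> flat_unit n c v \<Longrightarrow> i < n \<Longrightarrow> integrable (goe_vars n) (F n v i)"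
    "\<And>n v i. 0 < n \<Longrightarrow> flat_unit n c v \<Longrightarrow> i < n \<Longrightarrow> (\<integral>w. F n v i w \<partial>goe_vars n) \<le> K * h n"
  using assms unfolding goe_order_def by blast

lemma goe_order_mono:
  assumes "goe_order c h' G" and int: "\<And>n v i. 0 < n \<Longrightarrow> i < n \<Longrightarrow> integrable (goe_vars n) (F n v i)"
    and le: "\<And>n v i w. 0 < n \<Longrightarrow> flat_unit n c v \<Longrightarrow> i < n \<Longrightarrow> F n v i w \<le> G n v i w"
    and h: "\<And>n. 0 < n \<Longrightarrow> h' n \<le> h n"
  shows "goe_order c h F"
proof -
  obtain K where K: "0 \<le> K" "\<And>n v i. 0 < n \<Longrightarrow> flat_unit n c v \<Longrightarrow> i < n \<Longrightarrow> integrable (goe_vars n) (G n v i)"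
    "\<And>n v i. 0 < n \<Longrightarrow> flat_unit n c v \<Longrightarrow> i < n \<Longrightarrow> (\<integral>w. G n v i w \<partial>goe_vars n) \<le> K * h' n"
    using assms(1) by (rule goe_orderE) blast
  show ?thesis
  proof (rule goe_orderI[OF K(1)])
    fix n v i assume n: "0 < n" and v: "flat_unit n c v" and i: "i < n"
    show "integrable (goe_vars n) (F n v i)" by (rule int[OF n i])
    have "(\<integral>w. F n v i w \<partial>goe_vars n) \<le> (\<integral>w. G n v i w \<partial>goe_vars n)"
      by (intro integral_mono int K(2) le n v i)
    also have "\<dots> \<le> K * h' n" by (rule K(3)[OF n v i])
    also have "\<dots> \<le> K * h n" by (intro mult_left_mono h n K(1))
    finally show "(\<integral>w. F n v i w \<partial>goe_vars n) \<le> K * h n" .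
  qed
qed

lemma goe_order_add:
  assumes "goe_order c h F" "goe_order c h G"
  shows "goe_order c h (\<lambda>n v i w. F n v i w + G n v i w)"
proof -
  obtain K where K: "0 \<le> K" "\<And>n v i. 0 < n \<Longrightarrow> flat_unit n c v \<Longrightarrow> i < n \<Longrightarrow> integrable (goe_vars n) (F n v i)"
    "\<And>n v i. 0 < n \<Longrightarrow> flat_unit n c v \<Longrightarrow> i < n \<Longrightarrow> (\<integral>w. F n v i w \<partial>goe_vars n) \<le> K * h n"
    using assms(1) by (rule goe_orderE) blast
  obtain K' where K': "0 \<le> K'" "\<And>n v i. 0 < n \<Longrightarrow> flat_unit n c v \<Longrightarrow> i < n \<Longrightarrow> integrable (goe_vars n) (G n v i)"
    "\<And>n v i. 0 < n \<Longrightarrow> flat_unit n c v \<Longrightarrow> i < n \<Longrightarrow> (\<integral>w. G n v i w \<partial>goe_vars n) \<le> K' * h n"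
    using assms(2) by (rule goe_orderE) blast
  show ?thesis
    by (rule goe_orderI[of "K + K'"])
      (use K K' in \<open>auto simp: Bochner_Integration.integral_add distrib_right intro!: add_mono\<close>)
qed

lemma goe_order_scale:
  assumes "goe_order c h F" and "\<And>n. 0 \<le> g n"
  shows "goe_order c (\<lambda>n. g n * h n) (\<lambda>n v i w. g n * F n v i w)"
proof -
  obtain K where K: "0 \<le> K" "\<And>n v i. 0 < n \<Longrightarrow> flat_unit n c v \<Longrightarrow> i < n \<Longrightarrow> integrable (goe_vars n) (F n v i)"
    "\<And>n v i. 0 < n \<Longrightarrow> flat_unit n c v \<Longrightarrow> i < n \<Longrightarrow> (\<integral>w. F n v i w \<partial>goe_vars n) \<le> K * h n"
    using assms(1) by (rule goe_orderE) blast
  show ?thesis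
  proof (rule goe_orderI[OF K(1)])
    fix n v i assume *: "0 < n" "flat_unit n c v" "i < n"
    show "integrable (goe_vars n) (\<lambda>w. g n * F n v i w)" using K(2)[OF *] by simp
    show "(\<integral>w. g n * F n v i w \<partial>goe_vars n) \<le> K * (g n * h n)"
      using mult_left_mono[OF K(3)[OF *] assms(2)[of n]] by (simp add: mult.left_commute)
  qed
qed

lemma goe_order_cmult:
  assumes "goe_order c h F" and "0 \<le> a"
  shows "goe_order c h (\<lambda>n v i w. a * F n v i w)"
proof -
  obtain K where K: "0 \<le> K" "\<And>n v i. 0 < n \<Longrightarrow> flat_unit n c v \<Longrightarrow> i < n \<Longrightarrow> integrable (goe_vars n) (F n v i)"
    "\<And>n v i. 0 < n \<Longrightarrow> flat_unit n c v \<Longrightarrow> i < n \<Longrightarrow> (\<integral>w. F n v i w \<partial>goe_vars n) \<le> K * h n"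
    using assms(1) by (rule goe_orderE) blast
  show ?thesis
    by (rule goe_orderI[of "a * K"]) (use K assms(2) in \<open>auto simp: mult.assoc intro!: mult_left_mono\<close>)
qed

lemma goe_order_flat:
  assumes "goe_order c (\<lambda>_. 1) F" and nonneg: "\<And>n v i w. 0 \<le> F n v i w" and c: "0 \<le> c"
  shows "goe_order c (\<lambda>n. 1 / sqrt n) (\<lambda>n v i w. \<bar>v i\<bar> * F n v i w)"
proof -
  obtain K where K: "0 \<le> K" "\<And>n v i. 0 < n \<Longrightarrow> flat_unit n c v \<Longrightarrow> i < n \<Longrightarrow> integrable (goe_vars n) (F n v i)"
    "\<And>n v i. 0 < n \<Longrightarrow> flat_unit n c v \<Longrightarrow> i < n \<Longrightarrow> (\<integral>w. F n v i w \<partial>goe_vars n) \<le> K * 1"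
    using assms(1) by (rule goe_orderE) blast
  show ?thesis
  proof (rule goe_orderI[of "c * K"])
    fix n v i assume *: "0 < n" "flat_unit n c v" "i < n"
    show "integrable (goe_vars n) (\<lambda>w. \<bar>v i\<bar> * F n v i w)" using K(2)[OF *] by simp
    have "\<bar>v i\<bar> * (\<integral>w. F n v i w \<partial>goe_vars n) \<le> (c / sqrt n) * (K * 1)"
      using * K(3)[OF *] nonneg c by (intro mult_mono) (auto simp: flat_unit_def integral_nonneg_AE)
    then show "(\<integral>w. \<bar>v i\<bar> * F n v i w \<partial>goe_vars n) \<le> c * K * (1 / sqrt n)" by simp
  qed (use K c in auto)
qed

text \<open>By \<open>pure_moment_limit\<close>, applied to one and to two copies of a form, first
  and second moments are those of a constant up to O(1 / n). The label function \<open>l\<close>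
  covers the unit vectors and the spike vector at once.\<close>

lemma poly_form_L2:
  assumes c: "1 \<le> c" and l: "\<And>n i. i < n \<Longrightarrow> lab_ok n (l i)"
  shows "goe_order c (\<lambda>n. 1 / n)
    (\<lambda>n v i w. (poly_form n (sym_ext w) (lab_vec v (l i)) P (lab_vec v (l i)) - semicircle P)\<^sup>2)"
proof -
  let ?d = "degree P" and ?C = semicircle_moment
  obtain K where K0: "K \<ge> 0" and K: "\<And>n v L. 0 < n \<Longrightarrow> flat_unit n c v \<Longrightarrow> forms_ok n L \<Longrightarrow> forms_pure L \<Longrightarrow>
      length L \<le> 2 \<Longrightarrow> forms_deg L \<le> 2 * ?d \<Longrightarrow> \<bar>lmean n v L - forms_limit L\<bar> \<le> K / n"
    using pure_moment_limit[OF c, of 2 "2 * ?d"] by blast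
  let ?K = "real (Suc ?d) * (\<Sum>k\<le>?d. (coeff P k)\<^sup>2 * ((1 + 2 * \<bar>?C k\<bar>) * K))"
  show ?thesis
  proof (rule goe_orderI[of ?K])
    fix n v i assume n: "0 < n" and v: "flat_unit n c v" and i: "i < n"
    define x where "x = l i"
    have x: "lab_ok n x" using l[OF i] by (simp add: x_def)
    interpret gaussian_product "upper_indices n" "goe_sd n" by (rule gaussian_product_goe[OF n])
    let ?F = "\<lambda>k w. pow_form n (sym_ext w) (lab_vec v x) k (lab_vec v x)"
    let ?G = "\<lambda>w. (poly_form n (sym_ext w) (lab_vec v x) P (lab_vec v x) - semicircle P)\<^sup>2"
    have gp: "goe_poly n (?F k)" for k by (rule goe_poly_pow_form)
    have int: "integrable (goe_vars n) (\<lambda>w. (?F k w - ?C k)\<^sup>2)" for k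
      by (intro gauss_poly_integrable gauss_poly_intros gp)
    have single: "(\<integral>w. (?F k w - ?C k)\<^sup>2 \<partial>goe_vars n) \<le> (1 + 2 * \<bar>?C k\<bar>) * K / n" if k: "k \<le> ?d" for k
    proof -
      have "(\<integral>w. (?F k w - ?C k)\<^sup>2 \<partial>goe_vars n) =
          (\<integral>w. ?F k w * ?F k w - (2 * ?C k * ?F k w - ?C k * ?C k) \<partial>goe_vars n)"
        by (intro Bochner_Integration.integral_cong refl) (simp add: power2_eq_square algebra_simps)
      also have "\<dots> = (\<integral>w. ?F k w * ?F k w \<partial>goe_vars n) - (2 * ?C k * (\<integral>w. ?F k w \<partial>goe_vars n) - ?C k * ?C k)"
        by (simp add: gauss_poly_integrable gauss_poly_mult gp prob_space)
      also have "\<dots> = (lmean n v [(x, k, x), (x, k, x)] - ?C k * ?C k) - 2 * ?C k * (lmean n v [(x, k, x)] - ?C k)"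
        by (simp add: algebra_simps)
      also have "\<dots> \<le> K / n + 2 * \<bar>?C k\<bar> * (K / n)"
      proof -
        have "\<bar>lmean n v [(x, k, x), (x, k, x)] - ?C k * ?C k\<bar> \<le> K / n"
          using K[OF n v, of "[(x, k, x), (x, k, x)]"] x k by simp
        moreover have "\<bar>2 * ?C k * (lmean n v [(x, k, x)] - ?C k)\<bar> \<le> 2 * \<bar>?C k\<bar> * (K / n)"
          unfolding abs_mult using K[OF n v, of "[(x, k, x)]"] x k by (intro mult_mono) auto
        ultimately show ?thesis by linarith
      qed
      finally show ?thesis by (simp add: algebra_simps add_divide_distrib)
    qed
    have "goe_poly n ?G" by (intro gauss_poly_intros goe_poly_poly_form)
    then have Gint: "integrable (goe_vars n) ?G" by (rule gauss_poly_integrable)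
    then show "integrable (goe_vars n) (\<lambda>w. (poly_form n (sym_ext w) (lab_vec v (l i)) P (lab_vec v (l i)) - semicircle P)\<^sup>2)"
      unfolding x_def .
    have "(\<integral>w. ?G w \<partial>goe_vars n) \<le> (\<integral>w. real (Suc ?d) * (\<Sum>k\<le>?d. (coeff P k)\<^sup>2 * (?F k w - ?C k)\<^sup>2) \<partial>goe_vars n)"
    proof (rule integral_mono[OF Gint])
      show "integrable (goe_vars n) (\<lambda>w. real (Suc ?d) * (\<Sum>k\<le>?d. (coeff P k)\<^sup>2 * (?F k w - ?C k)\<^sup>2))"
        by (intro gauss_poly_integrable gauss_poly_intros gp)
      fix w
      have "poly_form n (sym_ext w) (lab_vec v x) P (lab_vec v x) - semicircle P =
          (\<Sum>k\<le>?d. coeff P k * (?F k w - ?C k))"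
        by (simp add: poly_form_def lin_poly_def sum_subtractf right_diff_distrib)
      then show "?G w \<le> real (Suc ?d) * (\<Sum>k\<le>?d. (coeff P k)\<^sup>2 * (?F k w - ?C k)\<^sup>2)"
        using square_sum_le[of "\<lambda>k. coeff P k * (?F k w - ?C k)" ?d] by (simp add: power_mult_distrib)
    qed
    also have "\<dots> = real (Suc ?d) * (\<Sum>k\<le>?d. (coeff P k)\<^sup>2 * (\<integral>w. (?F k w - ?C k)\<^sup>2 \<partial>goe_vars n))"
      by (simp add: Bochner_Integration.integral_sum int)
    also have "\<dots> \<le> real (Suc ?d) * (\<Sum>k\<le>?d. (coeff P k)\<^sup>2 * ((1 + 2 * \<bar>?C k\<bar>) * K / n))"
      by (intro mult_left_mono sum_mono single) auto
    also have "\<dots> = ?K * (1 / n)" by (simp add: sum_divide_distrib[symmetric])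
    finally show "(\<integral>w. (poly_form n (sym_ext w) (lab_vec v (l i)) P (lab_vec v (l i)) - semicircle P)\<^sup>2 \<partial>goe_vars n) \<le> ?K * (1 / n)"
      unfolding x_def .
  qed (use K0 in \<open>auto intro!: mult_nonneg_nonneg sum_nonneg\<close>)
qed

text \<open>Fourth moments are what the quartic terms in the spike column require.\<close>

lemma poly_form_fourth:
  assumes c: "1 \<le> c" and l: "\<And>n i. i < n \<Longrightarrow> lab_ok n (l i)" "\<And>n i. i < n \<Longrightarrow> lab_ok n (l' i)"
    and m: "\<And>i. mixed (l i) (l' i) = m"
  shows "goe_order c (\<lambda>n. (1 / sqrt n) ^ (4 * m))
    (\<lambda>n v i w. (poly_form n (sym_ext w) (lab_vec v (l i)) P (lab_vec v (l' i))) ^ 4)"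
proof -
  let ?d = "degree P"
  obtain K where K0: "K \<ge> 0" and K: "\<And>n v L. 0 < n \<Longrightarrow> flat_unit n c v \<Longrightarrow> forms_ok n L \<Longrightarrow>
      length L \<le> 4 \<Longrightarrow> forms_deg L \<le> 4 * ?d \<Longrightarrow> \<bar>lmean n v L\<bar> \<le> K * (1 / sqrt n) ^ forms_mixed L"
    using moment_bound[OF c, of 4 "4 * ?d"] by blast
  let ?K = "real (Suc ?d) ^ 3 * (\<Sum>k\<le>?d. (coeff P k) ^ 4 * K)"
  show ?thesis
  proof (rule goe_orderI[of ?K])
    fix n v i assume n: "0 < n" and v: "flat_unit n c v" and i: "i < n"
    interpret gaussian_product "upper_indices n" "goe_sd n" by (rule gaussian_product_goe[OF n])
    let ?h = "(1 / sqrt n) ^ (4 * m)"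
    let ?F = "\<lambda>k w. pow_form n (sym_ext w) (lab_vec v (l i)) k (lab_vec v (l' i))"
    let ?G = "\<lambda>w. (poly_form n (sym_ext w) (lab_vec v (l i)) P (lab_vec v (l' i))) ^ 4"
    have gp: "goe_poly n (?F k)" for k by (rule goe_poly_pow_form)
    have single: "(\<integral>w. (?F k w) ^ 4 \<partial>goe_vars n) \<le> K * ?h" if k: "k \<le> ?d" for k
      using K[OF n v, of "replicate 4 (l i, k, l' i)"] l[OF i] k m by (simp add: numeral_eq_Suc mult_ac)
    have "goe_poly n ?G" by (intro gauss_poly_intros goe_poly_poly_form)
    then show Gint: "integrable (goe_vars n) ?G" by (rule gauss_poly_integrable)
    have "(\<integral>w. ?G w \<partial>goe_vars n) \<le> (\<integral>w. real (Suc ?d) ^ 3 * (\<Sum>k\<le>?d. (coeff P k) ^ 4 * (?F k w) ^ 4) \<partial>goe_vars n)"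
    proof (rule integral_mono[OF Gint])
      show "integrable (goe_vars n) (\<lambda>w. real (Suc ?d) ^ 3 * (\<Sum>k\<le>?d. (coeff P k) ^ 4 * (?F k w) ^ 4))"
        by (intro gauss_poly_integrable gauss_poly_intros gp)
      show "?G w \<le> real (Suc ?d) ^ 3 * (\<Sum>k\<le>?d. (coeff P k) ^ 4 * (?F k w) ^ 4)" for w
        using fourth_power_sum_le[of "\<lambda>k. coeff P k * ?F k w" ?d]
        by (simp add: poly_form_def lin_poly_def power_mult_distrib)
    qed
    also have "\<dots> = real (Suc ?d) ^ 3 * (\<Sum>k\<le>?d. (coeff P k) ^ 4 * (\<integral>w. (?F k w) ^ 4 \<partial>goe_vars n))"
      by (simp add: Bochner_Integration.integral_sum gauss_poly_integrable gauss_poly_power gp)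
    also have "\<dots> \<le> real (Suc ?d) ^ 3 * (\<Sum>k\<le>?d. (coeff P k) ^ 4 * (K * ?h))"
      by (intro mult_left_mono sum_mono single) auto
    also have "\<dots> = ?K * ?h" by (simp only: sum_distrib_right mult.assoc)
    finally show "(\<integral>w. ?G w \<partial>goe_vars n) \<le> ?K * ?h" .
  qed (use K0 in \<open>auto intro!: mult_nonneg_nonneg sum_nonneg\<close>)
qed

text \<open>Integrated with s = \<open>sqrt n\<close>, it turns a mean square of order 1 / n into a
  mean of order 1 / sqrt n, doing the work of the Cauchy-Schwarz inequality.\<close>

lemma abs_le_weighted_square:
  assumes "0 < (s::real)"
  shows "\<bar>f\<bar> \<le> 1 / s + s * f\<^sup>2"
proof -
  have "t \<le> 1 + t\<^sup>2" for t :: real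
    using zero_le_power2[of "t - 1 / 2"] by (simp add: power2_eq_square algebra_simps)
  from this[of "s * \<bar>f\<bar>"] have "s * \<bar>f\<bar> \<le> s * (1 / s + s * f\<^sup>2)"
    using assms by (simp add: power_mult_distrib distrib_left power2_eq_square[of s] mult.assoc)
  then show ?thesis using assms by (simp only: mult_le_cancel_left_pos)
qed

lemma poly_form_L1:
  assumes c: "1 \<le> c" and l: "\<And>n i. i < n \<Longrightarrow> lab_ok n (l i)"
  shows "goe_order c (\<lambda>n. 1 / sqrt n)
    (\<lambda>n v i w. \<bar>poly_form n (sym_ext w) (lab_vec v (l i)) P (lab_vec v (l i)) - semicircle P\<bar>)"
proof -
  let ?G = "\<lambda>n v i w. (poly_form n (sym_ext w) (lab_vec v (l i)) P (lab_vec v (l i)) - semicircle P)\<^sup>2"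
  have one: "goe_order c (\<lambda>_. 1) (\<lambda>n v i w. 1)"
  proof (rule goe_orderI[of 1])
    fix n :: nat and v i assume "0 < n"
    then interpret gaussian_product "upper_indices n" "goe_sd n" by (rule gaussian_product_goe)
    show "integrable (goe_vars n) (\<lambda>w. 1 :: real)" "(\<integral>w. 1 \<partial>goe_vars n) \<le> 1 * (1 :: real)"
      by (simp_all add: prob_space)
  qed simp
  have h: "sqrt n / n = 1 / sqrt n" if "0 < n" for n :: nat
    using that by (simp add: field_simps)
  have "goe_order c (\<lambda>n. 1 / sqrt n) (\<lambda>n v i w. 1 / sqrt n * 1)"
    using goe_order_scale[OF one, of "\<lambda>n. 1 / sqrt n"] by simp
  moreover have "goe_order c (\<lambda>n. 1 / sqrt n) (\<lambda>n v i w. sqrt n * ?G n v i w)"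
    by (rule goe_order_mono[OF goe_order_scale[where g = "\<lambda>n. sqrt (real n)", OF poly_form_L2[OF c l]]])
      (auto simp: h intro!: goe_poly_integrable gauss_poly_intros goe_poly_poly_form)
  ultimately show ?thesis
    by (rule goe_order_mono[OF goe_order_add])
      (auto intro!: integrable_abs goe_poly_integrable gauss_poly_intros goe_poly_poly_form abs_le_weighted_square
        simp del: integrable_abs_iff)
qed

text \<open>Four mixed forms contribute n^(-2), which the factor \<open>sqrt n\<close> to the fourth
  power cancels: the entries of sqrt n P(W) v are of order one.\<close>

lemma poly_form_mixed_fourth:
  assumes c: "1 \<le> c"
  shows "goe_order c (\<lambda>_. 1) (\<lambda>n v i w. (sqrt n * poly_form n (sym_ext w) (unit_fun i) P v) ^ 4)"
proof -
  have "goe_order c (\<lambda>n. (1 / sqrt n) ^ 4) (\<lambda>n v i w. poly_form n (sym_ext w) (unit_fun i) P v ^ 4)"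
    using poly_form_fourth[OF c, of Some "\<lambda>_. None" 1 P] by (simp add: mixed_def)
  from goe_order_scale[OF this, of "\<lambda>n. (sqrt n) ^ 4"] show ?thesis
    by (rule goe_order_mono)
      (auto simp: power_mult_distrib power_divide intro!: goe_poly_integrable gauss_poly_intros goe_poly_poly_form)
qed

text \<open>Mere boundedness is enough, because in the row error this form comes with the factor
  \<open>v i\<close>, which supplies the decay 1 / sqrt n.\<close>

lemma poly_form_mixed_L1:
  assumes c: "1 \<le> c"
  shows "goe_order c (\<lambda>_. 1) (\<lambda>n v i w. \<bar>poly_form n (sym_ext w) (unit_fun i) P v\<bar>)"
proof -
  obtain K where K: "0 \<le> K" "\<And>n v i. 0 < n \<Longrightarrow> flat_unit n c v \<Longrightarrow> i < n \<Longrightarrow>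
      (\<integral>w. (sqrt n * poly_form n (sym_ext w) (unit_fun i) P v) ^ 4 \<partial>goe_vars n) \<le> K * 1"
    using poly_form_mixed_fourth[OF c] by (rule goe_orderE) blast
  show ?thesis
  proof (rule goe_orderI[of "1 + K"])
    fix n v i assume n: "0 < n" and v: "flat_unit n c v" and i: "i < n"
    interpret gaussian_product "upper_indices n" "goe_sd n" by (rule gaussian_product_goe[OF n])
    let ?F = "\<lambda>w. poly_form n (sym_ext w) (unit_fun i) P v"
    have gp: "goe_poly n ?F" by (rule goe_poly_poly_form)
    show int: "integrable (goe_vars n) (\<lambda>w. \<bar>?F w\<bar>)"
      by (intro integrable_abs gauss_poly_integrable gp)
    have int4: "integrable (goe_vars n) (\<lambda>w. (sqrt n * ?F w) ^ 4)"
      by (intro gauss_poly_integrable gauss_poly_intros gp)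
    have le: "\<bar>f\<bar> \<le> 1 + (sqrt n * f) ^ 4" for f :: real
    proof (cases "\<bar>f\<bar> \<le> 1")
      case True
      have "0 \<le> (sqrt n * f) ^ 4" by simp
      then show ?thesis using True by linarith
    next
      case False
      have "1 * \<bar>f\<bar> \<le> sqrt n * \<bar>f\<bar>" using n by (intro mult_right_mono) auto
      then have "\<bar>f\<bar> \<le> \<bar>sqrt n * f\<bar> ^ 1" by (simp add: abs_mult)
      also have "\<dots> \<le> \<bar>sqrt n * f\<bar> ^ 4"
        using False \<open>1 * \<bar>f\<bar> \<le> sqrt n * \<bar>f\<bar>\<close> by (intro power_increasing) (auto simp: abs_mult)
      finally show ?thesis by (simp add: power_even_abs)
    qed
    have "(\<integral>w. \<bar>?F w\<bar> \<partial>goe_vars n) \<le> (\<integral>w. 1 + (sqrt n * ?F w) ^ 4 \<partial>goe_vars n)"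
      by (intro integral_mono le int Bochner_Integration.integrable_add int4) simp
    also have "\<dots> = 1 + (\<integral>w. (sqrt n * ?F w) ^ 4 \<partial>goe_vars n)"
      by (subst Bochner_Integration.integral_add[OF _ int4]) (simp_all add: prob_space)
    also have "\<dots> \<le> (1 + K) * 1" using K(2)[OF n v i] by simp
    finally show "(\<integral>w. \<bar>?F w\<bar> \<partial>goe_vars n) \<le> (1 + K) * 1" .
  qed (use K in auto)
qed

section \<open>A lower bound on the spectrum\<close>

lemma normal_exp_moment:
  assumes s: "0 < s"
  shows "has_bochner_integral (density lborel (normal_density 0 s)) (\<lambda>x. exp (t * x)) (exp (t\<^sup>2 * s\<^sup>2 / 2))"
proof -
  have eq: "normal_density 0 s x * exp (t * x) = exp (t\<^sup>2 * s\<^sup>2 / 2) * normal_density (t * s\<^sup>2) s x" for x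
  proof -
    have "- (x\<^sup>2 / (2 * s\<^sup>2)) + t * x = t\<^sup>2 * s\<^sup>2 / 2 - (x - t * s\<^sup>2)\<^sup>2 / (2 * s\<^sup>2)"
      using s by (simp add: field_simps power2_eq_square)
    then show ?thesis
      by (simp add: normal_density_def exp_add[symmetric] mult_ac)
  qed
  have "has_bochner_integral lborel (\<lambda>x. exp (t\<^sup>2 * s\<^sup>2 / 2) * normal_density (t * s\<^sup>2) s x) (exp (t\<^sup>2 * s\<^sup>2 / 2) * 1)"
    using s by (intro has_bochner_integral_mult_right) (simp_all add: has_bochner_integral_iff)
  then show ?thesis
    by (subst has_bochner_integral_density) (auto simp: eq)
qed

context gaussian_product
begin

lemma linear_exp_moment:
  "has_bochner_integral (gauss_prod I s) (\<lambda>w. exp (\<Sum>i\<in>I. c i * w i)) (exp ((\<Sum>i\<in>I. (c i)\<^sup>2 * (s i)\<^sup>2) / 2))"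
proof -
  have e: "exp (\<Sum>i\<in>I. c i * w i) = (\<Prod>i\<in>I. exp (c i * w i))" for w
    by (rule exp_sum[OF finite_I])
  have int: "integrable (density lborel (normal_density 0 (s i))) (\<lambda>x. exp (c i * x))"
    and val: "(\<integral>x. exp (c i * x) \<partial>density lborel (normal_density 0 (s i))) = exp ((c i)\<^sup>2 * (s i)\<^sup>2 / 2)" for i
    using normal_exp_moment[OF s_pos, of i "c i"] by (auto simp: has_bochner_integral_iff)
  have "integrable (gauss_prod I s) (\<lambda>w. \<Prod>i\<in>I. exp (c i * w i))"
    unfolding gauss_prod_def by (rule P.product_integrable_prod[OF finite_I]) (rule int)
  moreover have "(\<integral>w. (\<Prod>i\<in>I. exp (c i * w i)) \<partial>gauss_prod I s) = (\<Prod>i\<in>I. exp ((c i)\<^sup>2 * (s i)\<^sup>2 / 2))"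
    unfolding gauss_prod_def val[symmetric] by (rule P.product_integral_prod[OF finite_I]) (rule int)
  moreover have "(\<Prod>i\<in>I. exp ((c i)\<^sup>2 * (s i)\<^sup>2 / 2)) = exp ((\<Sum>i\<in>I. (c i)\<^sup>2 * (s i)\<^sup>2) / 2)"
    by (simp add: exp_sum[OF finite_I] sum_divide_distrib)
  ultimately show ?thesis by (simp add: e has_bochner_integral_iff)
qed

text \<open>The Chernoff bound, with the parameter \<open>r\<close> left free for
  optimization.\<close>

lemma linear_tail:
  assumes r: "0 < r" and v: "(\<Sum>i\<in>I. (c i)\<^sup>2 * (s i)\<^sup>2) \<le> v"
  shows "\<P>(w in gauss_prod I s. t \<le> (\<Sum>i\<in>I. c i * w i)) \<le> exp (r\<^sup>2 * v / 2 - r * t)"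
proof -
  let ?X = "\<lambda>w. \<Sum>i\<in>I. c i * w i"
  have r2: "(\<Sum>i\<in>I. (r * c i) * w i) = r * ?X w" for w
    by (simp add: sum_distrib_left mult_ac)
  have r3: "(\<Sum>i\<in>I. (r * c i)\<^sup>2 * (s i)\<^sup>2) = r\<^sup>2 * (\<Sum>i\<in>I. (c i)\<^sup>2 * (s i)\<^sup>2)"
    by (simp add: sum_distrib_left power_mult_distrib mult_ac)
  have m: "has_bochner_integral (gauss_prod I s) (\<lambda>w. exp (r * ?X w)) (exp (r\<^sup>2 * (\<Sum>i\<in>I. (c i)\<^sup>2 * (s i)\<^sup>2) / 2))"
    using linear_exp_moment[of "\<lambda>i. r * c i"] unfolding r2 r3 .
  have "{w \<in> space (gauss_prod I s). t \<le> ?X w} = {w \<in> space (gauss_prod I s). exp (r * t) \<le> exp (r * ?X w)}"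
    using r by auto
  then have "\<P>(w in gauss_prod I s. t \<le> ?X w) = \<P>(w in gauss_prod I s. exp (r * t) \<le> exp (r * ?X w))"
    by simp
  also have "\<dots> \<le> (\<integral>w. exp (r * ?X w) \<partial>gauss_prod I s) / exp (r * t)"
    using m by (intro integral_Markov_inequality_measure[where A = "{}"]) (auto simp: has_bochner_integral_iff)
  also have "\<dots> = exp (r\<^sup>2 * (\<Sum>i\<in>I. (c i)\<^sup>2 * (s i)\<^sup>2) / 2 - r * t)"
    using m by (simp add: has_bochner_integral_iff exp_diff)
  also have "\<dots> \<le> exp (r\<^sup>2 * v / 2 - r * t)"
    using v by (auto intro!: divide_right_mono mult_left_mono)
  finally show ?thesis .
qed

end

section \<open>Tails of the bilinear form at fixed vectors\<close>

lemma sum_square_upper: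
  fixes f :: "nat \<Rightarrow> nat \<Rightarrow> real"
  shows "(\<Sum>i<n. \<Sum>j<n. f i j) = (\<Sum>(i, j)\<in>upper_indices n. if i = j then f i j else f i j + f j i)"
proof -
  let ?U = "upper_indices n" and ?L = "{(i, j). i < n \<and> j < i}"
  have split: "{..<n} \<times> {..<n} = ?U \<union> ?L" by (auto simp: upper_indices_def)
  have finL: "finite ?L" by (rule finite_subset[of _ "{..<n} \<times> {..<n}"]) auto
  have "(\<Sum>i<n. \<Sum>j<n. f i j) = (\<Sum>(i, j)\<in>?U \<union> ?L. f i j)"
    by (simp add: sum.cartesian_product split)
  also have "\<dots> = (\<Sum>(i, j)\<in>?U. f i j) + (\<Sum>(i, j)\<in>?L. f i j)"
    by (rule sum.union_disjoint[OF finite_upper_indices finL]) (auto simp: upper_indices_def)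
  also have "(\<Sum>(i, j)\<in>?L. f i j) = (\<Sum>(i, j)\<in>{(i, j)\<in>?U. i \<noteq> j}. f j i)"
    by (rule sum.reindex_bij_witness[of _ "\<lambda>(i, j). (j, i)" "\<lambda>(i, j). (j, i)"])
      (auto simp: upper_indices_def)
  also have "\<dots> = (\<Sum>(i, j)\<in>?U. if i \<noteq> j then f j i else 0)"
    by (intro sum.mono_neutral_cong_left) auto
  also have "(\<Sum>(i, j)\<in>?U. f i j) + \<dots> = (\<Sum>(i, j)\<in>?U. if i = j then f i j else f i j + f j i)"
    unfolding sum.distrib[symmetric] by (intro sum.cong refl) auto
  finally show ?thesis .
qed

definition bilin :: "nat \<Rightarrow> (nat \<Rightarrow> nat \<Rightarrow> real) \<Rightarrow> (nat \<Rightarrow> real) \<Rightarrow> (nat \<Rightarrow> real) \<Rightarrow> real" where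
  "bilin n W x y = (\<Sum>i<n. \<Sum>j<n. W i j * (x i * y j))"

lemma bilin_diff_left: "bilin n W (\<lambda>i. x i - x' i) y = bilin n W x y - bilin n W x' y"
  by (simp add: bilin_def sum_subtractf algebra_simps)

lemma bilin_diff_right: "bilin n W x (\<lambda>i. y i - y' i) = bilin n W x y - bilin n W x y'"
  by (simp add: bilin_def sum_subtractf algebra_simps)

lemma bilin_scale: "bilin n W (\<lambda>i. a * x i) (\<lambda>i. b * y i) = a * b * bilin n W x y"
  by (simp add: bilin_def sum_distrib_left mult_ac)

text \<open>For vectors in the unit ball the form is a centred Gaussian of variance at most 2 / n,
  and n t / 2 minimizes the Chernoff bound.\<close>

lemma bilin_tail:
  assumes n: "0 < n" and x: "inner_n n x x \<le> 1" and y: "inner_n n y y \<le> 1" and t: "0 < t"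
  shows "\<P>(w in goe_vars n. t \<le> bilin n (sym_ext w) x y) \<le> exp (- (real n * t\<^sup>2 / 4))"
proof -
  interpret gaussian_product "upper_indices n" "goe_sd n" by (rule gaussian_product_goe[OF n])
  define c where "c = (\<lambda>(i, j). if i = j then x i * y j else x i * y j + x j * y i)"
  have lin: "bilin n (sym_ext w) x y = (\<Sum>u\<in>upper_indices n. c u * w u)" for w
    unfolding bilin_def sum_square_upper
    by (intro sum.cong refl)
      (auto simp: c_def sym_ext_def upper_indices_def min_def max_def algebra_simps)
  \<comment> \<open>Off the diagonal (a + b)^2 \<le> 2 a^2 + 2 b^2 costs a factor 2, which matches
    the doubled variance on the diagonal; the bound is thus a full double sum.\<close>
  have "(\<Sum>u\<in>upper_indices n. (c u)\<^sup>2 * (goe_sd n u)\<^sup>2) \<le>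
      (\<Sum>(i, j)\<in>upper_indices n. if i = j then 2 / n * ((x i)\<^sup>2 * (y j)\<^sup>2)
        else 2 / n * ((x i)\<^sup>2 * (y j)\<^sup>2) + 2 / n * ((x j)\<^sup>2 * (y i)\<^sup>2))"
  proof (intro sum_mono, clarify)
    fix i j assume "(i, j) \<in> upper_indices n"
    have "(x i * y j + x j * y i)\<^sup>2 \<le> 2 * (x i * y j)\<^sup>2 + 2 * (x j * y i)\<^sup>2"
      using sum_squares_bound[of "x i * y j" "x j * y i"] by (simp add: power2_sum)
    then have "(x i * y j + x j * y i)\<^sup>2 / n \<le> (2 * (x i * y j)\<^sup>2 + 2 * (x j * y i)\<^sup>2) / n"
      by (rule divide_right_mono) simp
    then show "(c (i, j))\<^sup>2 * (goe_sd n (i, j))\<^sup>2 \<le> (if i = j then 2 / n * ((x i)\<^sup>2 * (y j)\<^sup>2)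
        else 2 / n * ((x i)\<^sup>2 * (y j)\<^sup>2) + 2 / n * ((x j)\<^sup>2 * (y i)\<^sup>2))"
      by (cases "i = j") (simp_all add: c_def goe_sd_def power_mult_distrib add_divide_distrib mult_ac)
  qed
  also have "\<dots> = (\<Sum>i<n. \<Sum>j<n. 2 / n * ((x i)\<^sup>2 * (y j)\<^sup>2))"
    by (rule sum_square_upper[symmetric])
  also have "\<dots> = 2 / n * (inner_n n x x * inner_n n y y)"
  proof -
    have "inner_n n x x * inner_n n y y = (\<Sum>i<n. \<Sum>j<n. (x i)\<^sup>2 * (y j)\<^sup>2)"
      unfolding inner_n_def sum_product by (simp add: power2_eq_square)
    then show ?thesis by (simp only: sum_distrib_left)
  qed
  also have "\<dots> \<le> 2 / n * (1 * 1)"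
    using x y by (intro mult_left_mono mult_mono) (auto simp: inner_n_def sum_nonneg)
  finally have v: "(\<Sum>u\<in>upper_indices n. (c u)\<^sup>2 * (goe_sd n u)\<^sup>2) \<le> 2 / n" by simp
  have "\<P>(w in goe_vars n. t \<le> (\<Sum>u\<in>upper_indices n. c u * w u)) \<le>
      exp ((n * t / 2)\<^sup>2 * (2 / n) / 2 - (n * t / 2) * t)"
    using n t by (intro linear_tail v) auto
  also have "(n * t / 2)\<^sup>2 * (2 / n) / 2 - (n * t / 2) * t = - (real n * t\<^sup>2 / 4)"
    using n by (simp add: field_simps power2_eq_square)
  finally show ?thesis unfolding lin .
qed

text \<open>The bound on the number of grid points is of the form \<open>exp (C n)\<close> although the coordinates range
  over \<open>8 n + 1\<close> values, because the norm of the points is bounded.\<close>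

definition grid :: "nat \<Rightarrow> (nat \<Rightarrow> int) set" where
  "grid n = {k \<in> {..<n} \<rightarrow>\<^sub>E {- int (4 * n)..int (4 * n)}. (\<Sum>i<n. (real_of_int (k i))\<^sup>2) \<le> 16 * n}"

definition grid_point :: "nat \<Rightarrow> (nat \<Rightarrow> int) \<Rightarrow> nat \<Rightarrow> real" where
  "grid_point n k i = k i / (4 * sqrt n)"

lemma finite_grid: "finite (grid n)"
  unfolding grid_def by (rule finite_subset[OF _ finite_PiE[of "{..<n}" "\<lambda>_. {- int (4 * n)..int (4 * n)}"]]) auto

lemma sum_half_powers: "(\<Sum>k\<in>{- int K..int K}. (1 / 2 :: real) ^ nat \<bar>k\<bar>) = 3 - 2 * (1 / 2) ^ K"
proof (induction K)
  case (Suc K)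
  have "{- int (Suc K)..int (Suc K)} = insert (- int (Suc K)) (insert (int (Suc K)) {- int K..int K})"
    by auto
  then have f: "(\<Sum>k\<in>{- int (Suc K)..int (Suc K)}. (1 / 2 :: real) ^ nat \<bar>k\<bar>) =
      (1 / 2) ^ nat \<bar>- int (Suc K)\<bar> + ((1 / 2) ^ nat \<bar>int (Suc K)\<bar> + (3 - 2 * (1 / 2) ^ K))"
    using Suc by simp
  have e: "nat \<bar>- int (Suc K)\<bar> = Suc K" "nat \<bar>int (Suc K)\<bar> = Suc K" by auto
  show ?case unfolding f e by simp
qed simp

text \<open>On the grid the weight exp (16 n - \<Sum> k_i^2) is at least 1, while its sum over the
  whole box factors into one-dimensional sums, each at most 3 \<le> exp 2. This gives 16 + 2 in the
  exponent.\<close>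

lemma card_grid: "real (card (grid n)) \<le> exp (18 * n)"
proof -
  let ?Z = "{- int (4 * n)..int (4 * n)}"
  have fin: "finite ({..<n} \<rightarrow>\<^sub>E ?Z)" by (intro finite_PiE) auto
  have le: "exp (- (real_of_int k)\<^sup>2) \<le> (1 / 2) ^ nat \<bar>k\<bar>" for k :: int
  proof -
    have "real (nat \<bar>k\<bar>) \<le> (real_of_int k)\<^sup>2"
    proof -
      have "\<bar>k\<bar> * 1 \<le> \<bar>k\<bar> * \<bar>k\<bar>" by (cases "k = 0") (simp, intro mult_left_mono, auto)
      then have "\<bar>k\<bar> \<le> k\<^sup>2" by (simp add: power2_eq_square)
      then have "real_of_int \<bar>k\<bar> \<le> real_of_int (k\<^sup>2)" by (simp only: of_int_le_iff)
      then show ?thesis by simp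
    qed
    then have "exp (- (real_of_int k)\<^sup>2) \<le> exp (real (nat \<bar>k\<bar>) * (-1))" by simp
    also have "\<dots> = exp (-1) ^ nat \<bar>k\<bar>" by (rule exp_of_nat_mult)
    also have "\<dots> \<le> (1 / 2) ^ nat \<bar>k\<bar>"
      using exp_ge_add_one_self[of 1] by (intro power_mono) (auto simp: exp_minus field_simps)
    finally show ?thesis .
  qed
  have "real (card (grid n)) = (\<Sum>k\<in>grid n. 1)" by simp
  also have "\<dots> \<le> (\<Sum>k\<in>grid n. exp (16 * real n - (\<Sum>i<n. (real_of_int (k i))\<^sup>2)))"
    by (intro sum_mono) (auto simp: grid_def)
  also have "\<dots> \<le> (\<Sum>k\<in>{..<n} \<rightarrow>\<^sub>E ?Z. exp (16 * real n - (\<Sum>i<n. (real_of_int (k i))\<^sup>2)))"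
    by (rule sum_mono2[OF fin]) (auto simp: grid_def)
  also have "\<dots> = exp (16 * real n) * (\<Sum>k\<in>{..<n} \<rightarrow>\<^sub>E ?Z. \<Prod>i<n. exp (- (real_of_int (k i))\<^sup>2))"
  proof -
    have "exp (16 * real n - (\<Sum>i<n. z i)) = exp (16 * real n) * (\<Prod>i<n. exp (- z i))" for z :: "nat \<Rightarrow> real"
      by (subst exp_sum[symmetric]) (simp_all add: sum_negf flip: exp_add)
    then show ?thesis by (simp only: sum_distrib_left)
  qed
  also have "(\<Sum>k\<in>{..<n} \<rightarrow>\<^sub>E ?Z. \<Prod>i<n. exp (- (real_of_int (k i))\<^sup>2)) =
      (\<Prod>i<n. \<Sum>k\<in>?Z. exp (- (real_of_int k)\<^sup>2))"
    by (subst prod_sum_PiE) auto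
  also have "\<dots> = (\<Sum>k\<in>?Z. exp (- (real_of_int k)\<^sup>2)) ^ n" by simp
  also have "\<dots> \<le> (\<Sum>k\<in>?Z. (1 / 2) ^ nat \<bar>k\<bar>) ^ n"
    by (intro power_mono sum_mono le sum_nonneg) auto
  also have "\<dots> \<le> exp 2 ^ n"
    unfolding sum_half_powers using exp_ge_add_one_self[of 2] power_le_one[of "1 / 2 :: real" "4 * n"]
      zero_le_power[of "1 / 2 :: real" "4 * n"]
    by (intro power_mono; linarith)
  also have "exp 2 ^ n = exp (2 * real n)" by (metis exp_of_nat_mult mult.commute)
  finally show ?thesis by (simp add: mult_left_mono flip: exp_add)
qed

lemma grid_point_norm:
  assumes "k \<in> grid n"
  shows "inner_n n (grid_point n k) (grid_point n k) \<le> 1"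
proof -
  have "inner_n n (grid_point n k) (grid_point n k) = (\<Sum>i<n. (real_of_int (k i))\<^sup>2) / (16 * n)"
    by (simp add: inner_n_def grid_point_def sum_divide_distrib power2_eq_square)
  also have "\<dots> \<le> 1" using assms by (cases "n = 0") (auto simp: grid_def divide_le_eq_1)
  finally show ?thesis .
qed

text \<open>Rounding each coordinate towards zero does not increase the norm, so the rounded point
  lies in the grid. A coordinate moves by at most 1 / (4 sqrt n), hence the vector by at most 1 / 4.
  The factor 4 is put into the conclusion so that the scaled difference is again a vector of the
  unit ball.\<close>

lemma grid_approx:
  assumes n: "0 < n" and x: "inner_n n x x \<le> 1"
  shows "\<exists>k\<in>grid n. inner_n n (\<lambda>i. 4 * (x i - grid_point n k i)) (\<lambda>i. 4 * (x i - grid_point n k i)) \<le> 1"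
proof -
  define k where "k = (\<lambda>i\<in>{..<n}. let z = x i * (4 * sqrt n) in if 0 \<le> z then \<lfloor>z\<rfloor> else \<lceil>z\<rceil>)"
  have k1: "\<bar>real_of_int (k i)\<bar> \<le> \<bar>x i * (4 * sqrt n)\<bar>"
    and k2: "\<bar>x i * (4 * sqrt n) - real_of_int (k i)\<bar> \<le> 1" if "i < n" for i
    using that by (auto simp: k_def Let_def) (linarith+)
  have sq: "(real_of_int (k i))\<^sup>2 \<le> 16 * n * (x i * x i)" if "i < n" for i
  proof -
    have "(real_of_int (k i))\<^sup>2 \<le> (x i * (4 * sqrt n))\<^sup>2"
      using k1[OF that] by (simp only: abs_le_square_iff)
    then show ?thesis by (simp add: power_mult_distrib power2_eq_square[of "x i"] mult_ac)
  qed
  have sum: "(\<Sum>i<n. (real_of_int (k i))\<^sup>2) \<le> 16 * n"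
  proof -
    have "(\<Sum>i<n. (real_of_int (k i))\<^sup>2) \<le> (\<Sum>i<n. 16 * n * (x i * x i))"
      by (intro sum_mono sq) auto
    also have "\<dots> = 16 * real n * inner_n n x x" by (simp add: inner_n_def sum_distrib_left)
    also have "\<dots> \<le> 16 * real n * 1" using x by (intro mult_left_mono) auto
    finally show ?thesis by simp
  qed
  have "k i \<in> {- int (4 * n)..int (4 * n)}" if i: "i < n" for i
  proof -
    have "(real_of_int (k i))\<^sup>2 \<le> (\<Sum>i<n. (real_of_int (k i))\<^sup>2)"
      using i by (intro member_le_sum) auto
    also have "\<dots> \<le> 16 * real n" using sum by simp
    also have "16 * real n \<le> (4 * real n)\<^sup>2" using n by (simp add: power2_eq_square)
    finally have "\<bar>real_of_int (k i)\<bar> \<le> \<bar>4 * real n\<bar>" by (simp only: abs_le_square_iff)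
    then show ?thesis by auto
  qed
  then have "k \<in> grid n" using sum by (auto simp: grid_def k_def)
  moreover have "inner_n n (\<lambda>i. 4 * (x i - grid_point n k i)) (\<lambda>i. 4 * (x i - grid_point n k i)) \<le> 1"
  proof -
    have "(4 * (x i - grid_point n k i)) * (4 * (x i - grid_point n k i)) \<le> 1 / n" if i: "i < n" for i
    proof -
      have "4 * (x i - grid_point n k i) = (x i * (4 * sqrt n) - real_of_int (k i)) / sqrt n"
        using n by (simp add: grid_point_def field_simps)
      then have "(4 * (x i - grid_point n k i))\<^sup>2 = (x i * (4 * sqrt n) - real_of_int (k i))\<^sup>2 / n"
        by (simp add: power_divide)
      also have "\<dots> \<le> 1 / n"
        using k2[OF i] by (intro divide_right_mono) (auto simp: abs_square_le_1)
      finally show ?thesis by (simp add: power2_eq_square)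
    qed
    then have "inner_n n (\<lambda>i. 4 * (x i - grid_point n k i)) (\<lambda>i. 4 * (x i - grid_point n k i)) \<le> (\<Sum>i<n. 1 / n)"
      unfolding inner_n_def by (intro sum_mono) auto
    then show ?thesis using n by simp
  qed
  ultimately show ?thesis by blast
qed

lemma coordinate_le_norm:
  assumes "inner_n n x x \<le> 1" "i < n"
  shows "\<bar>x i\<bar> \<le> 1"
proof -
  have "x i * x i \<le> inner_n n x x"
    unfolding inner_n_def using assms(2) by (intro member_le_sum) auto
  then have "(x i)\<^sup>2 \<le> 1" using assms(1) by (simp add: power2_eq_square)
  then show ?thesis by (simp only: abs_square_le_1)
qed

text \<open>With N the supremum over the unit ball, moving x and then y to the grid costs N / 4
  each, so N \<le> t + N / 2. Solving for N requires it to be finite, which the sum of the absolute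
  values of the entries ensures.\<close>

lemma bilin_bound_from_grid:
  assumes n: "0 < n"
    and t: "\<And>k l. k \<in> grid n \<Longrightarrow> l \<in> grid n \<Longrightarrow> bilin n W (grid_point n k) (grid_point n l) \<le> t"
    and x: "inner_n n x x \<le> 1" and y: "inner_n n y y \<le> 1"
  shows "bilin n W x y \<le> 2 * t"
proof -
  define S where "S = (\<lambda>(x, y). bilin n W x y) ` {(x, y). inner_n n x x \<le> 1 \<and> inner_n n y y \<le> 1}"
  define N where "N = Sup S"
  have bdd: "bdd_above S"
  proof (rule bdd_aboveI[of _ "\<Sum>i<n. \<Sum>j<n. \<bar>W i j\<bar>"])
    fix b assume "b \<in> S"
    then obtain x y where b: "b = bilin n W x y" and xy: "inner_n n x x \<le> 1" "inner_n n y y \<le> 1"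
      by (auto simp: S_def)
    have "W i j * (x i * y j) \<le> \<bar>W i j\<bar>" if "i < n" "j < n" for i j
    proof -
      have "\<bar>x i * y j\<bar> \<le> 1 * 1"
        unfolding abs_mult using coordinate_le_norm xy that by (intro mult_mono) auto
      then have "\<bar>W i j * (x i * y j)\<bar> \<le> \<bar>W i j\<bar> * 1"
        unfolding abs_mult[of "W i j"] by (intro mult_left_mono) auto
      then show ?thesis by simp
    qed
    then show "b \<le> (\<Sum>i<n. \<Sum>j<n. \<bar>W i j\<bar>)"
      unfolding b bilin_def by (intro sum_mono) auto
  qed
  have upper: "bilin n W x y \<le> N" if "inner_n n x x \<le> 1" "inner_n n y y \<le> 1" for x y
    unfolding N_def using that by (intro cSup_upper bdd) (auto simp: S_def)
  have least: "b \<le> t + N / 2" if "b \<in> S" for b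
  proof -
    note \<open>b \<in> S\<close>
    then obtain x y where b: "b = bilin n W x y" and xy: "inner_n n x x \<le> 1" "inner_n n y y \<le> 1"
      by (auto simp: S_def)
    obtain k where k: "k \<in> grid n"
      "inner_n n (\<lambda>i. 4 * (x i - grid_point n k i)) (\<lambda>i. 4 * (x i - grid_point n k i)) \<le> 1"
      using grid_approx[OF n xy(1)] by blast
    obtain l where l: "l \<in> grid n"
      "inner_n n (\<lambda>i. 4 * (y i - grid_point n l i)) (\<lambda>i. 4 * (y i - grid_point n l i)) \<le> 1"
      using grid_approx[OF n xy(2)] by blast
    have 1: "4 * (bilin n W x y - bilin n W (grid_point n k) y) \<le> N"
      using upper[OF k(2) xy(2)] bilin_scale[of n W 4 "\<lambda>i. x i - grid_point n k i" 1 y]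
      by (simp add: bilin_diff_left)
    have 2: "4 * (bilin n W (grid_point n k) y - bilin n W (grid_point n k) (grid_point n l)) \<le> N"
      using upper[OF grid_point_norm[OF k(1)] l(2)]
        bilin_scale[of n W 1 "grid_point n k" 4 "\<lambda>i. y i - grid_point n l i"]
      by (simp add: bilin_diff_right)
    show ?thesis
      using 1 2 t[OF k(1) l(1)] unfolding b by (simp add: field_simps)
  qed
  have "inner_n n (\<lambda>_. 0) (\<lambda>_. 0) \<le> 1" by (simp add: inner_n_def)
  then have "S \<noteq> {}" by (auto simp: S_def)
  then have "N \<le> t + N / 2" unfolding N_def by (rule cSup_least) (use least in \<open>simp add: N_def\<close>)
  then show ?thesis using upper[OF x y] by linarith
qed

lemma inner_n_nonneg: "0 \<le> inner_n n x x"
  by (simp add: inner_n_def sum_nonneg)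

text \<open>An upper bound on the bilinear form at -x / |x| and x / |x| is a lower bound on the
  quadratic form at x.\<close>

lemma bilin_lower_from_grid:
  assumes n: "0 < n"
    and t: "\<And>k l. k \<in> grid n \<Longrightarrow> l \<in> grid n \<Longrightarrow> bilin n W (grid_point n k) (grid_point n l) \<le> t"
  shows "- (2 * t * inner_n n x x) \<le> bilin n W x x"
proof (cases "inner_n n x x = 0")
  case True
  then have "\<forall>i<n. x i = 0" by (auto simp: inner_n_def sum_nonneg_eq_0_iff)
  then show ?thesis using True by (simp add: bilin_def)
next
  case False
  then have pos: "0 < inner_n n x x" using inner_n_nonneg[of n x] by simp
  define r where "r = sqrt (inner_n n x x)"
  have r: "0 < r" "r * r = inner_n n x x" using pos by (auto simp: r_def)
  have norm: "inner_n n (\<lambda>i. a / r * x i) (\<lambda>i. a / r * x i) \<le> 1" if "a * a = 1" for a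
  proof -
    have "inner_n n (\<lambda>i. a / r * x i) (\<lambda>i. a / r * x i) = (a * a) / (r * r) * inner_n n x x"
      by (simp add: inner_n_def sum_distrib_left mult_ac)
    then show ?thesis using that r by simp
  qed
  have "bilin n W (\<lambda>i. (-1) / r * x i) (\<lambda>i. 1 / r * x i) \<le> 2 * t"
    by (intro bilin_bound_from_grid n t norm) auto
  then have "- bilin n W x x / inner_n n x x \<le> 2 * t"
    unfolding bilin_scale using r by simp
  then have "- bilin n W x x \<le> 2 * t * inner_n n x x"
    using pos by (simp only: pos_divide_le_eq)
  then show ?thesis by simp
qed

text \<open>At most exp (36 n) pairs of grid points compete with the tail exp (- n t^2 / 4), and 13
  is the first integer t with t^2 / 4 > 36; passing from the grid to the ball doubles it to 26. The
  probability 3 / 4 leaves room for two further bad events of probability 1 / 8 each.\<close>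

lemma goe_lower_form_bound:
  assumes n: "0 < n"
  shows "\<exists>E\<in>sets (goe_vars n). 3 / 4 \<le> measure (goe_vars n) E \<and>
    (\<forall>w\<in>E. \<forall>x. - (26 * inner_n n x x) \<le> bilin n (sym_ext w) x x)"
proof -
  interpret gaussian_product "upper_indices n" "goe_sd n" by (rule gaussian_product_goe[OF n])
  let ?X = "\<lambda>kl w. bilin n (sym_ext w) (grid_point n (fst kl)) (grid_point n (snd kl))"
  let ?B = "\<lambda>kl. {w \<in> space (goe_vars n). 13 \<le> ?X kl w}"
  let ?G = "grid n \<times> grid n"
  have "goe_poly n (?X kl)" for kl
    unfolding bilin_def by (auto intro!: gauss_poly_intros goe_poly_entry)
  then have meas: "?X kl \<in> borel_measurable (goe_vars n)" for kl
    using gauss_poly_integrable by blast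
  have B: "?B kl \<in> sets (goe_vars n)" for kl
    using meas by measurable
  have "measure (goe_vars n) (\<Union>kl\<in>?G. ?B kl) \<le> (\<Sum>kl\<in>?G. measure (goe_vars n) (?B kl))"
    using B by (intro finite_measure_subadditive_finite) (auto simp: finite_grid)
  also have "\<dots> \<le> (\<Sum>kl\<in>?G. exp (- (real n * 13\<^sup>2 / 4)))"
    by (intro sum_mono bilin_tail n grid_point_norm) auto
  also have "\<dots> = (real (card (grid n)))\<^sup>2 * exp (- (real n * 13\<^sup>2 / 4))"
    by (simp add: card_cartesian_product power2_eq_square)
  also have "\<dots> \<le> (exp (18 * real n))\<^sup>2 * exp (- (real n * 13\<^sup>2 / 4))"
    by (intro mult_right_mono power_mono card_grid) auto
  also have "\<dots> = exp (36 * real n - real n * 169 / 4)"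
    by (simp add: power2_eq_square flip: exp_add)
  also have "\<dots> \<le> exp (- 3)" using n by simp
  also have "exp (- 3) \<le> (1 / 4 :: real)"
    using exp_ge_add_one_self[of 3] by (simp add: exp_minus field_simps)
  finally have bad: "measure (goe_vars n) (\<Union>kl\<in>?G. ?B kl) \<le> 1 / 4" .
  let ?E = "space (goe_vars n) - (\<Union>kl\<in>?G. ?B kl)"
  have U: "(\<Union>kl\<in>?G. ?B kl) \<in> sets (goe_vars n)"
    using B by (intro sets.finite_UN) (auto simp: finite_grid)
  show ?thesis
  proof (intro bexI[of _ ?E] conjI ballI allI)
    show "3 / 4 \<le> measure (goe_vars n) ?E"
      using bad prob_compl[OF U] by simp
    fix w x assume "w \<in> ?E"
    then have "bilin n (sym_ext w) (grid_point n k) (grid_point n l) \<le> 13"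
      if "k \<in> grid n" "l \<in> grid n" for k l
      using that by force
    from bilin_lower_from_grid[OF n this, of x]
    show "- (26 * inner_n n x x) \<le> bilin n (sym_ext w) x x" by simp
  qed (use U in auto)
qed

section \<open>Concentration of Lipschitz functions\<close>

text \<open>The variance is at most the mean square of h y - h 0, hence at most L^2 times the second
  moment. An arbitrary centre \<open>c\<close> is allowed because the induction over coordinates
  compares h with the global mean, not with its own.\<close>

lemma normal_lipschitz_variance:
  fixes h :: "real \<Rightarrow> real"
  assumes s: "0 < s" and L: "\<And>x y. \<bar>h x - h y\<bar> \<le> L * \<bar>x - y\<bar>"
  defines "N \<equiv> density lborel (normal_density 0 s)"
  shows "integrable N h" "(\<integral>y. (h y - c)\<^sup>2 \<partial>N) \<le> L\<^sup>2 * s\<^sup>2 + ((\<integral>y. h y \<partial>N) - c)\<^sup>2"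
proof -
  interpret prob_space N unfolding N_def by (rule prob_space_normal_density[OF s])
  have L0: "0 \<le> L" using L[of 1 0] by simp
  have "(L)-lipschitz_on UNIV h"
    using L L0 by (intro lipschitz_onI) (auto simp: dist_real_def)
  then have "continuous_on UNIV h" by (rule lipschitz_on_continuous_on)
  then have "h \<in> borel_measurable borel" by (rule borel_measurable_continuous_onI)
  then have hm [measurable]: "h \<in> borel_measurable N" by (simp add: N_def)
  have id2: "integrable N (\<lambda>y. y\<^sup>2)"
    unfolding N_def by (rule normal_moment_integrable[OF s])
  have sq: "(h y - h 0)\<^sup>2 \<le> L\<^sup>2 * y\<^sup>2" for y
  proof -
    have "\<bar>h y - h 0\<bar> \<le> \<bar>L * \<bar>y\<bar>\<bar>" using L[of y 0] L0 by simp
    then have "(h y - h 0)\<^sup>2 \<le> (L * \<bar>y\<bar>)\<^sup>2" by (simp only: abs_le_square_iff)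
    then show ?thesis by (simp add: power_mult_distrib)
  qed
  have int0: "integrable N (\<lambda>y. (h y - h 0)\<^sup>2)"
    by (rule Bochner_Integration.integrable_bound[of _ "\<lambda>y. L\<^sup>2 * y\<^sup>2"]) (use id2 sq in auto)
  have "integrable N (\<lambda>y. h y - h 0)"
    by (rule square_integrable_imp_integrable[OF _ int0]) simp
  then have "integrable N (\<lambda>y. (h y - h 0) + h 0)" by (intro Bochner_Integration.integrable_add) auto
  then show int: "integrable N h" by simp
  define m where "m = (\<integral>y. h y \<partial>N)"
  have expand: "(\<integral>y. (h y - b)\<^sup>2 \<partial>N) = (\<integral>y. (h y - h 0)\<^sup>2 \<partial>N) - (m - h 0)\<^sup>2 + (m - b)\<^sup>2" for b
  proof -
    have "(\<integral>y. (h y - b)\<^sup>2 \<partial>N) = (\<integral>y. (h y - h 0)\<^sup>2 + (2 * (h 0 - b) * h y + (b\<^sup>2 - (h 0)\<^sup>2)) \<partial>N)"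
      by (intro Bochner_Integration.integral_cong refl) (simp add: power2_eq_square algebra_simps)
    also have "\<dots> = (\<integral>y. (h y - h 0)\<^sup>2 \<partial>N) + (2 * (h 0 - b) * m + (b\<^sup>2 - (h 0)\<^sup>2))"
      using int0 int by (simp add: m_def prob_space)
    finally show ?thesis by (simp add: power2_eq_square algebra_simps)
  qed
  have "(\<integral>y. (h y - h 0)\<^sup>2 \<partial>N) \<le> (\<integral>y. L\<^sup>2 * y\<^sup>2 \<partial>N)"
    by (intro integral_mono int0 sq) (use id2 in auto)
  also have "(\<integral>y. L\<^sup>2 * y\<^sup>2 \<partial>N) = L\<^sup>2 * s\<^sup>2"
    using normal_moment_rec[OF s, of 1] prob_space
    by (simp add: N_def power2_eq_square)
  finally show "(\<integral>y. (h y - c)\<^sup>2 \<partial>N) \<le> L\<^sup>2 * s\<^sup>2 + ((\<integral>y. h y \<partial>N) - c)\<^sup>2"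
    unfolding m_def[symmetric] expand[of c] using zero_le_power2[of "m - h 0"] by linarith
qed

text \<open>Lipschitz in each coordinate with the others frozen, which is all that a variance bound
  by tensorization uses.\<close>

definition coord_lipschitz :: "'i set \<Rightarrow> real \<Rightarrow> (('i \<Rightarrow> real) \<Rightarrow> real) \<Rightarrow> bool" where
  "coord_lipschitz I L f \<longleftrightarrow> (\<forall>i\<in>I. \<forall>w t. \<bar>f (w(i := t)) - f w\<bar> \<le> L * \<bar>t - w i\<bar>)"

lemma coord_lipschitz_bound:
  assumes "finite I" "coord_lipschitz I L f" "\<And>i. i \<notin> I \<Longrightarrow> w i = w' i"
  shows "\<bar>f w - f w'\<bar> \<le> L * (\<Sum>i\<in>I. \<bar>w i - w' i\<bar>)"
  using assms
proof (induction I arbitrary: w)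
  case empty
  then have "w = w'" by auto
  then show ?case by simp
next
  case (insert i I)
  let ?w = "w(i := w' i)"
  have "\<bar>f ?w - f w'\<bar> \<le> L * (\<Sum>j\<in>I. \<bar>?w j - w' j\<bar>)"
    using insert.prems by (intro insert.IH) (auto simp: coord_lipschitz_def)
  also have "(\<Sum>j\<in>I. \<bar>?w j - w' j\<bar>) = (\<Sum>j\<in>I. \<bar>w j - w' j\<bar>)"
    using insert.hyps by (intro sum.cong) auto
  finally have 1: "\<bar>f ?w - f w'\<bar> \<le> L * (\<Sum>j\<in>I. \<bar>w j - w' j\<bar>)" .
  have 2: "\<bar>f ?w - f w\<bar> \<le> L * \<bar>w' i - w i\<bar>"
    using insert.prems by (auto simp: coord_lipschitz_def)
  have "\<bar>f w - f w'\<bar> \<le> L * \<bar>w i - w' i\<bar> + L * (\<Sum>j\<in>I. \<bar>w j - w' j\<bar>)"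
    using 1 2 unfolding abs_minus_commute[of "w' i"] by linarith
  then show ?case using insert.hyps by (simp add: distrib_left)
qed

lemma (in gaussian_product) coord_lipschitz_square_integrable:
  assumes f: "f \<in> borel_measurable (gauss_prod I s)" and L: "coord_lipschitz I L f"
  shows "integrable (gauss_prod I s) (\<lambda>w. (f w)\<^sup>2)"
proof -
  \<comment> \<open>Restricted to \<open>I\<close>, so that off \<open>I\<close> it agrees with the
    points of the product space, which are \<open>undefined\<close> there.\<close>
  let ?w0 = "\<lambda>i\<in>I. 0 :: real"
  let ?B = "\<lambda>w. 2 * (f ?w0)\<^sup>2 + 2 * (L\<^sup>2 * (real (card I) * (\<Sum>i\<in>I. (w i)\<^sup>2)))"
  have le: "(f w)\<^sup>2 \<le> ?B w" if "w \<in> space (gauss_prod I s)" for w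
  proof -
    have "\<bar>f w - f ?w0\<bar> \<le> L * (\<Sum>i\<in>I. \<bar>w i - ?w0 i\<bar>)"
      using that by (intro coord_lipschitz_bound finite_I L)
        (auto simp: gauss_prod_def space_PiM PiE_def extensional_def)
    also have "\<dots> = L * (\<Sum>i\<in>I. \<bar>w i\<bar>)" by simp
    also have "\<dots> \<le> \<bar>L * (\<Sum>i\<in>I. \<bar>w i\<bar>)\<bar>" by simp
    finally have "(f w - f ?w0)\<^sup>2 \<le> (L * (\<Sum>i\<in>I. \<bar>w i\<bar>))\<^sup>2" by (simp only: abs_le_square_iff)
    also have "\<dots> = L\<^sup>2 * (\<Sum>i\<in>I. \<bar>w i\<bar>)\<^sup>2" by (simp add: power_mult_distrib)
    also have "\<dots> \<le> L\<^sup>2 * (real (card I) * (\<Sum>i\<in>I. (w i)\<^sup>2))"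
    proof (intro mult_left_mono)
      show "(\<Sum>i\<in>I. \<bar>w i\<bar>)\<^sup>2 \<le> real (card I) * (\<Sum>i\<in>I. (w i)\<^sup>2)"
        using sum_squared_le_sum_of_squares[of "\<lambda>i. \<bar>w i\<bar>" I] by (simp add: mult.commute)
    qed simp
    finally have "(f w - f ?w0)\<^sup>2 \<le> L\<^sup>2 * (real (card I) * (\<Sum>i\<in>I. (w i)\<^sup>2))" .
    moreover have "(f w)\<^sup>2 \<le> 2 * (f ?w0)\<^sup>2 + 2 * (f w - f ?w0)\<^sup>2"
      using zero_le_power2[of "f w - 2 * f ?w0"] by (simp add: power2_eq_square algebra_simps)
    ultimately show ?thesis by linarith
  qed
  have "integrable (gauss_prod I s) ?B"
    by (intro gauss_poly_integrable gauss_poly_intros gauss_poly_var finite_I)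
  then show ?thesis
  proof (rule Bochner_Integration.integrable_bound)
    show "(\<lambda>w. (f w)\<^sup>2) \<in> borel_measurable (gauss_prod I s)"
      by (intro borel_measurable_power f)
    show "AE w in gauss_prod I s. norm ((f w)\<^sup>2) \<le> norm (?B w)"
      unfolding real_norm_def abs_power2
      by (intro AE_I2 order.trans[OF le abs_ge_self])
  qed
qed

text \<open>Tensorization of the variance: integrating out one coordinate adds at most L^2 (s i)^2,
  and the resulting function g of the other coordinates is Lipschitz with the same constant, so the
  induction continues with g.\<close>

lemma gauss_lipschitz_variance:
  assumes s: "\<And>i. 0 < s i" and I: "finite I" and f: "f \<in> borel_measurable (gauss_prod I s)"
    and L: "coord_lipschitz I L f"
  shows "(\<integral>w. (f w - (\<integral>w. f w \<partial>gauss_prod I s))\<^sup>2 \<partial>gauss_prod I s) \<le> L\<^sup>2 * (\<Sum>i\<in>I. (s i)\<^sup>2)"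
  using I f L
proof (induction I arbitrary: f)
  case empty
  interpret gaussian_product "{}" s by unfold_locales (auto simp: s)
  have eq: "f w = f (\<lambda>_. undefined)" if "w \<in> space (gauss_prod {} s)" for w
    using that by (simp add: gauss_prod_def space_PiM)
  have "(\<integral>w. f w \<partial>gauss_prod {} s) = (\<integral>w. f (\<lambda>_. undefined) \<partial>gauss_prod {} s)"
    and "(\<integral>w. (f w - c)\<^sup>2 \<partial>gauss_prod {} s) = (\<integral>w. (f (\<lambda>_. undefined) - c)\<^sup>2 \<partial>gauss_prod {} s)" for c
    by (rule Bochner_Integration.integral_cong[OF refl], simp only: eq)+
  then show ?case by (simp add: prob_space)
next
  case (insert i I)
  interpret G: gaussian_product "insert i I" s using insert.hyps by unfold_locales (auto simp: s)
  interpret H: gaussian_product I s using insert.hyps by unfold_locales (auto simp: s)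
  let ?N = "\<lambda>i. density lborel (normal_density 0 (s i))"
  note [measurable] = insert.prems(1)
  have L0: "0 \<le> L"
  proof -
    have "\<bar>f ((\<lambda>_. 0)(i := 1)) - f (\<lambda>_. 0)\<bar> \<le> L * \<bar>1 - 0\<bar>"
      using insert.prems(2) unfolding coord_lipschitz_def by blast
    then show ?thesis by simp
  qed
  define g where "g = (\<lambda>x. \<integral>y. f (x(i := y)) \<partial>?N i)"
  have lip1: "\<bar>f (x(i := y)) - f (x(i := y'))\<bar> \<le> L * \<bar>y - y'\<bar>" for x y y'
  proof -
    have "\<bar>f ((x(i := y'))(i := y)) - f (x(i := y'))\<bar> \<le> L * \<bar>y - (x(i := y')) i\<bar>"
      using insert.prems(2) unfolding coord_lipschitz_def by blast
    then show ?thesis by simp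
  qed
  note one = normal_lipschitz_variance[OF s, of _ L, OF lip1]
  have pair: "(\<lambda>(x, y). f (x(i := y))) \<in> borel_measurable (Pi\<^sub>M I ?N \<Otimes>\<^sub>M ?N i)"
    using measurable_comp[OF measurable_add_dim insert.prems(1)[unfolded gauss_prod_def]]
    by (simp add: comp_def split_beta)
  have gm: "g \<in> borel_measurable (gauss_prod I s)"
    unfolding g_def gauss_prod_def
    by (rule sigma_finite_measure.borel_measurable_lebesgue_integral
      [OF prob_space_imp_sigma_finite[OF prob_space_normal_density[OF s]]]) (rule pair)
  have gL: "coord_lipschitz I L g"
    unfolding coord_lipschitz_def
  proof (intro ballI allI)
    fix j w t assume j: "j \<in> I"
    then have ij: "i \<noteq> j" using insert.hyps by auto
    have le: "\<bar>f ((w(j := t))(i := y)) - f (w(i := y))\<bar> \<le> L * \<bar>t - w j\<bar>" for y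
    proof -
      have "\<bar>f ((w(i := y))(j := t)) - f (w(i := y))\<bar> \<le> L * \<bar>t - (w(i := y)) j\<bar>"
        using insert.prems(2) j unfolding coord_lipschitz_def by blast
      then show ?thesis using ij by (simp add: fun_upd_twist)
    qed
    have eq: "g (w(j := t)) - g w = (\<integral>y. f ((w(j := t))(i := y)) - f (w(i := y)) \<partial>?N i)"
      unfolding g_def by (intro Bochner_Integration.integral_diff[symmetric] one(1))
    show "\<bar>g (w(j := t)) - g w\<bar> \<le> L * \<bar>t - w j\<bar>"
      unfolding eq
      by (intro prob_space.abs_integral_le_bound[OF prob_space_normal_density[OF s[of i]]]
        Bochner_Integration.integrable_diff one(1) le)
  qed
  define m where "m = (\<integral>w. f w \<partial>gauss_prod (insert i I) s)"
  have fint2: "integrable (gauss_prod (insert i I) s) (\<lambda>w. (f w)\<^sup>2)"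
    by (rule G.coord_lipschitz_square_integrable[OF insert.prems])
  have fint: "integrable (gauss_prod (insert i I) s) f"
    by (rule G.square_integrable_imp_integrable[OF _ fint2]) simp
  have gint2: "integrable (gauss_prod I s) (\<lambda>w. (g w)\<^sup>2)"
    by (rule H.coord_lipschitz_square_integrable[OF gm gL])
  have gint: "integrable (gauss_prod I s) g"
    by (rule H.square_integrable_imp_integrable[OF gm gint2])
  have shift_int: "integrable (gauss_prod J s) (\<lambda>w. (h w - m)\<^sup>2)"
    if "integrable (gauss_prod J s) h" "integrable (gauss_prod J s) (\<lambda>w. (h w)\<^sup>2)" "finite J" for h J
  proof -
    interpret gaussian_product J s using that by unfold_locales (auto simp: s)
    have "integrable (gauss_prod J s) (\<lambda>w. (h w)\<^sup>2 - (2 * m * h w - m\<^sup>2))"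
      using that by (intro Bochner_Integration.integrable_diff integrable_mult_right) auto
    then show ?thesis by (simp add: power2_eq_square algebra_simps)
  qed
  have m: "m = (\<integral>x. g x \<partial>gauss_prod I s)"
    unfolding m_def g_def using fint unfolding gauss_prod_def
    by (intro G.P.product_integral_insert insert.hyps)
  have "(\<integral>w. (f w - m)\<^sup>2 \<partial>gauss_prod (insert i I) s) =
      (\<integral>x. (\<integral>y. (f (x(i := y)) - m)\<^sup>2 \<partial>?N i) \<partial>gauss_prod I s)"
    using shift_int[OF fint fint2] insert.hyps unfolding gauss_prod_def
    by (intro G.P.product_integral_insert) auto
  also have "\<dots> \<le> (\<integral>x. L\<^sup>2 * (s i)\<^sup>2 + (g x - m)\<^sup>2 \<partial>gauss_prod I s)"
  proof (rule integral_mono')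
    show "integrable (gauss_prod I s) (\<lambda>x. L\<^sup>2 * (s i)\<^sup>2 + (g x - m)\<^sup>2)"
      by (intro Bochner_Integration.integrable_add shift_int[OF gint gint2] insert.hyps) simp
    show "(\<integral>y. (f (x(i := y)) - m)\<^sup>2 \<partial>?N i) \<le> L\<^sup>2 * (s i)\<^sup>2 + (g x - m)\<^sup>2" for x
      unfolding g_def by (rule one(2))
  qed simp
  also have "\<dots> = L\<^sup>2 * (s i)\<^sup>2 + (\<integral>x. (g x - m)\<^sup>2 \<partial>gauss_prod I s)"
    using shift_int[OF gint gint2] insert.hyps by (simp add: H.prob_space)
  also have "\<dots> \<le> L\<^sup>2 * (s i)\<^sup>2 + L\<^sup>2 * (\<Sum>i\<in>I. (s i)\<^sup>2)"
    unfolding m by (intro add_left_mono insert.IH gm gL)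
  finally show ?case
    using insert.hyps by (simp add: m_def distrib_left)
qed

text \<open>A concentrated random variable that exceeds \<open>a\<close> with probability at least \<open>1/2\<close> has a mean
  above \<open>a - d\<close>.\<close>

lemma gauss_lipschitz_lower_tail:
  assumes s: "\<And>i. 0 < s i" and I: "finite I" and f: "f \<in> borel_measurable (gauss_prod I s)"
    and L: "coord_lipschitz I L f" and d: "0 < d"
    and V: "L\<^sup>2 * (\<Sum>i\<in>I. (s i)\<^sup>2) \<le> V" "V / d\<^sup>2 < 1 / 2"
    and half: "1 / 2 \<le> \<P>(w in gauss_prod I s. a \<le> f w)"
  shows "1 - V / d\<^sup>2 \<le> \<P>(w in gauss_prod I s. a - 2 * d \<le> f w)"
proof -
  interpret gaussian_product I s using I by unfold_locales (auto simp: s)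
  note [measurable] = f
  let ?m = "expectation f"
  let ?D = "{w \<in> space (gauss_prod I s). d \<le> \<bar>f w - ?m\<bar>}"
  have f2: "integrable (gauss_prod I s) (\<lambda>w. (f w)\<^sup>2)"
    by (rule coord_lipschitz_square_integrable[OF f L])
  have f1: "integrable (gauss_prod I s) f"
    by (rule square_integrable_imp_integrable[OF f f2])
  have "integrable (gauss_prod I s) (\<lambda>w. (f w)\<^sup>2 - (2 * ?m * f w - ?m\<^sup>2))"
    using f1 f2 by (intro Bochner_Integration.integrable_diff integrable_mult_right) auto
  then have int: "integrable (gauss_prod I s) (\<lambda>w. (f w - ?m)\<^sup>2)"
    by (simp add: power2_eq_square algebra_simps)
  have "prob ?D \<le> (\<integral>w. (f w - ?m)\<^sup>2 \<partial>gauss_prod I s) / d\<^sup>2"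
    by (rule second_moment_method[OF _ int d]) simp
  also have "\<dots> \<le> V / d\<^sup>2"
    using gauss_lipschitz_variance[OF s I f L] V(1) by (intro divide_right_mono) auto
  finally have D: "prob ?D \<le> V / d\<^sup>2" .
  \<comment> \<open>An event of probability at least 1 / 2 cannot lie inside the deviation event,
    and a single point outside already locates the mean.\<close>
  have "\<exists>w\<in>space (gauss_prod I s). a \<le> f w \<and> \<bar>f w - ?m\<bar> < d"
  proof (rule ccontr)
    assume "\<not> ?thesis"
    then have "{w \<in> space (gauss_prod I s). a \<le> f w} \<subseteq> ?D" by (auto simp: not_less)
    then have "\<P>(w in gauss_prod I s. a \<le> f w) \<le> prob ?D"
      by (intro finite_measure_mono) auto
    then show False using half D V(2) by linarith
  qed
  then have m: "a - d < ?m" by force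
  have "1 - V / d\<^sup>2 \<le> 1 - prob ?D" using D by simp
  also have "\<dots> = prob (space (gauss_prod I s) - ?D)" by (subst prob_compl) auto
  also have "\<dots> \<le> \<P>(w in gauss_prod I s. a - 2 * d \<le> f w)"
    using m by (intro finite_measure_mono) auto
  finally show ?thesis .
qed

section \<open>The test matrix\<close>

text \<open>The feasible matrix is the Gram matrix of rows of norm at most 1, plus the diagonal
  \<delta> that restores the entries 1. As 0 \<le> \<delta> \<le> 1, the correction changes the
  objective by at most the absolute sum of the diagonal of M, which is of lower order than n for the
  matrices at hand.\<close>

lemma SDP_ge_columns:
  fixes t :: "'a \<Rightarrow> nat \<Rightarrow> real"
  assumes M: "M \<in> carrier_mat n n" and A: "finite A"
    and t: "\<And>i. i < n \<Longrightarrow> (\<Sum>a\<in>A. (t a i)\<^sup>2) \<le> 1"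
  shows "(\<Sum>a\<in>A. bilin n (\<lambda>i j. M $$ (i, j)) (t a) (t a)) - (\<Sum>i<n. \<bar>M $$ (i, i)\<bar>) \<le> SDP M"
proof -
  define \<delta> where "\<delta> = (\<lambda>i. 1 - (\<Sum>a\<in>A. (t a i)\<^sup>2))"
  define X where "X = Matrix.mat n n (\<lambda>(i, j). (\<Sum>a\<in>A. t a i * t a j) + (if i = j then \<delta> i else 0))"
  have Xc: "X \<in> carrier_mat n n" by (simp add: X_def)
  have diag_sum: "(\<Sum>i<n. \<Sum>j<n. if i = j then g i j else 0) = (\<Sum>i<n. g i i)" for g :: "nat \<Rightarrow> nat \<Rightarrow> real"
    by (intro sum.cong refl) simp
  have "0 \<le> v \<bullet> (X *\<^sub>v v)" if v: "v \<in> carrier_vec n" for v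
  proof -
    have "v \<bullet> (X *\<^sub>v v) = (\<Sum>i<n. \<Sum>j<n. (\<Sum>a\<in>A. (v $ i * t a i) * (v $ j * t a j)) +
        (if i = j then \<delta> i * (v $ i * v $ j) else 0))"
      unfolding quadratic_form_eq[OF Xc v]
      by (intro sum.cong refl) (auto simp: X_def algebra_simps sum_distrib_left sum_distrib_right)
    also have "\<dots> = (\<Sum>i<n. \<Sum>j<n. \<Sum>a\<in>A. (v $ i * t a i) * (v $ j * t a j)) + (\<Sum>i<n. \<delta> i * (v $ i * v $ i))"
      by (simp only: sum.distrib diag_sum)
    also have "(\<Sum>i<n. \<Sum>j<n. \<Sum>a\<in>A. (v $ i * t a i) * (v $ j * t a j)) =
        (\<Sum>a\<in>A. \<Sum>i<n. \<Sum>j<n. (v $ i * t a i) * (v $ j * t a j))"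
      by (simp only: sum.swap[of _ A])
    also have "\<dots> = (\<Sum>a\<in>A. (\<Sum>i<n. v $ i * t a i)\<^sup>2)"
      by (simp add: power2_eq_square sum_product)
    also have "\<dots> + (\<Sum>i<n. \<delta> i * (v $ i * v $ i)) \<ge> 0"
      using t by (intro add_nonneg_nonneg sum_nonneg mult_nonneg_nonneg[OF _ zero_le_square]) (auto simp: \<delta>_def)
    finally show ?thesis .
  qed
  moreover have "transpose_mat X = X"
    by (intro eq_matI) (auto simp: X_def mult.commute)
  moreover have "X $$ (i, i) = 1" if "i < n" for i
    using that by (simp add: X_def \<delta>_def power2_eq_square)
  ultimately have "X \<in> elliptope n"
    using Xc by (auto simp: elliptope_def positive_semidefinite_def)
  then have "mat_trace (M * X) \<le> SDP M" using SDP_attained[OF M] by auto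
  moreover have "mat_trace (M * X) = (\<Sum>a\<in>A. bilin n (\<lambda>i j. M $$ (i, j)) (t a) (t a)) + (\<Sum>i<n. M $$ (i, i) * \<delta> i)"
  proof -
    have "mat_trace (M * X) = (\<Sum>i<n. \<Sum>j<n. (\<Sum>a\<in>A. M $$ (i, j) * (t a i * t a j)) +
        (if i = j then M $$ (i, j) * \<delta> i else 0))"
      unfolding mat_trace_mult[OF M Xc]
      by (intro sum.cong refl) (auto simp: X_def algebra_simps sum_distrib_left)
    also have "\<dots> = (\<Sum>i<n. \<Sum>j<n. \<Sum>a\<in>A. M $$ (i, j) * (t a i * t a j)) + (\<Sum>i<n. M $$ (i, i) * \<delta> i)"
      by (simp only: sum.distrib diag_sum)
    also have "(\<Sum>i<n. \<Sum>j<n. \<Sum>a\<in>A. M $$ (i, j) * (t a i * t a j)) =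
        (\<Sum>a\<in>A. \<Sum>i<n. \<Sum>j<n. M $$ (i, j) * (t a i * t a j))"
      by (simp only: sum.swap[of _ A])
    finally show ?thesis by (simp add: bilin_def)
  qed
  moreover have "- (\<Sum>i<n. \<bar>M $$ (i, i)\<bar>) \<le> (\<Sum>i<n. M $$ (i, i) * \<delta> i)"
    unfolding sum_negf[symmetric]
  proof (intro sum_mono)
    fix i assume "i \<in> {..<n}"
    then have "0 \<le> \<delta> i" "\<delta> i \<le> 1" using t by (auto simp: \<delta>_def sum_nonneg)
    then have "\<bar>M $$ (i, i)\<bar> * \<delta> i \<le> \<bar>M $$ (i, i)\<bar> * 1" by (intro mult_left_mono) auto
    moreover have "- (M $$ (i, i) * \<delta> i) \<le> \<bar>M $$ (i, i)\<bar> * \<delta> i"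
      using \<open>0 \<le> \<delta> i\<close> abs_ge_minus_self[of "M $$ (i, i) * \<delta> i"] by (simp add: abs_mult)
    ultimately show "- \<bar>M $$ (i, i)\<bar> \<le> M $$ (i, i) * \<delta> i" by linarith
  qed
  ultimately show ?thesis by linarith
qed

lemma bilin_rows: "bilin n B (\<lambda>i. c i * x i) y = (\<Sum>i<n. c i * (x i * (\<Sum>j<n. B i j * y j)))"
  by (simp add: bilin_def sum_distrib_left mult_ac)

lemma bilin_sym:
  assumes "\<And>i j. B i j = B j i"
  shows "bilin n B x y = bilin n B y x"
  unfolding bilin_def
  by (subst sum.swap, intro sum.cong refl, subst assms) (simp add: mult_ac)

text \<open>Expand the form at t - a t. The part linear in \<open>a\<close> is kept exactly, row by
  row; the quadratic part is bounded through \<open>low\<close>. This is how the lower bound on the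
  spectrum enters.\<close>

lemma scaled_columns_bound:
  fixes t :: "'a \<Rightarrow> nat \<Rightarrow> real"
  assumes sym: "\<And>i j. B i j = B j i" and A: "finite A"
    and low: "\<And>x. - (C * inner_n n x x) \<le> bilin n B x x"
  shows "(\<Sum>i<n. (1 - 2 * a i) * (\<Sum>b\<in>A. t b i * (\<Sum>j<n. B i j * t b j)) - C * ((a i)\<^sup>2 * (\<Sum>b\<in>A. (t b i)\<^sup>2)))
    \<le> (\<Sum>b\<in>A. bilin n B (\<lambda>i. (1 - a i) * t b i) (\<lambda>i. (1 - a i) * t b i))"
proof -
  have "(\<Sum>i<n. (1 - 2 * a i) * (t b i * (\<Sum>j<n. B i j * t b j)) - C * ((a i)\<^sup>2 * (t b i)\<^sup>2))
      \<le> bilin n B (\<lambda>i. (1 - a i) * t b i) (\<lambda>i. (1 - a i) * t b i)" for b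
  proof -
    let ?e = "\<lambda>i. a i * t b i"
    have eq: "(\<lambda>i. (1 - a i) * t b i) = (\<lambda>i. t b i - ?e i)" by (simp add: algebra_simps)
    have "bilin n B (\<lambda>i. t b i - ?e i) (\<lambda>i. t b i - ?e i) =
        bilin n B (t b) (t b) - 2 * bilin n B ?e (t b) + bilin n B ?e ?e"
      unfolding bilin_diff_left bilin_diff_right using bilin_sym[where x = "t b" and y = ?e and n = n, OF sym] by simp
    also have "\<dots> \<ge> bilin n B (t b) (t b) - 2 * bilin n B ?e (t b) - C * inner_n n ?e ?e"
      using low[of ?e] by simp
    also have "bilin n B (t b) (t b) = (\<Sum>i<n. t b i * (\<Sum>j<n. B i j * t b j))"
      using bilin_rows[of n B "\<lambda>_. 1" "t b" "t b"] by simp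
    finally have F: "(\<Sum>i<n. t b i * (\<Sum>j<n. B i j * t b j)) - 2 * bilin n B ?e (t b) - C * inner_n n ?e ?e
        \<le> bilin n B (\<lambda>i. t b i - ?e i) (\<lambda>i. t b i - ?e i)" .
    have E: "(\<Sum>i<n. t b i * r i) - 2 * (\<Sum>i<n. a i * (t b i * r i)) - C * inner_n n ?e ?e =
        (\<Sum>i<n. (1 - 2 * a i) * (t b i * r i) - C * ((a i)\<^sup>2 * (t b i)\<^sup>2))" for r
      unfolding inner_n_def sum_distrib_left sum_subtractf[symmetric]
      by (intro sum.cong refl) (simp add: power2_eq_square algebra_simps)
    show ?thesis
      using F unfolding eq bilin_rows E .
  qed
  then have "(\<Sum>b\<in>A. \<Sum>i<n. (1 - 2 * a i) * (t b i * (\<Sum>j<n. B i j * t b j)) - C * ((a i)\<^sup>2 * (t b i)\<^sup>2))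
      \<le> (\<Sum>b\<in>A. bilin n B (\<lambda>i. (1 - a i) * t b i) (\<lambda>i. (1 - a i) * t b i))"
    by (rule sum_mono)
  then show ?thesis
    by (subst (asm) sum.swap) (simp add: sum_subtractf sum_distrib_left)
qed

text \<open>With s the square root of max 1 \<rho>, the first-order bound is 2 (1 - 1 / s) \<le> s^2
  - 1. It is sharp as \<rho> decreases to 1, and the threshold for \<lambda> depends on this
  constant; the quadratic bound feeds error terms.\<close>

lemma sqrt_truncation:
  fixes \<rho> :: real
  assumes "0 \<le> \<rho>"
  defines "a \<equiv> 1 - 1 / sqrt (max 1 \<rho>)"
  shows "0 \<le> a" "a \<le> 1" "2 * a \<le> max 0 (\<rho> - 1)" "a\<^sup>2 * \<rho> \<le> (max 0 (\<rho> - 1))\<^sup>2" "(1 - a)\<^sup>2 * \<rho> \<le> 1"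
proof -
  define s where "s = sqrt (max 1 \<rho>)"
  have s: "1 \<le> s" "s\<^sup>2 = max 1 \<rho>" by (auto simp: s_def)
  have a: "a = 1 - 1 / s" by (simp add: a_def s_def)
  show 0: "0 \<le> a" "a \<le> 1" using s by (auto simp: a)
  have "2 * (1 - 1 / s) \<le> s\<^sup>2 - 1"
  proof -
    have "0 \<le> (s - 1) * (s * (s + 1) - 2)"
    proof (intro mult_nonneg_nonneg)
      have "1 * (1 + 1) \<le> s * (s + 1)" using s by (intro mult_mono) auto
      then show "0 \<le> s * (s + 1) - 2" by simp
    qed (use s in auto)
    then show ?thesis using s by (simp add: field_simps power2_eq_square)
  qed
  then show "2 * a \<le> max 0 (\<rho> - 1)" using s by (auto simp: a max_def split: if_splits)
  show "(1 - a)\<^sup>2 * \<rho> \<le> 1"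
  proof -
    have "\<rho> \<le> s\<^sup>2" using s by simp
    then show ?thesis using s by (simp add: a power_divide divide_le_eq)
  qed
  show "a\<^sup>2 * \<rho> \<le> (max 0 (\<rho> - 1))\<^sup>2"
  proof (cases "\<rho> \<le> 1")
    case True
    then have "s = 1" by (simp add: s_def max_def)
    then show ?thesis by (simp add: a)
  next
    case False
    then have s2: "\<rho> = s\<^sup>2" using s by simp
    have "a * s = s - 1" using s by (simp add: a field_simps)
    then have "a\<^sup>2 * \<rho> = (s - 1)\<^sup>2" unfolding s2 by (metis power_mult_distrib)
    also have "\<dots> \<le> (s\<^sup>2 - 1)\<^sup>2"
    proof (intro power_mono)
      have "s * 1 \<le> s * s" using s by (intro mult_left_mono) auto
      then show "s - 1 \<le> s\<^sup>2 - 1" by (simp add: power2_eq_square)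
    qed (use s in auto)
    finally show ?thesis using False by (simp add: s2)
  qed
qed

text \<open>Here \<rho> is the squared norm of a row and \<kappa> + y + u + e \<phi> \<zeta> its
  energy, with z, y, u the deviations. Since 2 a \<le> |z| + e \<phi>^2, scaling costs \<kappa> e
  \<phi>^2 to first order. The constant 53 is 26 * 2 from the spectral term plus 1 from the product
  of \<open>a\<close> with e \<phi> \<zeta>; likewise 54 is 26 * 2 + 2.\<close>

lemma row_estimate:
  fixes \<rho> \<kappa> y u z e \<phi> \<zeta> :: real
  assumes \<rho>: "0 \<le> \<rho>" "\<rho> = 1 + z + e * \<phi>\<^sup>2" and e: "0 \<le> e" and \<kappa>: "0 \<le> \<kappa>" "\<kappa> \<le> 2"
  defines "a \<equiv> 1 - 1 / sqrt (max 1 \<rho>)"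
  shows "\<kappa> + e * (\<phi> * \<zeta> - \<kappa> * \<phi>\<^sup>2) - (3 * \<bar>y\<bar> + 3 * \<bar>u\<bar> + 2 * \<bar>z\<bar> + 53 * z\<^sup>2) - 54 * (e\<^sup>2 * (\<phi> ^ 4 + \<zeta> ^ 4))
    \<le> (1 - 2 * a) * (\<kappa> + y + u + e * (\<phi> * \<zeta>)) - 26 * (a\<^sup>2 * \<rho>)"
proof -
  note tr = sqrt_truncation[OF \<rho>(1), folded a_def]
  have ep: "0 \<le> e * \<phi>\<^sup>2" using e by simp
  have le: "max 0 (\<rho> - 1) \<le> \<bar>z\<bar> + e * \<phi>\<^sup>2" using \<rho>(2) ep by linarith
  have a2: "2 * a \<le> \<bar>z\<bar> + e * \<phi>\<^sup>2" using tr(3) le by linarith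
  have "a\<^sup>2 * \<rho> \<le> (\<bar>z\<bar> + e * \<phi>\<^sup>2)\<^sup>2"
    using tr(4) power_mono[OF le, of 2] by simp
  also have "\<dots> \<le> 2 * \<bar>z\<bar>\<^sup>2 + 2 * (e * \<phi>\<^sup>2)\<^sup>2"
    using sum_squares_bound[of "\<bar>z\<bar>" "e * \<phi>\<^sup>2"] by (simp add: power2_sum)
  also have "\<dots> = 2 * z\<^sup>2 + 2 * (e\<^sup>2 * \<phi> ^ 4)" by (simp add: power_mult_distrib)
  finally have A: "a\<^sup>2 * \<rho> \<le> 2 * z\<^sup>2 + 2 * (e\<^sup>2 * \<phi> ^ 4)" .
  have B: "2 * a * \<kappa> \<le> 2 * \<bar>z\<bar> + e * (\<kappa> * \<phi>\<^sup>2)"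
  proof -
    have "2 * a * \<kappa> \<le> (\<bar>z\<bar> + e * \<phi>\<^sup>2) * \<kappa>" using a2 \<kappa> by (intro mult_right_mono)
    moreover have "\<bar>z\<bar> * \<kappa> \<le> \<bar>z\<bar> * 2" using \<kappa> by (intro mult_left_mono) auto
    ultimately show ?thesis by (simp add: algebra_simps)
  qed
  have lin: "- (3 * \<bar>x\<bar>) \<le> (1 - 2 * a) * x" for x
  proof -
    have "\<bar>(1 - 2 * a) * x\<bar> \<le> 1 * \<bar>x\<bar>" unfolding abs_mult using tr by (intro mult_right_mono) auto
    then show ?thesis by linarith
  qed
  have E: "2 * a * (e * (\<phi> * \<zeta>)) \<le> z\<^sup>2 + 2 * (e\<^sup>2 * (\<phi> ^ 4 + \<zeta> ^ 4))"
  proof -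
    have "2 * a * (e * (\<phi> * \<zeta>)) \<le> 2 * a * (e * \<bar>\<phi> * \<zeta>\<bar>)"
      using tr e by (intro mult_left_mono) auto
    also have "\<dots> \<le> (\<bar>z\<bar> + e * \<phi>\<^sup>2) * (e * \<bar>\<phi> * \<zeta>\<bar>)"
      using a2 e by (intro mult_right_mono) auto
    also have "\<dots> = \<bar>z\<bar> * (e * \<bar>\<phi> * \<zeta>\<bar>) + e\<^sup>2 * (\<phi>\<^sup>2 * \<bar>\<phi> * \<zeta>\<bar>)"
      by (simp add: algebra_simps power2_eq_square)
    also have "\<dots> \<le> (z\<^sup>2 + e\<^sup>2 * (\<phi>\<^sup>2 * \<zeta>\<^sup>2)) + e\<^sup>2 * (\<phi> ^ 4 + \<phi>\<^sup>2 * \<zeta>\<^sup>2)"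
    proof (intro add_mono mult_left_mono)
      have "2 * \<bar>z\<bar> * (e * \<bar>\<phi> * \<zeta>\<bar>) \<le> \<bar>z\<bar>\<^sup>2 + (e * \<bar>\<phi> * \<zeta>\<bar>)\<^sup>2" by (rule sum_squares_bound)
      moreover have "(e * \<bar>\<phi> * \<zeta>\<bar>)\<^sup>2 = e\<^sup>2 * (\<phi>\<^sup>2 * \<zeta>\<^sup>2)" by (simp add: power_mult_distrib)
      moreover have "0 \<le> \<bar>z\<bar> * (e * \<bar>\<phi> * \<zeta>\<bar>)" using e by simp
      ultimately show "\<bar>z\<bar> * (e * \<bar>\<phi> * \<zeta>\<bar>) \<le> z\<^sup>2 + e\<^sup>2 * (\<phi>\<^sup>2 * \<zeta>\<^sup>2)" by simp
      have "2 * \<phi>\<^sup>2 * \<bar>\<phi> * \<zeta>\<bar> \<le> (\<phi>\<^sup>2)\<^sup>2 + \<bar>\<phi> * \<zeta>\<bar>\<^sup>2" by (rule sum_squares_bound)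
      moreover have "\<bar>\<phi> * \<zeta>\<bar>\<^sup>2 = \<phi>\<^sup>2 * \<zeta>\<^sup>2" "(\<phi>\<^sup>2)\<^sup>2 = \<phi> ^ 4" by (simp_all add: power_mult_distrib)
      moreover have "0 \<le> \<phi>\<^sup>2 * \<bar>\<phi> * \<zeta>\<bar>" by simp
      ultimately show "\<phi>\<^sup>2 * \<bar>\<phi> * \<zeta>\<bar> \<le> \<phi> ^ 4 + \<phi>\<^sup>2 * \<zeta>\<^sup>2"
        unfolding mult.assoc by linarith
    qed simp
    also have "\<dots> = z\<^sup>2 + e\<^sup>2 * (\<phi> ^ 4 + 2 * (\<phi>\<^sup>2 * \<zeta>\<^sup>2))" by (simp add: algebra_simps)
    also have "\<dots> \<le> z\<^sup>2 + e\<^sup>2 * (2 * (\<phi> ^ 4 + \<zeta> ^ 4))"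
    proof (intro add_left_mono mult_left_mono)
      have "2 * (\<phi>\<^sup>2 * \<zeta>\<^sup>2) \<le> \<phi> ^ 4 + \<zeta> ^ 4"
        using sum_squares_bound[of "\<phi>\<^sup>2" "\<zeta>\<^sup>2"] by (simp add: mult.assoc)
      moreover have "0 \<le> \<zeta> ^ 4" by simp
      have gen: "x + w \<le> 2 * (x + y)" if "w \<le> x + y" "0 \<le> y" for x y w :: real
        using that unfolding distrib_left by linarith
      with \<open>2 * (\<phi>\<^sup>2 * \<zeta>\<^sup>2) \<le> \<phi> ^ 4 + \<zeta> ^ 4\<close> \<open>0 \<le> \<zeta> ^ 4\<close>
      show "\<phi> ^ 4 + 2 * (\<phi>\<^sup>2 * \<zeta>\<^sup>2) \<le> 2 * (\<phi> ^ 4 + \<zeta> ^ 4)"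
        by (intro gen)
    qed simp
    finally show ?thesis by (simp add: algebra_simps)
  qed
  have F: "0 \<le> e\<^sup>2 * \<zeta> ^ 4" by simp
  have "(1 - 2 * a) * (\<kappa> + y + u + e * (\<phi> * \<zeta>)) - 26 * (a\<^sup>2 * \<rho>) =
      \<kappa> + e * (\<phi> * \<zeta>) - 2 * a * \<kappa> + (1 - 2 * a) * y + (1 - 2 * a) * u - 2 * a * (e * (\<phi> * \<zeta>)) - 26 * (a\<^sup>2 * \<rho>)"
    by (simp add: algebra_simps)
  moreover have "e * (\<phi> * \<zeta> - \<kappa> * \<phi>\<^sup>2) = e * (\<phi> * \<zeta>) - e * (\<kappa> * \<phi>\<^sup>2)"
    "e\<^sup>2 * (\<phi> ^ 4 + \<zeta> ^ 4) = e\<^sup>2 * \<phi> ^ 4 + e\<^sup>2 * \<zeta> ^ 4"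
    by (simp_all add: algebra_simps)
  ultimately show ?thesis
    using A B E F lin[of y] lin[of u] by linarith
qed

section \<open>The energy of the test matrix in terms of quadratic forms\<close>

lemma poly_form_commute:
  assumes "\<And>i j. W i j = W j i"
  shows "poly_form n W x P y = poly_form n W y P x"
  unfolding poly_form_def using pow_form_commute[of W n x _ y, OF assms] by simp

text \<open>Completeness of the unit vectors together with the symmetry of W. It turns the sums over
  the n columns p(W) e_a into single quadratic forms.\<close>

lemma poly_form_sum_units:
  assumes sym: "\<And>i j. W i j = W j i"
  shows "(\<Sum>a<n. poly_form n W (unit_fun a) P x * poly_form n W (unit_fun a) Q y) = poly_form n W x (P * Q) y"
proof -
  have "(\<Sum>a<n. poly_form n W (unit_fun a) P x * poly_form n W (unit_fun a) Q y) =
     (\<Sum>a<n. \<Sum>k\<le>degree P. \<Sum>l\<le>degree Q. coeff P k * coeff Q l * (pow_app n W k x a * pow_app n W l y a))"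
    unfolding poly_form_def lin_poly_def
    by (intro sum.cong refl) (simp add: sum_product pow_form_unit mult_ac)
  also have "\<dots> = (\<Sum>k\<le>degree P. \<Sum>l\<le>degree Q. \<Sum>a<n. coeff P k * coeff Q l * (pow_app n W k x a * pow_app n W l y a))"
    by (simp only: sum.swap[of _ _ "{..<n}"])
  also have "\<dots> = (\<Sum>k\<le>degree P. \<Sum>l\<le>degree Q. coeff P k * coeff Q l * pow_form n W x (k + l) y)"
    unfolding inner_pow_app_pow_app[OF sym, symmetric] inner_n_def sum_distrib_left ..
  finally show ?thesis by (simp add: poly_form_def lin_poly_mult)
qed

lemma poly_form_inner: "(\<Sum>j<n. v j * poly_form n W (unit_fun j) P y) = poly_form n W v P y"
proof -
  have "(\<Sum>j<n. v j * poly_form n W (unit_fun j) P y) =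
      lin_poly (\<lambda>k. \<Sum>j<n. v j * pow_form n W (unit_fun j) k y) P"
    unfolding poly_form_def lin_poly_linear ..
  also have "\<dots> = poly_form n W v P y"
    unfolding poly_form_def
    by (simp add: pow_form_unit) (simp add: pow_form_def inner_n_def)
  finally show ?thesis .
qed

lemma poly_form_apply:
  assumes "i < n"
  shows "(\<Sum>j<n. W i j * poly_form n W (unit_fun j) P y) = poly_form n W (unit_fun i) (pCons 0 P) y"
proof -
  have "(\<Sum>j<n. W i j * poly_form n W (unit_fun j) P y) =
      lin_poly (\<lambda>k. \<Sum>j<n. W i j * pow_form n W (unit_fun j) k y) P"
    unfolding poly_form_def lin_poly_linear ..
  also have "\<dots> = poly_form n W (unit_fun i) (pCons 0 P) y"
    using assms by (simp add: poly_form_def lin_poly_pCons pow_form_unit)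
  finally show ?thesis .
qed

text \<open>The square is linearized by \<alpha>^2 \<ge> 2 \<alpha> - 1, so that first-moment bounds
  on the deviations of the three spike forms are enough.\<close>

lemma gain_estimate:
  fixes lam \<kappa> \<alpha> \<beta> \<gamma> \<beta>0 \<gamma>0 :: real
  assumes "0 \<le> lam" "0 \<le> \<gamma>" "\<kappa> \<le> 2"
  shows "lam + \<beta>0 - 2 * \<gamma>0 - (2 * lam * \<bar>\<alpha> - 1\<bar> + \<bar>\<beta> - \<beta>0\<bar> + 2 * \<bar>\<gamma> - \<gamma>0\<bar>) \<le> lam * \<alpha>\<^sup>2 + \<beta> - \<kappa> * \<gamma>"
proof -
  have \<alpha>: "\<alpha>\<^sup>2 = (\<alpha> - 1)\<^sup>2 + 2 * \<alpha> - 1" by (simp add: power2_eq_square algebra_simps)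
  have gen: "1 - 2 * b \<le> x" if "x = s + 2 * a - 1" "1 - a \<le> b" "0 \<le> s" for x s a b :: real
    using that by linarith
  have "1 - 2 * \<bar>\<alpha> - 1\<bar> \<le> \<alpha>\<^sup>2" by (rule gen[OF \<alpha>]) auto
  then have "lam * (1 - 2 * \<bar>\<alpha> - 1\<bar>) \<le> lam * \<alpha>\<^sup>2" using assms by (intro mult_left_mono)
  then have "lam - 2 * lam * \<bar>\<alpha> - 1\<bar> \<le> lam * \<alpha>\<^sup>2" by (simp add: algebra_simps)
  moreover have "\<kappa> * \<gamma> \<le> 2 * \<gamma>" using assms by (intro mult_right_mono)
  moreover have "\<beta>0 - \<beta> \<le> \<bar>\<beta> - \<beta>0\<bar>" "\<gamma> - \<gamma>0 \<le> \<bar>\<gamma> - \<gamma>0\<bar>" by simp_all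
  moreover have "l + b0 - 2 * c0 - (x + b' + 2 * c') \<le> y + b - k"
    if "l - x \<le> y" "k \<le> 2 * c" "b0 - b \<le> b'" "c - c0 \<le> c'" for l b0 c0 x b' c' y b k c :: real
    using that by linarith
  ultimately show ?thesis by blast
qed

text \<open>In the energy of the test matrix, \<open>row_error\<close> and \<open>spike_error\<close> collect
  the deviations of the quadratic forms from their limits, and \<open>quartic_error\<close> the terms of second
  order in the weight \<open>e\<close> of the spike column.\<close>

definition row_error :: "nat \<Rightarrow> real \<Rightarrow> (nat \<Rightarrow> real) \<Rightarrow> real poly \<Rightarrow> real \<Rightarrow> (nat \<Rightarrow> nat \<Rightarrow> real) \<Rightarrow> nat \<Rightarrow> real" where
  "row_error n lam v p \<kappa> W i =
     3 * \<bar>poly_form n W (unit_fun i) (pCons 0 (p * p)) (unit_fun i) - \<kappa>\<bar>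
     + 3 * \<bar>lam * (v i * poly_form n W (unit_fun i) (p * p) v)\<bar>
     + 2 * \<bar>poly_form n W (unit_fun i) (p * p) (unit_fun i) - 1\<bar>
     + 53 * (poly_form n W (unit_fun i) (p * p) (unit_fun i) - 1)\<^sup>2
     + \<bar>W i i\<bar>"

definition quartic_error :: "nat \<Rightarrow> real \<Rightarrow> (nat \<Rightarrow> real) \<Rightarrow> real poly \<Rightarrow> (nat \<Rightarrow> nat \<Rightarrow> real) \<Rightarrow> nat \<Rightarrow> real" where
  "quartic_error n lam v q W i = (sqrt n * poly_form n W (unit_fun i) q v) ^ 4
     + (sqrt n * (poly_form n W (unit_fun i) (pCons 0 q) v + lam * (v i * poly_form n W v q v))) ^ 4"

definition spike_error :: "nat \<Rightarrow> real \<Rightarrow> (nat \<Rightarrow> real) \<Rightarrow> real poly \<Rightarrow> (nat \<Rightarrow> nat \<Rightarrow> real) \<Rightarrow> real" where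
  "spike_error n lam v q W = 2 * lam * \<bar>poly_form n W v q v - 1\<bar>
     + \<bar>poly_form n W v (pCons 0 (q * q)) v - semicircle (pCons 0 (q * q))\<bar>
     + 2 * \<bar>poly_form n W v (q * q) v - semicircle (q * q)\<bar>"

text \<open>A deterministic statement for a symmetric W whose form is bounded below. All
  computations take place with \<lambda> v v^T + W, whose rows are explicit; M enters only through
  domination as a form and through its diagonal.\<close>

lemma SDP_lower_bound:
  fixes n :: nat and lam e b \<kappa> :: real and p q :: "real poly" and v :: "nat \<Rightarrow> real"
  assumes M: "M \<in> carrier_mat n n" and sym: "\<And>i j. W i j = W j i"
    and dom: "\<And>x. lam * (inner_n n v x)\<^sup>2 + bilin n W x x \<le> bilin n (\<lambda>i j. M $$ (i, j)) x x"
    and low: "\<And>x. - (26 * inner_n n x x) \<le> bilin n W x x"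
    and diag: "\<And>i. i < n \<Longrightarrow> \<bar>M $$ (i, i)\<bar> \<le> \<bar>W i i\<bar> + b"
    and lam: "0 \<le> lam" and e: "0 \<le> e" and \<kappa>: "0 \<le> \<kappa>" "\<kappa> \<le> 2"
  shows "n * (\<kappa> + e * (lam + semicircle (pCons 0 (q * q)) - 2 * semicircle (q * q) - spike_error n lam v q W))
     - (\<Sum>i<n. row_error n lam v p \<kappa> W i) - 54 * (e\<^sup>2 * (\<Sum>i<n. quartic_error n lam v q W i)) - n * b \<le> SDP M"
proof -
  define z where "z = (\<lambda>i. poly_form n W (unit_fun i) (p * p) (unit_fun i) - 1)"
  define y where "y = (\<lambda>i. poly_form n W (unit_fun i) (pCons 0 (p * p)) (unit_fun i) - \<kappa>)"
  define u where "u = (\<lambda>i. lam * (v i * poly_form n W (unit_fun i) (p * p) v))"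
  define \<phi> where "\<phi> = (\<lambda>i. sqrt n * poly_form n W (unit_fun i) q v)"
  \<comment> \<open>The vector B \<phi> for the matrix B defined next; see
    \<open>Bt\<close>.\<close>
  define \<zeta> where "\<zeta> = (\<lambda>i. sqrt n * (poly_form n W (unit_fun i) (pCons 0 q) v + lam * (v i * poly_form n W v q v)))"
  define B where "B = (\<lambda>i j. lam * (v i * v j) + W i j)"
  \<comment> \<open>The indices below \<open>n\<close> are the columns of p(W), and index
    \<open>n\<close> is the spike column with weight e.\<close>
  define t where "t = (\<lambda>a i. if a < n then poly_form n W (unit_fun a) p (unit_fun i) else sqrt e * \<phi> i)"
  define \<rho> where "\<rho> = (\<lambda>i. \<Sum>a<Suc n. (t a i)\<^sup>2)"
  define a where "a = (\<lambda>i. 1 - 1 / sqrt (max 1 (\<rho> i)))"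
  have Bsym: "B i j = B j i" for i j using sym by (simp add: B_def mult_ac)
  have Bform: "bilin n B x x = lam * (inner_n n v x)\<^sup>2 + bilin n W x x" for x
  proof -
    have "bilin n B x x = (\<Sum>i<n. \<Sum>j<n. lam * ((v i * x i) * (v j * x j)) + W i j * (x i * x j))"
      unfolding bilin_def by (intro sum.cong refl) (simp add: B_def algebra_simps)
    also have "\<dots> = lam * (inner_n n v x)\<^sup>2 + bilin n W x x"
    proof -
      have "(inner_n n v x)\<^sup>2 = (\<Sum>i<n. \<Sum>j<n. (v i * x i) * (v j * x j))"
        by (simp add: inner_n_def power2_eq_square sum_product)
      then show ?thesis by (simp only: sum.distrib bilin_def sum_distrib_left)
    qed
    finally show ?thesis .
  qed
  have \<rho>: "\<rho> i = 1 + z i + e * (\<phi> i)\<^sup>2" if "i < n" for i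
  proof -
    have "(\<Sum>a<n. (t a i)\<^sup>2) = poly_form n W (unit_fun i) (p * p) (unit_fun i)"
      unfolding poly_form_sum_units[OF sym, symmetric] by (simp add: t_def power2_eq_square)
    then show ?thesis using e by (simp add: \<rho>_def z_def t_def power_mult_distrib)
  qed
  have \<rho>0: "0 \<le> \<rho> i" for i by (simp add: \<rho>_def sum_nonneg)
  have Bt: "(\<Sum>j<n. B i j * poly_form n W (unit_fun j) P x) =
      poly_form n W (unit_fun i) (pCons 0 P) x + lam * (v i * poly_form n W v P x)" if "i < n" for i P x
  proof -
    have "(\<Sum>j<n. B i j * poly_form n W (unit_fun j) P x) =
        lam * (v i * (\<Sum>j<n. v j * poly_form n W (unit_fun j) P x)) + (\<Sum>j<n. W i j * poly_form n W (unit_fun j) P x)"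
      unfolding B_def distrib_right sum.distrib sum_distrib_left by (simp add: mult_ac)
    also have "\<dots> = lam * (v i * poly_form n W v P x) + poly_form n W (unit_fun i) (pCons 0 P) x"
      by (simp only: poly_form_inner[where v = v] poly_form_apply[OF that])
    finally show ?thesis by simp
  qed
  have R: "(\<Sum>b<Suc n. t b i * (\<Sum>j<n. B i j * t b j)) = \<kappa> + y i + u i + e * (\<phi> i * \<zeta> i)" if i: "i < n" for i
  proof -
    have "(\<Sum>b<n. t b i * (\<Sum>j<n. B i j * t b j)) =
        (\<Sum>b<n. poly_form n W (unit_fun b) p (unit_fun i) *
          (poly_form n W (unit_fun b) (pCons 0 p) (unit_fun i) + lam * (v i * poly_form n W (unit_fun b) p v)))"
    proof (intro sum.cong refl)
      fix b assume b: "b \<in> {..<n}"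
      have "(\<Sum>j<n. B i j * t b j) = (\<Sum>j<n. B i j * poly_form n W (unit_fun j) p (unit_fun b))"
        using b by (intro sum.cong refl) (simp add: t_def poly_form_commute[where n = n and x = "unit_fun b", OF sym])
      also have "\<dots> = poly_form n W (unit_fun i) (pCons 0 p) (unit_fun b) + lam * (v i * poly_form n W v p (unit_fun b))"
        by (rule Bt[OF i])
      also have "\<dots> = poly_form n W (unit_fun b) (pCons 0 p) (unit_fun i) + lam * (v i * poly_form n W (unit_fun b) p v)"
        by (simp only: poly_form_commute[where n = n and x = "unit_fun b", OF sym])
      finally show "t b i * (\<Sum>j<n. B i j * t b j) = poly_form n W (unit_fun b) p (unit_fun i) *
          (poly_form n W (unit_fun b) (pCons 0 p) (unit_fun i) + lam * (v i * poly_form n W (unit_fun b) p v))"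
        using b by (simp add: t_def)
    qed
    also have "\<dots> = (\<Sum>b<n. poly_form n W (unit_fun b) p (unit_fun i) * poly_form n W (unit_fun b) (pCons 0 p) (unit_fun i)) +
        lam * (v i * (\<Sum>b<n. poly_form n W (unit_fun b) p (unit_fun i) * poly_form n W (unit_fun b) p v))"
      by (simp add: distrib_left sum.distrib sum_distrib_left mult_ac)
    also have "\<dots> = \<kappa> + y i + u i"
      unfolding poly_form_sum_units[OF sym] by (simp add: y_def u_def)
    finally have 1: "(\<Sum>b<n. t b i * (\<Sum>j<n. B i j * t b j)) = \<kappa> + y i + u i" .
    have "(\<Sum>j<n. B i j * t n j) = sqrt e * (sqrt n * (\<Sum>j<n. B i j * poly_form n W (unit_fun j) q v))"
      by (simp add: t_def \<phi>_def sum_distrib_left mult_ac)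
    also have "\<dots> = sqrt e * \<zeta> i" unfolding Bt[OF i] by (simp add: \<zeta>_def)
    finally have "t n i * (\<Sum>j<n. B i j * t n j) = (sqrt e * sqrt e) * (\<phi> i * \<zeta> i)"
      by (simp add: t_def mult_ac)
    then show ?thesis using 1 e by simp
  qed
  have Blow: "- (26 * inner_n n x x) \<le> bilin n B x x" for x
    using low[of x] lam unfolding Bform by (smt (verit) mult_nonneg_nonneg zero_le_power2)
  have "(\<Sum>i<n. (\<kappa> + e * (\<phi> i * \<zeta> i - \<kappa> * (\<phi> i)\<^sup>2)) - (3 * \<bar>y i\<bar> + 3 * \<bar>u i\<bar> + 2 * \<bar>z i\<bar> + 53 * (z i)\<^sup>2)
        - 54 * (e\<^sup>2 * (\<phi> i ^ 4 + \<zeta> i ^ 4)))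
      \<le> (\<Sum>i<n. (1 - 2 * a i) * (\<Sum>b<Suc n. t b i * (\<Sum>j<n. B i j * t b j)) - 26 * ((a i)\<^sup>2 * (\<Sum>b<Suc n. (t b i)\<^sup>2)))"
  proof (intro sum_mono)
    fix i assume "i \<in> {..<n}"
    then have i: "i < n" by simp
    have \<rho>i: "(\<Sum>b<Suc n. (t b i)\<^sup>2) = \<rho> i" by (simp only: \<rho>_def)
    show "(\<kappa> + e * (\<phi> i * \<zeta> i - \<kappa> * (\<phi> i)\<^sup>2)) - (3 * \<bar>y i\<bar> + 3 * \<bar>u i\<bar> + 2 * \<bar>z i\<bar> + 53 * (z i)\<^sup>2)
        - 54 * (e\<^sup>2 * (\<phi> i ^ 4 + \<zeta> i ^ 4))
      \<le> (1 - 2 * a i) * (\<Sum>b<Suc n. t b i * (\<Sum>j<n. B i j * t b j)) - 26 * ((a i)\<^sup>2 * (\<Sum>b<Suc n. (t b i)\<^sup>2))"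
      unfolding R[OF i] \<rho>i a_def by (rule row_estimate[OF \<rho>0 \<rho>[OF i] e \<kappa>])
  qed
  also have "\<dots> \<le> (\<Sum>b<Suc n. bilin n B (\<lambda>i. (1 - a i) * t b i) (\<lambda>i. (1 - a i) * t b i))"
    by (intro scaled_columns_bound Bsym Blow) simp
  also have "\<dots> \<le> (\<Sum>b<Suc n. bilin n (\<lambda>i j. M $$ (i, j)) (\<lambda>i. (1 - a i) * t b i) (\<lambda>i. (1 - a i) * t b i))"
    unfolding Bform by (intro sum_mono dom)
  also have "\<dots> \<le> SDP M + (\<Sum>i<n. \<bar>M $$ (i, i)\<bar>)"
  proof -
    have "(\<Sum>b<Suc n. ((1 - a i) * t b i)\<^sup>2) \<le> 1" if "i < n" for i
    proof -
      have "(\<Sum>b<Suc n. ((1 - a i) * t b i)\<^sup>2) = (1 - a i)\<^sup>2 * \<rho> i"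
        by (simp only: power_mult_distrib sum_distrib_left \<rho>_def)
      also have "\<dots> \<le> 1" unfolding a_def by (rule sqrt_truncation(5)[OF \<rho>0])
      finally show ?thesis .
    qed
    from SDP_ge_columns[where t = "\<lambda>b i. (1 - a i) * t b i" and A = "{..<Suc n}", OF M _ this]
    show ?thesis by (simp only: finite_lessThan simp_thms diff_le_eq)
  qed
  finally have main: "(\<Sum>i<n. (\<kappa> + e * (\<phi> i * \<zeta> i - \<kappa> * (\<phi> i)\<^sup>2)) - (3 * \<bar>y i\<bar> + 3 * \<bar>u i\<bar> + 2 * \<bar>z i\<bar> + 53 * (z i)\<^sup>2)
        - 54 * (e\<^sup>2 * (\<phi> i ^ 4 + \<zeta> i ^ 4))) \<le> SDP M + (\<Sum>i<n. \<bar>M $$ (i, i)\<bar>)" .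
  have sumphi: "(\<Sum>i<n. (\<phi> i)\<^sup>2) = n * poly_form n W v (q * q) v"
    unfolding poly_form_sum_units[OF sym, symmetric] sum_distrib_left
    by (simp add: \<phi>_def power_mult_distrib) (simp add: power2_eq_square)
  have sumzeta: "(\<Sum>i<n. \<phi> i * \<zeta> i) = n * (lam * (poly_form n W v q v)\<^sup>2 + poly_form n W v (pCons 0 (q * q)) v)"
  proof -
    have expand: "(s * f) * (s * (g + lam * (b * c))) = (s * s) * (f * g + lam * (c * (b * f)))"
      for s f g b c :: real by (simp add: algebra_simps)
    have "(\<Sum>i<n. \<phi> i * \<zeta> i) = (\<Sum>i<n. (sqrt n * sqrt n) * (poly_form n W (unit_fun i) q v * poly_form n W (unit_fun i) (pCons 0 q) v
        + lam * (poly_form n W v q v * (v i * poly_form n W (unit_fun i) q v))))"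
      by (simp only: \<phi>_def \<zeta>_def expand)
    also have "\<dots> = n * ((\<Sum>i<n. poly_form n W (unit_fun i) q v * poly_form n W (unit_fun i) (pCons 0 q) v)
        + lam * (poly_form n W v q v * (\<Sum>i<n. v i * poly_form n W (unit_fun i) q v)))"
      by (simp add: sum.distrib flip: sum_distrib_left)
    finally show ?thesis
      unfolding poly_form_sum_units[OF sym] poly_form_inner by (simp add: power2_eq_square)
  qed
  have gain: "n * (e * (lam + semicircle (pCons 0 (q * q)) - 2 * semicircle (q * q) - spike_error n lam v q W))
      \<le> e * ((\<Sum>i<n. \<phi> i * \<zeta> i) - \<kappa> * (\<Sum>i<n. (\<phi> i)\<^sup>2))"
  proof -
    have "0 \<le> poly_form n W v (q * q) v"
      unfolding poly_form_sum_units[OF sym, symmetric] by (intro sum_nonneg) simp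
    then have "n * (e * (lam + semicircle (pCons 0 (q * q)) - 2 * semicircle (q * q) - spike_error n lam v q W)) \<le>
        n * (e * (lam * (poly_form n W v q v)\<^sup>2 + poly_form n W v (pCons 0 (q * q)) v - \<kappa> * poly_form n W v (q * q) v))"
      unfolding spike_error_def by (intro mult_left_mono gain_estimate lam e \<kappa>) auto
    also have "\<dots> = e * ((\<Sum>i<n. \<phi> i * \<zeta> i) - \<kappa> * (\<Sum>i<n. (\<phi> i)\<^sup>2))"
      unfolding sumphi sumzeta by (simp add: algebra_simps)
    finally show ?thesis .
  qed
  have "(\<Sum>i<n. (\<kappa> + e * (\<phi> i * \<zeta> i - \<kappa> * (\<phi> i)\<^sup>2)) - (3 * \<bar>y i\<bar> + 3 * \<bar>u i\<bar> + 2 * \<bar>z i\<bar> + 53 * (z i)\<^sup>2)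
        - 54 * (e\<^sup>2 * (\<phi> i ^ 4 + \<zeta> i ^ 4))) =
     n * \<kappa> + e * ((\<Sum>i<n. \<phi> i * \<zeta> i) - \<kappa> * (\<Sum>i<n. (\<phi> i)\<^sup>2))
     - ((\<Sum>i<n. row_error n lam v p \<kappa> W i) - (\<Sum>i<n. \<bar>W i i\<bar>))
     - 54 * (e\<^sup>2 * (\<Sum>i<n. quartic_error n lam v q W i))"
    unfolding row_error_def quartic_error_def z_def y_def u_def \<phi>_def \<zeta>_def
      sum_subtractf sum.distrib[of "\<lambda>_. \<kappa>"] sum_distrib_left[symmetric] sum.distrib[of _ "\<lambda>i. \<bar>W i i\<bar>"] by simp
  moreover have "(\<Sum>i<n. \<bar>M $$ (i, i)\<bar>) \<le> (\<Sum>i<n. \<bar>W i i\<bar>) + n * b"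
  proof -
    have "(\<Sum>i<n. \<bar>M $$ (i, i)\<bar>) \<le> (\<Sum>i<n. \<bar>W i i\<bar> + b)" by (intro sum_mono diag) simp
    then show ?thesis by (simp add: sum.distrib)
  qed
  \<comment> \<open>With the sums abstracted to variables, combining the estimates is plain linear
    arithmetic.\<close>
  moreover have "x * (\<kappa> + g) - R - Q - x * b \<le> s"
    if "x * g \<le> G" "m = x * \<kappa> + G - (R - w) - Q" "d \<le> w + x * b" "m \<le> s + d" for x g R Q s G m d w :: real
    using that unfolding distrib_left by linarith
  ultimately show ?thesis using main gain by blast
qed

section \<open>The block model\<close>

text \<open>The right-hand side is the sum of (s l - m)^2 with m the mean. Keeping l = 0, 1 and
  minimizing over m leaves half the squared difference.\<close>

lemma sum_square_spread:
  fixes s :: "nat \<Rightarrow> real"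
  assumes r: "2 \<le> r"
  shows "(s 0 - s 1)\<^sup>2 / 2 \<le> (\<Sum>l<r. (s l)\<^sup>2) - (\<Sum>l<r. s l)\<^sup>2 / r"
proof -
  define m where "m = (\<Sum>l<r. s l) / r"
  have rm: "(\<Sum>l<r. s l) = r * m" using r by (simp add: m_def)
  have "(s 0 - s 1)\<^sup>2 / 2 \<le> (s 0 - m)\<^sup>2 + (s 1 - m)\<^sup>2"
    using zero_le_power2[of "s 0 + s 1 - 2 * m"] by (simp add: power2_eq_square field_simps)
  also have "\<dots> = (\<Sum>l\<in>{0, 1}. (s l - m)\<^sup>2)" by simp
  also have "\<dots> \<le> (\<Sum>l<r. (s l - m)\<^sup>2)" using r by (intro sum_mono2) auto
  also have "\<dots> = (\<Sum>l<r. (s l)\<^sup>2 - 2 * m * s l + m\<^sup>2)"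
    by (intro sum.cong refl) (simp add: power2_eq_square algebra_simps)
  also have "\<dots> = (\<Sum>l<r. (s l)\<^sup>2) - 2 * m * (\<Sum>l<r. s l) + r * m\<^sup>2"
    by (simp add: sum.distrib sum_subtractf sum_distrib_left)
  also have "\<dots> = (\<Sum>l<r. (s l)\<^sup>2) - (\<Sum>l<r. s l)\<^sup>2 / r"
    unfolding rm using r by (simp add: power2_eq_square field_simps)
  finally show ?thesis .
qed

text \<open>B_0 is the orthogonal projection onto the block-constant vectors with vanishing sum, so
  it dominates v v^T for a unit vector v in its range. A block has n / r elements, which makes the
  entries of v at most sqrt r / sqrt n.\<close>

lemma equipartition_spike:
  assumes r: "2 \<le> r" and n: "0 < n" "r dvd n" and S: "equipartition r n S"
  shows "\<exists>v. flat_unit n (sqrt r) v \<and>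
    (\<forall>x. (inner_n n v x)\<^sup>2 \<le> bilin n (\<lambda>i j. B0_mat r n S $$ (i, j)) x x)"
proof -
  define m where "m = n div r"
  have nm: "n = r * m" using n by (simp add: m_def)
  have m: "0 < m" using n nm by (cases m) auto
  have un: "(\<Union>l<r. S l) = {..<n}" and dis: "disjoint_family_on S {..<r}" and card: "\<And>l. l < r \<Longrightarrow> card (S l) = m"
    using S by (auto simp: equipartition_def m_def)
  have sub: "S l \<subseteq> {..<n}" if "l < r" for l using un that by blast
  define I where "I = (\<lambda>l i. if i \<in> S l then 1 else 0 :: real)"
  have block: "\<exists>l<r. i \<in> S l" if "i < n" for i using un that by blast
  have uniq: "l = l'" if "l < r" "l' < r" "i \<in> S l" "i \<in> S l'" for l l' i
    using dis that by (auto simp: disjoint_family_on_def)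
  have I1: "(\<Sum>l<r. I l i) = 1" if i: "i < n" for i
  proof -
    obtain l where l: "l < r" "i \<in> S l" using block[OF i] by blast
    have "(\<Sum>l'<r. I l' i) = (\<Sum>l'<r. if l' = l then 1 else 0)"
      using l uniq by (intro sum.cong refl) (auto simp: I_def)
    then show ?thesis using l by simp
  qed
  have I2: "(\<Sum>l<r. I l i * I l j) = (if \<exists>l<r. {i, j} \<subseteq> S l then 1 else 0)" if i: "i < n" for i j
  proof -
    obtain l where l: "l < r" "i \<in> S l" using block[OF i] by blast
    have "(\<Sum>l'<r. I l' i * I l' j) = (\<Sum>l'<r. if l' = l then (if j \<in> S l then 1 else 0) else 0)"
      using l uniq by (intro sum.cong refl) (auto simp: I_def)
    also have "\<dots> = (if j \<in> S l then 1 else 0)" using l by simp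
    also have "(j \<in> S l) = (\<exists>l<r. {i, j} \<subseteq> S l)" using l uniq by auto
    finally show ?thesis by simp
  qed
  have sumI: "(\<Sum>i<n. I l i * x i) = sum x (S l)" if "l < r" for l and x :: "nat \<Rightarrow> real"
  proof -
    have "(\<Sum>i<n. I l i * x i) = (\<Sum>i<n. if i \<in> S l then x i else 0)"
      by (intro sum.cong refl) (simp add: I_def)
    also have "\<dots> = sum x ({..<n} \<inter> S l)" by (simp add: sum.inter_restrict)
    also have "{..<n} \<inter> S l = S l" using sub[OF that] by blast
    finally show ?thesis .
  qed
  have B0: "B0_mat r n S $$ (i, j) = (r / n) * (\<Sum>l<r. I l i * I l j) - 1 / n" if "i < n" "j < n" for i j
  proof -
    have "(if P then (real r - 1) / real n else - 1 / real n) = real r / n * (if P then 1 else 0) - 1 / n" for P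
      by (simp add: diff_divide_distrib)
    moreover have "B0_mat r n S $$ (i, j) = (if \<exists>l<r. {i, j} \<subseteq> S l then (real r - 1) / real n else - 1 / real n)"
      using that by (simp only: B0_mat_def index_mat prod.case)
    ultimately show ?thesis unfolding I2[OF that(1)] by (simp only:)
  qed
  define s where "s = (\<lambda>(x :: nat \<Rightarrow> real) l. \<Sum>i<n. I l i * x i)"
  have square_sum: "(\<Sum>i<n. g i)\<^sup>2 = (\<Sum>i<n. \<Sum>j<n. g i * g j)" for g :: "nat \<Rightarrow> real"
    by (simp only: power2_eq_square sum_product)
  have form: "bilin n (\<lambda>i j. B0_mat r n S $$ (i, j)) x x = ((\<Sum>l<r. (s x l)\<^sup>2) - (\<Sum>l<r. s x l)\<^sup>2 / r) / m" for x
  proof -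
    have "bilin n (\<lambda>i j. B0_mat r n S $$ (i, j)) x x =
        (\<Sum>i<n. \<Sum>j<n. (\<Sum>l<r. (r / n) * ((I l i * x i) * (I l j * x j))) - (1 / n) * (x i * x j))"
      unfolding bilin_def
    proof (intro sum.cong refl)
      fix i j assume "i \<in> {..<n}" "j \<in> {..<n}"
      then have e: "B0_mat r n S $$ (i, j) = (r / n) * (\<Sum>l<r. I l i * I l j) - 1 / n" by (simp add: B0)
      show "B0_mat r n S $$ (i, j) * (x i * x j) =
          (\<Sum>l<r. (r / n) * ((I l i * x i) * (I l j * x j))) - (1 / n) * (x i * x j)"
        unfolding e left_diff_distrib sum_distrib_left sum_distrib_right
        by (intro arg_cong2[where f = minus] sum.cong refl) (simp add: mult_ac)
    qed
    also have "\<dots> = (\<Sum>i<n. \<Sum>j<n. \<Sum>l<r. (r / n) * ((I l i * x i) * (I l j * x j))) - (\<Sum>i<n. \<Sum>j<n. (1 / n) * (x i * x j))"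
      by (simp only: sum_subtractf)
    also have "(\<Sum>i<n. \<Sum>j<n. \<Sum>l<r. (r / n) * ((I l i * x i) * (I l j * x j))) =
        (\<Sum>l<r. \<Sum>i<n. \<Sum>j<n. (r / n) * ((I l i * x i) * (I l j * x j)))"
      by (simp only: sum.swap[of _ "{..<r}"])
    also have "\<dots> = (r / n) * (\<Sum>l<r. (s x l)\<^sup>2)"
      unfolding s_def square_sum by (simp only: sum_distrib_left)
    also have "(\<Sum>i<n. \<Sum>j<n. (1 / n) * (x i * x j)) = (1 / n) * (\<Sum>i<n. x i)\<^sup>2"
      unfolding square_sum by (simp only: sum_distrib_left)
    also have "(\<Sum>i<n. x i) = (\<Sum>i<n. \<Sum>l<r. I l i * x i)"
      by (intro sum.cong refl) (simp add: I1 flip: sum_distrib_right)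
    also have "\<dots> = (\<Sum>l<r. s x l)" unfolding s_def by (rule sum.swap)
    finally show ?thesis using m r by (simp add: nm field_simps)
  qed
  define v where "v = (\<lambda>i. (I 0 i - I 1 i) / sqrt (2 * m))"
  have vx: "inner_n n v x = (s x 0 - s x 1) / sqrt (2 * m)" for x
    by (simp add: inner_n_def v_def s_def left_diff_distrib sum_subtractf flip: sum_divide_distrib)
  have "(inner_n n v x)\<^sup>2 \<le> bilin n (\<lambda>i j. B0_mat r n S $$ (i, j)) x x" for x
  proof -
    have "(inner_n n v x)\<^sup>2 = ((s x 0 - s x 1)\<^sup>2 / 2) / m" by (simp add: vx power_divide)
    also have "\<dots> \<le> ((\<Sum>l<r. (s x l)\<^sup>2) - (\<Sum>l<r. s x l)\<^sup>2 / r) / m"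
      using sum_square_spread[OF r, of "s x"] by (intro divide_right_mono) auto
    finally show ?thesis unfolding form .
  qed
  moreover have "inner_n n v v = 1"
  proof -
    have "v i * v i = (I 0 i + I 1 i) / (2 * m)" if "i < n" for i
      using uniq[of 0 1 i] r by (auto simp: v_def I_def)
    then have "inner_n n v v = (\<Sum>i<n. (I 0 i * 1 + I 1 i * 1) / (2 * m))"
      unfolding inner_n_def by (intro sum.cong refl) simp
    also have "\<dots> = (real (card (S 0)) + real (card (S 1))) / (2 * m)"
      unfolding sum_divide_distrib[symmetric] sum.distrib using r sumI[of 0 "\<lambda>_. 1"] sumI[of 1 "\<lambda>_. 1"] by simp
    also have "\<dots> = 1" using r card m by simp
    finally show ?thesis .
  qed
  moreover have "\<bar>v i\<bar> \<le> sqrt r / sqrt n" for i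
  proof -
    have "\<bar>v i\<bar> \<le> 1 / sqrt (2 * m)" by (auto simp: v_def I_def)
    also have "\<dots> \<le> 1 / sqrt m" using m by (intro divide_left_mono) auto
    also have "\<dots> = sqrt r / sqrt n" using r by (simp add: nm real_sqrt_mult)
    finally show ?thesis .
  qed
  ultimately show ?thesis unfolding flat_unit_def by blast
qed

text \<open>The entries of a feasible matrix lie in [-1, 1], so a maximizer for one matrix loses at
  most the entrywise distance when used for the other.\<close>

lemma SDP_lipschitz:
  assumes M: "M \<in> carrier_mat n n" and M': "M' \<in> carrier_mat n n"
  shows "\<bar>SDP M - SDP M'\<bar> \<le> (\<Sum>i<n. \<Sum>j<n. \<bar>M $$ (i, j) - M' $$ (i, j)\<bar>)"
proof -
  have one: "SDP A \<le> SDP B + (\<Sum>i<n. \<Sum>j<n. \<bar>A $$ (i, j) - B $$ (i, j)\<bar>)"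
    if A: "A \<in> carrier_mat n n" and B: "B \<in> carrier_mat n n" for A B
  proof -
    obtain X where X: "X \<in> elliptope n" "mat_trace (A * X) = SDP A" using SDP_attained[OF A] by blast
    have Xc: "X \<in> carrier_mat n n" using X by (simp add: elliptope_def)
    have "mat_trace (A * X) - mat_trace (B * X) = (\<Sum>i<n. \<Sum>j<n. (A $$ (i, j) - B $$ (i, j)) * X $$ (j, i))"
      by (simp add: mat_trace_mult[OF A Xc] mat_trace_mult[OF B Xc] sum_subtractf left_diff_distrib)
    also have "\<dots> \<le> (\<Sum>i<n. \<Sum>j<n. \<bar>A $$ (i, j) - B $$ (i, j)\<bar>)"
    proof (intro sum_mono)
      fix i j assume "i \<in> {..<n}" "j \<in> {..<n}"
      then have "\<bar>X $$ (j, i)\<bar> \<le> 1" using elliptope_entry_bound[OF X(1)] by simp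
      then have "\<bar>A $$ (i, j) - B $$ (i, j)\<bar> * \<bar>X $$ (j, i)\<bar> \<le> \<bar>A $$ (i, j) - B $$ (i, j)\<bar> * 1"
        by (intro mult_left_mono) auto
      then show "(A $$ (i, j) - B $$ (i, j)) * X $$ (j, i) \<le> \<bar>A $$ (i, j) - B $$ (i, j)\<bar>"
        using abs_ge_self[of "(A $$ (i, j) - B $$ (i, j)) * X $$ (j, i)"] by (simp add: abs_mult)
    qed
    finally show ?thesis using SDP_attained[OF B] X by auto
  qed
  have "(\<Sum>i<n. \<Sum>j<n. \<bar>M' $$ (i, j) - M $$ (i, j)\<bar>) = (\<Sum>i<n. \<Sum>j<n. \<bar>M $$ (i, j) - M' $$ (i, j)\<bar>)"
    by (simp only: abs_minus_commute)
  then show ?thesis using one[OF M M'] one[OF M' M] by (simp add: abs_le_iff)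
qed

section \<open>Measurability and Lipschitz continuity of the value\<close>

lemma B_mat_carrier: "W \<in> carrier_mat n n \<Longrightarrow> B_mat lam r n S W \<in> carrier_mat n n"
  by (simp add: B_mat_def B0_mat_def)

lemma B_mat_entry:
  assumes "W \<in> carrier_mat n n" "i < n" "j < n"
  shows "B_mat lam r n S W $$ (i, j) = lam * B0_mat r n S $$ (i, j) + W $$ (i, j)"
  using assms by (simp add: B_mat_def B0_mat_def)

text \<open>The value is continuous in the entries. Matrices are extended by 0 to functions on all
  index pairs, because on that full countable product the product sigma-algebra is the Borel
  one.\<close>

lemma SDP_B_measurable: "(\<lambda>W. SDP (B_mat lam r n S W)) \<in> borel_measurable (mat_borel n)"
proof -
  let ?m = "\<lambda>x. Matrix.mat n n x :: real mat"
  define g where "g = (\<lambda>x. SDP (B_mat lam r n S (?m x)))"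
  have cont: "continuous_on A (\<lambda>f :: nat \<times> nat \<Rightarrow> real. f ij)" for A ij
    by (rule continuous_on_subset[OF continuous_on_product_coordinates]) simp
  have lip: "\<bar>g x - g y\<bar> \<le> (\<Sum>i<n. \<Sum>j<n. \<bar>x (i, j) - y (i, j)\<bar>)" for x y
  proof -
    have "\<bar>g x - g y\<bar> \<le> (\<Sum>i<n. \<Sum>j<n. \<bar>B_mat lam r n S (?m x) $$ (i, j) - B_mat lam r n S (?m y) $$ (i, j)\<bar>)"
      unfolding g_def by (intro SDP_lipschitz B_mat_carrier) auto
    also have "\<dots> = (\<Sum>i<n. \<Sum>j<n. \<bar>x (i, j) - y (i, j)\<bar>)"
      by (intro sum.cong refl) (simp add: B_mat_entry)
    finally show ?thesis .
  qed
  have "continuous_on UNIV g"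
    unfolding continuous_on_def
  proof
    fix x :: "nat \<times> nat \<Rightarrow> real"
    have "continuous_on UNIV (\<lambda>y :: nat \<times> nat \<Rightarrow> real. \<Sum>i<n. \<Sum>j<n. \<bar>y (i, j) - x (i, j)\<bar>)"
      by (intro continuous_on_sum continuous_on_rabs continuous_on_diff continuous_on_const cont)
    then have "((\<lambda>y. \<Sum>i<n. \<Sum>j<n. \<bar>y (i, j) - x (i, j)\<bar>) \<longlongrightarrow> (\<Sum>i<n. \<Sum>j<n. \<bar>x (i, j) - x (i, j)\<bar>)) (at x within UNIV)"
      unfolding continuous_on_def by blast
    then have "((\<lambda>y. \<Sum>i<n. \<Sum>j<n. \<bar>y (i, j) - x (i, j)\<bar>) \<longlongrightarrow> 0) (at x within UNIV)" by simp
    then have "((\<lambda>y. g y - g x) \<longlongrightarrow> 0) (at x within UNIV)"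
      by (rule Lim_null_comparison[rotated]) (simp add: lip)
    then show "(g \<longlongrightarrow> g x) (at x within UNIV)" by (rule LIM_zero_cancel)
  qed
  then have "g \<in> borel_measurable borel" by (rule borel_measurable_continuous_onI)
  then have g: "g \<in> borel_measurable (Pi\<^sub>M UNIV (\<lambda>_. borel))"
    using measurable_cong_sets[OF sets_PiM_equal_borel refl] by blast
  let ?e = "\<lambda>W. \<lambda>ij\<in>UNIV. if ij \<in> {..<n} \<times> {..<n} then W $$ ij else 0"
  have "?e \<in> measurable (mat_borel n) (Pi\<^sub>M UNIV (\<lambda>_. borel :: real measure))"
  proof (rule measurable_restrict)
    fix ij :: "nat \<times> nat"
    show "(\<lambda>W. if ij \<in> {..<n} \<times> {..<n} then W $$ ij else 0) \<in> borel_measurable (mat_borel n)"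
      by (cases ij; cases "ij \<in> {..<n} \<times> {..<n}") (auto intro: entry_measurable)
  qed
  then have "g \<circ> ?e \<in> borel_measurable (mat_borel n)"
    using g by (rule measurable_comp)
  moreover have "SDP (B_mat lam r n S W) = (g \<circ> ?e) W" if "W \<in> space (mat_borel n)" for W
  proof -
    have "?m (?e W) = W" using that by (intro eq_matI) auto
    then show ?thesis by (simp add: g_def)
  qed
  ultimately show ?thesis by (subst measurable_cong) auto
qed

lemma goe_vars_eq: "goe_vars n = Pi\<^sub>M (upper_indices n) (\<lambda>ij. density lborel (GOE_density n ij))"
proof -
  have "GOE_density n ij = normal_density 0 (goe_sd n ij)" for ij
    by (cases ij) (simp add: GOE_density_def goe_sd_def)
  then show ?thesis by (simp add: gauss_prod_def)
qed

lemma symmetric_mat_measurable_goe: "symmetric_mat_of n \<in> measurable (goe_vars n) (mat_borel n)"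
proof -
  have "sets (goe_vars n) = sets (Pi\<^sub>M (upper_indices n) (\<lambda>_. borel))"
    unfolding gauss_prod_def by (intro sets_PiM_cong) auto
  then show ?thesis using symmetric_mat_of_measurable measurable_cong_sets by blast
qed

definition sdp_value :: "real \<Rightarrow> nat \<Rightarrow> nat \<Rightarrow> (nat \<Rightarrow> nat set) \<Rightarrow> (nat \<times> nat \<Rightarrow> real) \<Rightarrow> real" where
  "sdp_value lam r n S w = SDP (B_mat lam r n S (symmetric_mat_of n w))"

lemma sdp_value_measurable: "sdp_value lam r n S \<in> borel_measurable (goe_vars n)"
  using measurable_compose[OF symmetric_mat_measurable_goe SDP_B_measurable]
  by (simp add: sdp_value_def[abs_def])

lemma GOE_prob_eq:
  assumes n: "0 < n"
  shows "\<P>(W in GOE n. SDP (B_mat lam r n S W) / real n \<ge> c) = \<P>(w in goe_vars n. n * c \<le> sdp_value lam r n S w)"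
proof -
  let ?A = "{W \<in> space (GOE n). SDP (B_mat lam r n S W) / real n \<ge> c}"
  note [measurable] = SDP_B_measurable
  have "?A = {W \<in> space (mat_borel n). SDP (B_mat lam r n S W) / real n \<ge> c}"
    by (simp add: GOE_def)
  also have "\<dots> \<in> sets (mat_borel n)" by measurable
  finally have A: "?A \<in> sets (mat_borel n)" .
  have "measure (GOE n) ?A = measure (goe_vars n) (symmetric_mat_of n -` ?A \<inter> space (goe_vars n))"
    using measure_distr[OF symmetric_mat_measurable_goe A] by (simp add: GOE_def goe_vars_eq)
  also have "symmetric_mat_of n -` ?A \<inter> space (goe_vars n) =
      {w \<in> space (goe_vars n). n * c \<le> sdp_value lam r n S w}"
    using n by (auto simp: GOE_def sdp_value_def symmetric_mat_of_def field_simps)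
  finally show ?thesis .
qed

lemma symmetric_mat_entry: "i < n \<Longrightarrow> j < n \<Longrightarrow> symmetric_mat_of n w $$ (i, j) = sym_ext w i j"
  by (simp add: symmetric_mat_of_def sym_ext_def)

text \<open>The constant is 2 because a coordinate off the diagonal occupies two entries of the
  matrix.\<close>

lemma sdp_value_lipschitz: "coord_lipschitz (upper_indices n) 2 (sdp_value lam r n S)"
  unfolding coord_lipschitz_def
proof (intro ballI allI)
  fix u w t assume u: "u \<in> upper_indices n"
  let ?M = "\<lambda>w. B_mat lam r n S (symmetric_mat_of n w)"
  have W: "symmetric_mat_of n w \<in> carrier_mat n n" for w by (simp add: symmetric_mat_of_def)
  have "\<bar>sdp_value lam r n S (w(u := t)) - sdp_value lam r n S w\<bar> \<le>
      (\<Sum>i<n. \<Sum>j<n. \<bar>?M (w(u := t)) $$ (i, j) - ?M w $$ (i, j)\<bar>)"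
    unfolding sdp_value_def by (intro SDP_lipschitz B_mat_carrier W)
  also have "\<dots> = (\<Sum>i<n. \<Sum>j<n. \<bar>sym_ext (w(u := t)) i j - sym_ext w i j\<bar>)"
    by (intro sum.cong refl) (simp add: B_mat_entry[OF W] symmetric_mat_entry)
  also have "\<dots> \<le> (\<Sum>ij\<in>upper_indices n. if ij = u then 2 * \<bar>t - w u\<bar> else 0)"
    unfolding sum_square_upper
  proof (intro sum_mono, clarify)
    fix i j assume "(i, j) \<in> upper_indices n"
    then have "min i j = i" "max i j = j" "min j i = i" "max j i = j" by (auto simp: upper_indices_def)
    then show "(if i = j then \<bar>sym_ext (w(u := t)) i j - sym_ext w i j\<bar>
        else \<bar>sym_ext (w(u := t)) i j - sym_ext w i j\<bar> + \<bar>sym_ext (w(u := t)) j i - sym_ext w j i\<bar>)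
      \<le> (if (i, j) = u then 2 * \<bar>t - w u\<bar> else 0)"
      by (auto simp: sym_ext_def)
  qed
  also have "\<dots> = 2 * \<bar>t - w u\<bar>" using u by simp
  finally show "\<bar>sdp_value lam r n S (w(u := t)) - sdp_value lam r n S w\<bar> \<le> 2 * \<bar>t - w u\<bar>" .
qed

text \<open>At most n^2 coordinates of variance at most 2 / n. Growth linear in n is what counts:
  together with the Lipschitz constant 2 the variance of the value is at most 8 n.\<close>

lemma goe_variance_sum:
  assumes n: "0 < n"
  shows "(\<Sum>u\<in>upper_indices n. (goe_sd n u)\<^sup>2) \<le> 2 * n"
proof -
  have "(\<Sum>u\<in>upper_indices n. (goe_sd n u)\<^sup>2) \<le> (\<Sum>u\<in>upper_indices n. 2 / n)"
    by (intro sum_mono) (auto simp: goe_sd_def divide_right_mono split: prod.splits)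
  also have "\<dots> = real (card (upper_indices n)) * (2 / n)" by simp
  also have "\<dots> \<le> real (n * n) * (2 / n)"
  proof (intro mult_right_mono)
    have "card (upper_indices n) \<le> card ({..<n} \<times> {..<n})"
      by (intro card_mono) (auto simp: upper_indices_def)
    then show "real (card (upper_indices n)) \<le> real (n * n)" by (simp only: of_nat_le_iff card_cartesian_product card_lessThan)
  qed simp
  also have "\<dots> = 2 * n" using n by simp
  finally show ?thesis .
qed

section \<open>Sizes of the error terms and choice of the parameters\<close>

lemma row_error_order:
  assumes c: "1 \<le> c" and lam: "0 \<le> lam"
    and p: "semicircle (p * p) = 1" "semicircle (pCons 0 (p * p)) = \<kappa>"
  shows "goe_order c (\<lambda>n. 1 / sqrt n) (\<lambda>n v i w. row_error n lam v p \<kappa> (sym_ext w) i)"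
proof -
  have L1: "goe_order c (\<lambda>n. 1 / sqrt n)
      (\<lambda>n v i w. \<bar>poly_form n (sym_ext w) (unit_fun i) P (unit_fun i) - semicircle P\<bar>)" for P
    using poly_form_L1[OF c, of Some P] by simp
  have u: "goe_order c (\<lambda>n. 1 / sqrt n)
      (\<lambda>n v i w. 3 * (lam * (\<bar>v i\<bar> * \<bar>poly_form n (sym_ext w) (unit_fun i) (p * p) v\<bar>)))"
    using c lam by (intro goe_order_cmult goe_order_flat poly_form_mixed_L1) auto
  have z2: "goe_order c (\<lambda>n. 1 / sqrt n)
      (\<lambda>n v i w. (poly_form n (sym_ext w) (unit_fun i) (p * p) (unit_fun i) - semicircle (p * p))\<^sup>2)"
    by (rule goe_order_mono[OF poly_form_L2[OF c, of Some]])
      (auto intro!: goe_poly_integrable gauss_poly_intros goe_poly_poly_form divide_left_mono real_le_lsqrt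
        simp: power2_eq_square)
  \<comment> \<open>A diagonal entry of W is the form of the polynomial x, whose semicircle mean is
    0, so \<open>L1\<close> covers it as well.\<close>
  have entry: "poly_form n W (unit_fun i) [:0, 1:] (unit_fun i) - semicircle [:0, 1:] = W i i"
    if "i < n" for n W i
  proof -
    have "poly_form n W (unit_fun i) [:0, 1:] (unit_fun i) = inner_n n (W i) (unit_fun i)"
      using that by (simp add: poly_form_def lin_poly_def pow_form_unit inner_n_def)
    then show ?thesis using that by (simp add: lin_poly_def semicircle_moment_Suc)
  qed
  show ?thesis
  proof (rule goe_order_mono[OF goe_order_add[OF goe_order_add[OF goe_order_add[OF goe_order_add[OF
      goe_order_cmult[OF L1[of "pCons 0 (p * p)"], of 3] u] goe_order_cmult[OF L1[of "p * p"], of 2]]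
      goe_order_cmult[OF z2, of 53]] L1[of "[:0, 1:]"]]])
    show "integrable (goe_vars n) (\<lambda>w. row_error n lam v p \<kappa> (sym_ext w) i)" if "0 < n" "i < n" for n v i
      unfolding row_error_def using that
      by (intro Bochner_Integration.integrable_add integrable_mult_right integrable_abs goe_poly_integrable
        gauss_poly_intros goe_poly_poly_form goe_poly_entry)
  qed (use lam in \<open>auto simp: row_error_def p entry abs_mult\<close>)
qed

text \<open>This error is bounded but does not decay; it becomes small only through its weight e^2.
  Flatness keeps \<open>sqrt n * v i\<close> bounded.\<close>

lemma quartic_error_order:
  assumes c: "1 \<le> c"
  shows "goe_order c (\<lambda>_. 1) (\<lambda>n v i w. quartic_error n lam v q (sym_ext w) i)"
proof -
  have four: "x ^ 4 = (x\<^sup>2)\<^sup>2" for x :: real by simp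
  have p4: "(x + y) ^ 4 \<le> 8 * x ^ 4 + 8 * y ^ 4" for x y :: real
  proof -
    have sq: "(x + y)\<^sup>2 \<le> 2 * (x\<^sup>2 + y\<^sup>2)" for x y :: real
      using sum_squares_bound[of x y] by (simp add: power2_sum)
    have "(x + y) ^ 4 \<le> (2 * (x\<^sup>2 + y\<^sup>2))\<^sup>2"
      unfolding four by (intro power_mono sq) simp
    also have "\<dots> = 4 * (x\<^sup>2 + y\<^sup>2)\<^sup>2" unfolding power_mult_distrib by simp
    also have "\<dots> \<le> 4 * (2 * ((x\<^sup>2)\<^sup>2 + (y\<^sup>2)\<^sup>2))" by (intro mult_left_mono sq) simp
    finally show ?thesis by simp
  qed
  have a: "goe_order c (\<lambda>_. 1) (\<lambda>n v i w. poly_form n (sym_ext w) v q v ^ 4)"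
    using poly_form_fourth[OF c, of "\<lambda>_. None" "\<lambda>_. None" 0 q] by (simp add: mixed_def)
  have le: "quartic_error n lam v q W i \<le> (sqrt n * poly_form n W (unit_fun i) q v) ^ 4 +
      8 * (sqrt n * poly_form n W (unit_fun i) (pCons 0 q) v) ^ 4 + 8 * (lam * c) ^ 4 * poly_form n W v q v ^ 4"
    if n: "0 < n" and v: "flat_unit n c v" and i: "i < n" for n v i W
  proof -
    have "\<bar>v i\<bar> \<le> c / sqrt n" using v i by (simp add: flat_unit_def)
    then have "sqrt n * \<bar>v i\<bar> \<le> c" using n by (simp add: pos_le_divide_eq mult.commute)
    then have "\<bar>lam\<bar> * (sqrt n * \<bar>v i\<bar>) \<le> \<bar>lam\<bar> * c" by (intro mult_left_mono) auto
    then have "\<bar>sqrt n * (lam * v i)\<bar> \<le> \<bar>lam * c\<bar>" using c by (simp add: abs_mult mult_ac)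
    then have vi: "(sqrt n * (lam * v i)) ^ 4 \<le> (lam * c) ^ 4"
      using power_mono[of "\<bar>sqrt n * (lam * v i)\<bar>" "\<bar>lam * c\<bar>" 4] by (simp add: power_even_abs)
    have "(sqrt n * (poly_form n W (unit_fun i) (pCons 0 q) v + lam * (v i * poly_form n W v q v))) ^ 4 =
        (sqrt n * poly_form n W (unit_fun i) (pCons 0 q) v + (sqrt n * (lam * v i)) * poly_form n W v q v) ^ 4"
      by (simp add: algebra_simps)
    also have "\<dots> \<le> 8 * (sqrt n * poly_form n W (unit_fun i) (pCons 0 q) v) ^ 4 +
        8 * ((sqrt n * (lam * v i)) * poly_form n W v q v) ^ 4" by (rule p4)
    also have "\<dots> \<le> 8 * (sqrt n * poly_form n W (unit_fun i) (pCons 0 q) v) ^ 4 +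
        8 * ((lam * c) ^ 4 * poly_form n W v q v ^ 4)"
      unfolding power_mult_distrib[of "sqrt n * (lam * v i)"]
      by (intro add_left_mono mult_left_mono mult_right_mono vi) auto
    finally show ?thesis by (simp add: quartic_error_def)
  qed
  show ?thesis
    by (rule goe_order_mono[OF goe_order_add[OF goe_order_add[OF poly_form_mixed_fourth[OF c, of q]
      goe_order_cmult[OF poly_form_mixed_fourth[OF c, of "pCons 0 q"], of 8]]
      goe_order_cmult[OF a, of "8 * (lam * c) ^ 4"]] _ le])
      (auto simp: quartic_error_def intro!: goe_poly_integrable gauss_poly_intros goe_poly_poly_form)
qed

lemma spike_error_order:
  assumes c: "1 \<le> c" and lam: "0 \<le> lam" and q: "semicircle q = 1"
  shows "goe_order c (\<lambda>n. 1 / sqrt n) (\<lambda>n v i w. spike_error n lam v q (sym_ext w))"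
proof -
  have L1: "goe_order c (\<lambda>n. 1 / sqrt n)
      (\<lambda>n v i w. \<bar>poly_form n (sym_ext w) v P v - semicircle P\<bar>)" for P
    using poly_form_L1[OF c, of "\<lambda>_. None" P] by simp
  have "goe_order c (\<lambda>n. 1 / sqrt n) (\<lambda>n v i w. 2 * lam * \<bar>poly_form n (sym_ext w) v q v - semicircle q\<bar>
     + \<bar>poly_form n (sym_ext w) v (pCons 0 (q * q)) v - semicircle (pCons 0 (q * q))\<bar>
     + 2 * \<bar>poly_form n (sym_ext w) v (q * q) v - semicircle (q * q)\<bar>)"
    using lam by (intro goe_order_add goe_order_cmult L1) auto
  then show ?thesis by (simp add: spike_error_def q)
qed

lemma sdp_value_lower:
  fixes e lam \<kappa> :: real and p q :: "real poly"
  assumes n: "0 < n" and r: "2 \<le> r" and lam: "0 \<le> lam" and e: "0 \<le> e" and \<kappa>: "0 \<le> \<kappa>" "\<kappa> \<le> 2"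
    and v: "\<And>x. (inner_n n v x)\<^sup>2 \<le> bilin n (\<lambda>i j. B0_mat r n S $$ (i, j)) x x"
    and low: "\<And>x. - (26 * inner_n n x x) \<le> bilin n (sym_ext w) x x"
  shows "n * (\<kappa> + e * (lam + semicircle (pCons 0 (q * q)) - 2 * semicircle (q * q) - spike_error n lam v q (sym_ext w)))
      - (\<Sum>i<n. row_error n lam v p \<kappa> (sym_ext w) i)
      - 54 * (e\<^sup>2 * (\<Sum>i<n. quartic_error n lam v q (sym_ext w) i)) - n * (lam * (r / n))
    \<le> sdp_value lam r n S w"
  unfolding sdp_value_def
proof (rule SDP_lower_bound[OF B_mat_carrier sym_ext_sym _ low _ lam e \<kappa>])
  let ?W = "symmetric_mat_of n w" and ?w = "sym_ext w"
  let ?M = "B_mat lam r n S ?W"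
  show W: "?W \<in> carrier_mat n n" by (simp add: symmetric_mat_of_def)
  have ent: "?M $$ (i, j) = lam * B0_mat r n S $$ (i, j) + ?w i j" if "i < n" "j < n" for i j
    using that by (simp add: B_mat_entry[OF W] symmetric_mat_entry)
  show "lam * (inner_n n v x)\<^sup>2 + bilin n ?w x x \<le> bilin n (\<lambda>i j. ?M $$ (i, j)) x x" for x
  proof -
    have "bilin n (\<lambda>i j. ?M $$ (i, j)) x x = (\<Sum>i<n. \<Sum>j<n. lam * (B0_mat r n S $$ (i, j) * (x i * x j)) + ?w i j * (x i * x j))"
      unfolding bilin_def by (intro sum.cong refl) (simp add: ent distrib_right mult.assoc)
    also have "\<dots> = lam * bilin n (\<lambda>i j. B0_mat r n S $$ (i, j)) x x + bilin n ?w x x"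
      by (simp only: sum.distrib bilin_def sum_distrib_left)
    finally show ?thesis using mult_left_mono[OF v lam, of x] by simp
  qed
  show "\<bar>?M $$ (i, i)\<bar> \<le> \<bar>?w i i\<bar> + lam * (r / n)" if i: "i < n" for i
  proof -
    have "\<bar>B0_mat r n S $$ (i, i)\<bar> \<le> r / n"
      using i r by (auto simp: B0_mat_def divide_right_mono)
    then have "lam * \<bar>B0_mat r n S $$ (i, i)\<bar> \<le> lam * (r / n)" using lam by (rule mult_left_mono)
    then show ?thesis
      using abs_triangle_ineq[of "lam * B0_mat r n S $$ (i, i)" "?w i i"] lam by (simp add: ent[OF i i] abs_mult)
  qed
qed

text \<open>Of the gain e g per row, e g / 4 pays for the first-moment errors, e g / 4 for the
  quartic error, e g / 8 for 2 - \<kappa> and e g / 8 for the diagonal of B_0. What remains is e g /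
  4 = 2 \<Delta>; one \<Delta> is the final gain and the other is reserved for concentration. The
  probability is 3 / 4 - 1 / 8 - 1 / 8.\<close>

lemma sdp_value_half:
  assumes r: "2 \<le> r" and lam: "1 < (lam :: real)"
  shows "\<exists>\<Delta>>0. \<exists>n0. \<forall>n\<ge>n0. \<forall>S. 0 < n \<longrightarrow> r dvd n \<longrightarrow> equipartition r n S \<longrightarrow>
    1 / 2 \<le> \<P>(w in goe_vars n. n * (2 + 2 * \<Delta>) \<le> sdp_value lam r n S w)"
proof -
  define c where "c = sqrt (real r)"
  have c: "1 \<le> c" using r by (simp add: c_def)
  have lam0: "0 \<le> lam" using lam by simp
  obtain q where q: "semicircle q = 1" and g0: "0 < lam + semicircle (pCons 0 (q * q)) - 2 * semicircle (q * q)"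
    using spike_poly[OF lam] by blast
  define g where "g = lam + semicircle (pCons 0 (q * q)) - 2 * semicircle (q * q)"
  have g: "0 < g" using g0 by (simp add: g_def)
  obtain KQ where KQ: "KQ \<ge> 0" "\<And>n v i. 0 < n \<Longrightarrow> flat_unit n c v \<Longrightarrow> i < n \<Longrightarrow>
      integrable (goe_vars n) (\<lambda>w. quartic_error n lam v q (sym_ext w) i)"
    "\<And>n v i. 0 < n \<Longrightarrow> flat_unit n c v \<Longrightarrow> i < n \<Longrightarrow>
      (\<integral>w. quartic_error n lam v q (sym_ext w) i \<partial>goe_vars n) \<le> KQ * 1"
    using quartic_error_order[OF c, of lam q] by (rule goe_orderE) blast
  \<comment> \<open>1728 = 54 * 8 * 4: the quartic error then costs exactly e g / 4, see
    \<open>eK\<close>. This is not circular, because \<open>KQ\<close> does not depend on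
    \<open>e\<close>.\<close>
  define e where "e = g / (1728 * (KQ + 1))"
  have e: "0 < e" using g KQ(1) by (simp add: e_def)
  have eK: "54 * (e\<^sup>2 * (8 * (KQ + 1))) = e * g / 4"
  proof -
    have h: "e * (1728 * (KQ + 1)) = g" using KQ(1) by (simp add: e_def)
    have "54 * (e\<^sup>2 * (8 * (KQ + 1))) = e * (e * (1728 * (KQ + 1))) / 4"
      by (simp add: power2_eq_square algebra_simps)
    then show ?thesis unfolding h .
  qed
  have eg: "0 < e * g" using e g by simp
  obtain p \<kappa> where p: "semicircle (p * p) = 1" "semicircle (pCons 0 (p * p)) = \<kappa>"
    \<comment> \<open>The minimum with 1 makes \<kappa> nonnegative.\<close>
    and \<kappa>: "2 - min 1 (e * g / 8) < \<kappa>" "\<kappa> \<le> 2"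
    using edge_poly[of "min 1 (e * g / 8)"] eg by auto
  have \<kappa>0: "0 \<le> \<kappa>" using \<kappa>(1) by linarith
  obtain KR where KR: "KR \<ge> 0" "\<And>n v i. 0 < n \<Longrightarrow> flat_unit n c v \<Longrightarrow> i < n \<Longrightarrow>
      integrable (goe_vars n) (\<lambda>w. row_error n lam v p \<kappa> (sym_ext w) i + e * spike_error n lam v q (sym_ext w))"
    "\<And>n v i. 0 < n \<Longrightarrow> flat_unit n c v \<Longrightarrow> i < n \<Longrightarrow>
      (\<integral>w. row_error n lam v p \<kappa> (sym_ext w) i + e * spike_error n lam v q (sym_ext w) \<partial>goe_vars n)
        \<le> KR * (1 / sqrt n)"
    using goe_order_add[OF row_error_order[OF c lam0 p] goe_order_cmult[OF spike_error_order[OF c lam0 q], of e]] e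
    by (auto elim: goe_orderE)
  define \<Delta> where "\<Delta> = e * g / 8"
  \<comment> \<open>\<open>n1\<close> absorbs the diagonal contribution \<open>lam * r\<close>, and
    \<open>n2\<close> brings Markov's bound for \<open>T\<close> down to 1 / 8.\<close>
  obtain n1 :: nat where n1: "8 * lam * r / (e * g) < n1" using reals_Archimedean2 by blast
  obtain n2 :: nat where n2: "(32 * KR / (e * g))\<^sup>2 < n2" using reals_Archimedean2 by blast
  show ?thesis
  proof (intro exI[of _ \<Delta>] conjI exI[of _ "max n1 n2"] allI impI)
    show "0 < \<Delta>" using eg by (simp add: \<Delta>_def)
    fix n S assume nn: "max n1 n2 \<le> n" and n: "0 < n" and dvd: "r dvd n" and S: "equipartition r n S"
    interpret gaussian_product "upper_indices n" "goe_sd n" by (rule gaussian_product_goe[OF n])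
    obtain v where v: "flat_unit n c v"
      and vB: "\<And>x. (inner_n n v x)\<^sup>2 \<le> bilin n (\<lambda>i j. B0_mat r n S $$ (i, j)) x x"
      using equipartition_spike[OF r n dvd S] unfolding c_def by blast
    obtain E where E: "E \<in> events" "3 / 4 \<le> prob E"
      and low: "\<And>w x. w \<in> E \<Longrightarrow> - (26 * inner_n n x x) \<le> bilin n (sym_ext w) x x"
      using goe_lower_form_bound[OF n] by blast
    define Q where "Q = (\<lambda>w. (\<Sum>i<n. quartic_error n lam v q (sym_ext w) i))"
    \<comment> \<open>The spike error is the same for every i and is spread over the rows, so that a
      single Markov bound handles both errors.\<close>
    define T where "T = (\<lambda>w. (\<Sum>i<n. row_error n lam v p \<kappa> (sym_ext w) i + e * spike_error n lam v q (sym_ext w)))"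
    have Qint: "integrable (goe_vars n) Q"
      unfolding Q_def by (intro Bochner_Integration.integrable_sum KQ(2) n v) simp
    have Tint: "integrable (goe_vars n) T"
      unfolding T_def by (intro Bochner_Integration.integrable_sum KR(2) n v) simp
    have Q0: "0 \<le> Q w" for w unfolding Q_def quartic_error_def by (intro sum_nonneg) simp
    have T0: "0 \<le> T w" for w
      unfolding T_def row_error_def spike_error_def using e lam0
      by (intro add_nonneg_nonneg sum_nonneg mult_nonneg_nonneg) auto
    have EQ: "expectation Q \<le> n * KQ"
    proof -
      have "expectation Q = (\<Sum>i<n. expectation (\<lambda>w. quartic_error n lam v q (sym_ext w) i))"
        unfolding Q_def by (intro Bochner_Integration.integral_sum KQ(2) n v) simp
      also have "\<dots> \<le> (\<Sum>i<n. KQ * 1)" by (intro sum_mono KQ(3) n v) simp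
      finally show ?thesis by simp
    qed
    have ET: "expectation T \<le> n * (KR / sqrt n)"
    proof -
      have "expectation T = (\<Sum>i<n. expectation (\<lambda>w. row_error n lam v p \<kappa> (sym_ext w) i + e * spike_error n lam v q (sym_ext w)))"
        unfolding T_def by (intro Bochner_Integration.integral_sum KR(2) n v) simp
      also have "\<dots> \<le> (\<Sum>i<n. KR * (1 / sqrt n))" by (intro sum_mono KR(3) n v) simp
      finally show ?thesis by simp
    qed
    let ?A = "{w \<in> space (goe_vars n). T w \<ge> n * (e * g / 4)}"
    let ?B = "{w \<in> space (goe_vars n). Q w \<ge> n * (8 * (KQ + 1))}"
    let ?G = "{w \<in> space (goe_vars n). n * (2 + 2 * \<Delta>) \<le> sdp_value lam r n S w}"
    have B: "prob ?B \<le> 1 / 8"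
    proof -
      have "prob ?B \<le> expectation Q / (n * (8 * (KQ + 1)))"
        using n KQ(1) Q0 by (intro integral_Markov_inequality_measure[where A = "{}"] Qint) auto
      also have "\<dots> \<le> (n * KQ) / (n * (8 * (KQ + 1)))"
        using EQ KQ(1) by (intro divide_right_mono) auto
      also have "\<dots> \<le> (n * (KQ + 1)) / (n * (8 * (KQ + 1)))"
        using KQ(1) by (intro divide_right_mono mult_left_mono) auto
      also have "\<dots> = 1 / 8"
      proof -
        have "(a * k) / (a * (8 * k)) = 1 / 8" if "a \<noteq> 0" "k \<noteq> 0" for a k :: real
          using that by simp
        then show ?thesis using n KQ(1) by simp
      qed
      finally show ?thesis .
    qed
    have A: "prob ?A \<le> 1 / 8"
    proof -
      have "prob ?A \<le> expectation T / (n * (e * g / 4))"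
        using n eg T0 by (intro integral_Markov_inequality_measure[where A = "{}"] Tint) auto
      also have "\<dots> \<le> (n * (KR / sqrt n)) / (n * (e * g / 4))"
        using ET eg by (intro divide_right_mono) auto
      also have "\<dots> = (32 * KR / (e * g)) / sqrt n / 8" using n eg by (simp add: field_simps)
      also have "\<dots> \<le> 1 / 8"
      proof -
        have "(32 * KR / (e * g))\<^sup>2 \<le> n" using n2 nn by linarith
        then have le: "32 * KR / (e * g) \<le> sqrt n" by (rule real_le_rsqrt)
        have "x / s / 8 \<le> 1 / 8" if "x \<le> s" "0 < s" for x s :: real
          using that by (simp add: divide_le_eq_1)
        from this[OF le] show ?thesis using n by simp
      qed
      finally show ?thesis .
    qed
    have "E \<subseteq> ?G \<union> (?A \<union> ?B)"
    proof
      fix w assume wE: "w \<in> E"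
      then have ws: "w \<in> space (goe_vars n)" using E(1) sets.sets_into_space by blast
      show "w \<in> ?G \<union> (?A \<union> ?B)"
      proof (cases "w \<in> ?A \<union> ?B")
        case False
        then have TQ: "T w \<le> n * (e * g / 4)" "Q w \<le> n * (8 * (KQ + 1))" using ws by auto
        have "n * (lam * (r / n)) = lam * r" using n by simp
        moreover have "T w = (\<Sum>i<n. row_error n lam v p \<kappa> (sym_ext w) i) + n * (e * spike_error n lam v q (sym_ext w))"
          by (simp add: T_def sum.distrib)
        moreover have "n * (\<kappa> + e * (g - spike_error n lam v q (sym_ext w))) - (\<Sum>i<n. row_error n lam v p \<kappa> (sym_ext w) i)
            - 54 * (e\<^sup>2 * Q w) - n * (lam * (r / n)) \<le> sdp_value lam r n S w"
          unfolding g_def Q_def using e by (intro sdp_value_lower n r lam0 \<kappa>0 \<kappa> vB low[OF wE]) simp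
        moreover have "n * (\<kappa> + e * (g - spike_error n lam v q (sym_ext w))) =
            n * (\<kappa> + e * g) - n * (e * spike_error n lam v q (sym_ext w))"
          by (simp add: algebra_simps)
        ultimately have "n * (\<kappa> + e * g) - T w - 54 * (e\<^sup>2 * Q w) - lam * r \<le> sdp_value lam r n S w"
          by linarith
        moreover have "54 * (e\<^sup>2 * Q w) \<le> n * (e * g / 4)"
        proof -
          have "54 * (e\<^sup>2 * Q w) \<le> 54 * (e\<^sup>2 * (n * (8 * (KQ + 1))))"
            using TQ(2) by (intro mult_left_mono) auto
          also have "\<dots> = n * (54 * (e\<^sup>2 * (8 * (KQ + 1))))" by simp
          finally show ?thesis by (simp only: eK)
        qed
        moreover have "n * (2 - e * g / 8) \<le> n * \<kappa>" using \<kappa>(1) by (intro mult_left_mono) auto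
        moreover have "lam * r \<le> n * (e * g / 8)"
        proof -
          have "8 * lam * r / (e * g) \<le> n" using n1 nn by linarith
          then show ?thesis using eg by (simp add: pos_divide_le_eq)
        qed
        moreover have "n * (\<kappa> + e * g) = n * \<kappa> + 8 * (n * (e * g / 8))"
          "n * (e * g / 4) = 2 * (n * (e * g / 8))"
          "n * (2 - e * g / 8) = 2 * n - n * (e * g / 8)"
          "n * (2 + 2 * \<Delta>) = 2 * n + 2 * (n * (e * g / 8))"
          by (simp_all add: \<Delta>_def algebra_simps)
        ultimately have "n * (2 + 2 * \<Delta>) \<le> sdp_value lam r n S w"
          using TQ(1) by linarith
        then show ?thesis using ws by simp
      qed simp
    qed
    moreover have meas: "?G \<in> events" "?A \<in> events" "?B \<in> events"
      using sdp_value_measurable[of lam r n S] Tint Qint by measurable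
    ultimately have "prob E \<le> prob (?G \<union> (?A \<union> ?B))"
      by (intro finite_measure_mono) auto
    also have "\<dots> \<le> prob ?G + prob (?A \<union> ?B)"
      using meas by (intro measure_Un_le) auto
    also have "prob (?A \<union> ?B) \<le> prob ?A + prob ?B"
      using meas by (intro measure_Un_le) auto
    finally show "1 / 2 \<le> prob ?G" using E(2) A B by linarith
  qed
qed

text \<open>The probability 1 / 2 improves to 1 - O(1 / n), since the variance is at most 8 n while
  a deviation of order n is permitted. The gain depends on r and \<lambda> only and is fixed before
  the partitions; the filter is n \<rightarrow> \<infinity> along the multiples of r.\<close>

theorem theoremJ2:
  fixes r :: nat and lam :: real
  assumes "2 \<le> r" and "1 < lam"
  shows "\<exists>\<Delta>>0. \<forall>S :: nat \<Rightarrow> nat \<Rightarrow> nat set.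
    (\<forall>n. r dvd n \<longrightarrow> equipartition r n (S n)) \<longrightarrow>
    ((\<lambda>n. \<P>(W in GOE n. SDP (B_mat lam r n (S n) W) / real n \<ge> 2 + \<Delta>)) \<longlongrightarrow> 1)
      (inf sequentially (principal {n. r dvd n}))"
proof -
  obtain \<Delta> n0 where \<Delta>: "0 < \<Delta>" and half: "\<And>n S. n0 \<le> n \<Longrightarrow> 0 < n \<Longrightarrow> r dvd n \<Longrightarrow> equipartition r n S \<Longrightarrow>
    1 / 2 \<le> \<P>(w in goe_vars n. n * (2 + 2 * \<Delta>) \<le> sdp_value lam r n S w)"
    using sdp_value_half[OF assms] by blast
  \<comment> \<open>With d = n \<Delta> / 2 Chebyshev's bound is 8 n / d^2 = 32 / (\<Delta>^2 n),
    which is below 1 / 2 as soon as n > 64 / \<Delta>^2.\<close>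
  obtain n1 :: nat where n1: "64 / \<Delta>\<^sup>2 < n1" using reals_Archimedean2 by blast
  let ?F = "inf sequentially (principal {n. r dvd n})"
  show ?thesis
  proof (intro exI[of _ \<Delta>] conjI allI impI)
    fix S :: "nat \<Rightarrow> nat \<Rightarrow> nat set"
    assume S: "\<forall>n. r dvd n \<longrightarrow> equipartition r n (S n)"
    let ?p = "\<lambda>n. \<P>(W in GOE n. SDP (B_mat lam r n (S n) W) / real n \<ge> 2 + \<Delta>)"
    have lower: "1 - 32 / \<Delta>\<^sup>2 / n \<le> ?p n" if n: "max (max n0 n1) 1 \<le> n" "r dvd n" for n
    proof -
      have n0: "0 < n" using n by simp
      have d: "0 < n * \<Delta> / 2" using n0 \<Delta> by simp
      have Vd: "(8 * n) / (n * \<Delta> / 2)\<^sup>2 = 32 / \<Delta>\<^sup>2 / n"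
        using n0 \<Delta> by (simp add: field_simps power2_eq_square)
      have "64 / \<Delta>\<^sup>2 < n" using n1 n by linarith
      then have "32 / \<Delta>\<^sup>2 < 1 / 2 * n" by simp
      then have small: "32 / \<Delta>\<^sup>2 / n < 1 / 2" using n0 by (simp only: pos_divide_less_eq of_nat_0_less_iff)
      have "1 - 32 / \<Delta>\<^sup>2 / n = 1 - (8 * n) / (n * \<Delta> / 2)\<^sup>2" by (simp only: Vd)
      also have "\<dots> \<le> \<P>(w in goe_vars n. n * (2 + 2 * \<Delta>) - 2 * (n * \<Delta> / 2) \<le> sdp_value lam r n (S n) w)"
      proof (rule gauss_lipschitz_lower_tail[OF _ finite_upper_indices sdp_value_measurable sdp_value_lipschitz d])
        show "0 < goe_sd n i" for i using n0 by (cases i) (simp add: goe_sd_def)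
        show "2\<^sup>2 * (\<Sum>u\<in>upper_indices n. (goe_sd n u)\<^sup>2) \<le> 8 * n"
          using goe_variance_sum[OF n0] by simp
        show "(8 * n) / (n * \<Delta> / 2)\<^sup>2 < 1 / 2" unfolding Vd by (rule small)
        show "1 / 2 \<le> \<P>(w in goe_vars n. n * (2 + 2 * \<Delta>) \<le> sdp_value lam r n (S n) w)"
          using S n n0 by (intro half) auto
      qed
      also have "n * (2 + 2 * \<Delta>) - 2 * (n * \<Delta> / 2) = n * (2 + \<Delta>)" by (simp add: algebra_simps)
      finally show ?thesis unfolding GOE_prob_eq[OF n0] .
    qed
    show "(?p \<longlongrightarrow> 1) ?F"
    proof (rule tendsto_sandwich)
      show "\<forall>\<^sub>F n in ?F. 1 - 32 / \<Delta>\<^sup>2 / n \<le> ?p n"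
        unfolding eventually_inf_principal
        using eventually_ge_at_top[of "max (max n0 n1) 1"] by eventually_elim (use lower in auto)
      show "\<forall>\<^sub>F n in ?F. ?p n \<le> 1"
        unfolding eventually_inf_principal
        using eventually_gt_at_top[of 0]
        by eventually_elim (use prob_space.prob_le_1[OF prob_space_GOE] in auto)
      have "(\<lambda>n. 1 - 32 / \<Delta>\<^sup>2 / real n) \<longlonglongrightarrow> 1 - 0"
        by (intro tendsto_intros lim_const_over_n)
      then show "((\<lambda>n. 1 - 32 / \<Delta>\<^sup>2 / real n) \<longlongrightarrow> 1) ?F"
        by (simp add: tendsto_mono[OF inf_le1])
    qed simp
  qed (rule \<Delta>)
qed

end
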